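(* Let $U$ be a solution on $[t_0,\infty)$ of the two-dimensional incompressible Navier--Stokes equations $\frac{dU}{dt}+\nu AU+B(U,U)=f$ satisfying the working assumptions stated in the context, and let $c_1>0$. For every $\delta>0$ there exist $\lambda>0$ (large enough) and $h>0$ (small enough) such that, if $I_h$ is a type-I interpolant observable with constant $c_1$ and length scale $h$ and $u$ is the approximating solution produced from $U$ by spectrally-filtered discrete-in-time downscaling data assimilation with parameters $\delta,\lambda,I_h$, then $\|U(t)-u(t)\|\to 0$ as $t\to\infty$. Moreover, the rate of convergence is exponential in time: there are constants $K,\alpha>0$ with $\|U(t)-u(t)\|\le Ke^{-\alpha(t-t_0)}$ for all $t\ge t_0$.
   Context: **Spaces and operators.** $\Omega=[0,L]^2$ with periodic boundary conditions, $\nu>0$, $f\in L^\infty([t_0,\infty);H)$. $\mathcal V$ is the set of divergence-free $L$-periodic $\mathbb{R}^2$-valued trigonometric polynomials with zero spatial average; $H$ is its closure in $L^2(\Omega;\mathbb{R}^2)$, $V$ its closure in $H^1(\Omega;\mathbb{R}^2)$, $V^*$ the dual of $V$; $P_\sigma$ is the orthogonal projection of $L^2(\Omega;\mathbb{R}^2)$ onto $H$. $A:V\to V^*$ and $B:V\times V\to V^*$ are the continuous extensions of $Au=-P_\sigma\Delta u$ and $B(u,v)=P_\sigma(u\cdot\nabla v)$, $u,v\in\mathcal V$. $\mathcal D(A)=H^2(\Omega)\cap V$. Let $\mathcal J=\{\frac{2\pi}{L}(n_1,n_2):(n_1,n_2)\in\mathbb{Z}^2\setminus\{(0,0)\}\}$.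 For $U=\sum_{k\in\mathcal J}\widehat U_ke^{ik\cdot x}\in H$ put $\|U\|_\alpha^2=L^2\sum_{k\in\mathcal J}|k|^{2\alpha}|\widehat U_k|^2$, $|U|=\|U\|_0$, $\|U\|=\|U\|_1$, $|AU|=\|U\|_2$. $\lambda_1=(2\pi/L)^2$. **Semi-process.** $S(t,s;u_s)$ denotes the value at time $t\ge s$ of the solution of $\frac{du}{dt}+\nu Au+B(u,u)=f$ with $u(s)=u_s$. **Type-I interpolant observable.** A linear operator $I_h:V\to L^2(\Omega;\mathbb{R}^2)$ is a type-I interpolant observable (with constant $c_1>0$ and length scale $h>0$) if $\|U-I_hU\|_{L^2}^2\le c_1h^2\|U\|^2$ for all $U\in V$. **Spectral filter.** For $\lambda>0$, $P_\lambda U=\sum_{|k|^2\le\lambda}\widehat U_ke^{ik\cdot x}$ on $H$; $J=P_\lambda P_\sigma I_h$ and $E=I-J$. **Algorithm (spectrally-filtered discrete-in-time downscaling data assimilation).** Let $t_n=t_0+n\delta$. Given $U$, define $u_0=JU(t_0)$, $u_{n+1}=E\,S(t_{n+1},t_n;u_n)+JU(t_{n+1})$, and $u(t)=S(t,t_n;u_n)$ for $t\in[t_n,t_{n+1})$, $n=0,1,2,\dots$. **Working assumptions (type-I case).** There are constants $\rho_H,\rho_V$ (determined by $f$, $\Omega$, $\nu$) such that, for all $t\ge t_0$, $|U(t)|\le\rho_H$, $\|U(t)\|\le\rho_V$, and for every $\delta>0$, $\int_t^{t+\delta}|AU(s)|^2ds\le\left(\frac1\nu+\frac{\delta\lambda_1}{2}\right)\rho_V^2$.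 For solutions with other initial conditions, the norms and time integrals appearing in these bounds are assumed to be finite at times after the initial time. *)

theory Defs
  imports "HOL-Analysis.Analysis"
begin

text \<open>Vector fields on the torus are represented by functions \<open>real^2 \<Rightarrow> real^2\<close> of which only the
  restriction to the square matters, up to almost everywhere equality.\<close>

type_synonym field = "real^2 \<Rightarrow> real^2"

definition Omega :: "real \<Rightarrow> (real^2) set" where
  "Omega L = {x. \<forall>i. 0 \<le> x $ i \<and> x $ i \<le> L}"

definition aeq :: "real \<Rightarrow> field \<Rightarrow> field \<Rightarrow> bool" where
  "aeq L u v \<longleftrightarrow> (AE x in lebesgue_on (Omega L). u x = v x)"

definition L2 :: "real \<Rightarrow> field set" where
  "L2 L = {u \<in> borel_measurable (lebesgue_on (Omega L)).
             integrable (lebesgue_on (Omega L)) (\<lambda>x. (norm (u x))\<^sup>2)}"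

definition L2_inner :: "real \<Rightarrow> field \<Rightarrow> field \<Rightarrow> real" where
  "L2_inner L u v = (\<integral>x. u x \<bullet> v x \<partial>lebesgue_on (Omega L))"

definition L2_norm :: "real \<Rightarrow> field \<Rightarrow> real" where
  "L2_norm L u = sqrt (L2_inner L u u)"

definition pd :: "2 \<Rightarrow> field \<Rightarrow> field" where
  "pd i u x = vector_derivative (\<lambda>s. u (x + s *\<^sub>R axis i 1)) (at 0)"

definition laplacian :: "field \<Rightarrow> field" where
  "laplacian u x = (\<Sum>i\<in>UNIV. pd i (pd i u) x)"

definition divergence :: "field \<Rightarrow> real^2 \<Rightarrow> real" where
  "divergence u x = (\<Sum>i\<in>UNIV. pd i u x $ i)"

definition convection :: "field \<Rightarrow> field \<Rightarrow> field" where
  "convection u v x = (\<Sum>i\<in>UNIV. u x $ i *\<^sub>R pd i v x)"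

definition freqs :: "real \<Rightarrow> (real^2) set" where
  "freqs L = {(2 * pi / L) *\<^sub>R vector [of_int n1, of_int n2] | n1 n2 :: int. (n1, n2) \<noteq> (0, 0)}"

definition trig_poly :: "real \<Rightarrow> field set" where
  "trig_poly L = {u. \<exists>F a b. finite F \<and> F \<subseteq> insert 0 (freqs L) \<and>
      u = (\<lambda>x. \<Sum>k\<in>F. cos (k \<bullet> x) *\<^sub>R a k + sin (k \<bullet> x) *\<^sub>R b k)}"

definition sol_poly :: "real \<Rightarrow> field set" where
  "sol_poly L = {u \<in> trig_poly L. (\<forall>x. divergence u x = 0) \<and>
      (\<integral>x. u x \<partial>lebesgue_on (Omega L)) = 0}"

definition H :: "real \<Rightarrow> field set" where
  "H L = {u \<in> L2 L. \<forall>\<epsilon>>0. \<exists>\<phi>\<in>sol_poly L. L2_norm L (\<lambda>x. u x - \<phi> x) < \<epsilon>}"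

text \<open>Weak derivatives on the torus: testing with trigonometric polynomials is the same as testing
  with smooth periodic fields, by density.\<close>

definition weak_pd :: "real \<Rightarrow> 2 \<Rightarrow> field \<Rightarrow> field \<Rightarrow> bool" where
  "weak_pd L i u g \<longleftrightarrow> g \<in> L2 L \<and>
     (\<forall>\<phi>\<in>trig_poly L. L2_inner L u (pd i \<phi>) = - L2_inner L g \<phi>)"

definition H1 :: "real \<Rightarrow> field set" where
  "H1 L = {u \<in> L2 L. \<forall>i. \<exists>g. weak_pd L i u g}"

definition H1_norm :: "real \<Rightarrow> field \<Rightarrow> real" where
  "H1_norm L u = sqrt ((L2_norm L u)\<^sup>2 + (\<Sum>i\<in>UNIV. (L2_norm L (SOME g. weak_pd L i u g))\<^sup>2))"

definition V :: "real \<Rightarrow> field set" where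
  "V L = {u \<in> H1 L. \<forall>\<epsilon>>0. \<exists>\<phi>\<in>sol_poly L. H1_norm L (\<lambda>x. u x - \<phi> x) < \<epsilon>}"

text \<open>The orthogonal projection of \<open>L2\<close> onto \<open>H\<close>; determined up to almost everywhere equality.\<close>

definition leray :: "real \<Rightarrow> field \<Rightarrow> field" where
  "leray L g = (SOME h. h \<in> H L \<and> (\<forall>w\<in>H L. L2_inner L (\<lambda>x. g x - h x) w = 0))"

definition fourier_coeff :: "real \<Rightarrow> field \<Rightarrow> real^2 \<Rightarrow> complex^2" where
  "fourier_coeff L u k =
     (\<chi> j. (\<integral>x. of_real (u x $ j) * cis (- (k \<bullet> x)) \<partial>lebesgue_on (Omega L)) / of_real (L\<^sup>2))"

text \<open>The squared norm takes the value \<open>\<infinity>\<close> when the series diverges. The real-valued norm is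
  meaningful only where the squared norm is finite, e.g. on \<open>V\<close> for exponents at most \<open>1\<close>.\<close>

definition sob_sq :: "real \<Rightarrow> real \<Rightarrow> field \<Rightarrow> ennreal" where
  "sob_sq L \<alpha> u = ennreal (L\<^sup>2) *
     (\<Sum>\<^sub>\<infinity>k\<in>freqs L. ennreal (norm k powr (2 * \<alpha>) * (norm (fourier_coeff L u k))\<^sup>2))"

definition sob_norm :: "real \<Rightarrow> real \<Rightarrow> field \<Rightarrow> real" where
  "sob_norm L \<alpha> u = sqrt (enn2real (sob_sq L \<alpha> u))"

text \<open>The operators \<open>A\<close> and \<open>B\<close> enter through the duality pairings of their values with elements
  of \<open>V\<close>. On polynomial fields a value lies in \<open>H\<close> and the pairing is the inner product; elsewhere
  it is the limit along polynomial approximations in \<open>V\<close> (extension by continuity).\<close>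

definition V_limit :: "real \<Rightarrow> (nat \<Rightarrow> field) \<Rightarrow> field \<Rightarrow> bool" where
  "V_limit L \<phi> u \<longleftrightarrow> (\<forall>n. \<phi> n \<in> sol_poly L) \<and>
     (\<lambda>n. sob_norm L 1 (\<lambda>x. \<phi> n x - u x)) \<longlonglongrightarrow> 0"

definition A_pairing :: "real \<Rightarrow> field \<Rightarrow> field \<Rightarrow> real" where
  "A_pairing L u w = (THE a. \<forall>\<phi>. V_limit L \<phi> u \<longrightarrow>
     (\<lambda>n. L2_inner L (\<lambda>x. - leray L (laplacian (\<phi> n)) x) w) \<longlonglongrightarrow> a)"

definition B_pairing :: "real \<Rightarrow> field \<Rightarrow> field \<Rightarrow> field \<Rightarrow> real" where
  "B_pairing L u v w = (THE b. \<forall>\<phi> \<psi>. V_limit L \<phi> u \<and> V_limit L \<psi> v \<longrightarrow>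
     (\<lambda>n. L2_inner L (leray L (convection (\<phi> n) (\<psi> n))) w) \<longlonglongrightarrow> b)"

text \<open>Measurability is imposed weakly; as \<open>H\<close> is separable, this is strong measurability
  by Pettis' theorem.\<close>

definition Linf_H :: "real \<Rightarrow> real \<Rightarrow> (real \<Rightarrow> field) \<Rightarrow> bool" where
  "Linf_H L t0 f \<longleftrightarrow>
     (\<forall>w\<in>H L. (\<lambda>t. L2_inner L (f t) w) \<in> borel_measurable (lebesgue_on {t0..})) \<and>
     (\<exists>M. AE t in lebesgue_on {t0..}. f t \<in> H L \<and> L2_norm L (f t) \<le> M)"

text \<open>Strong solutions on \<open>[s,\<infinity>)\<close>, of class \<open>C([s,\<infinity>);V)\<close> and locally square integrable into
  \<open>D(A)\<close>. The equation \<open>du/dt + \<nu>Au + B(u,u) = f\<close> in the dual of \<open>V\<close> is imposed in integrated form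
  against every element of \<open>V\<close>.\<close>

definition nse_solution :: "real \<Rightarrow> real \<Rightarrow> (real \<Rightarrow> field) \<Rightarrow> real \<Rightarrow> (real \<Rightarrow> field) \<Rightarrow> bool" where
  "nse_solution L \<nu> f s u \<longleftrightarrow>
     (\<forall>t\<ge>s. u t \<in> V L) \<and>
     (\<forall>t\<ge>s. ((\<lambda>r. sob_norm L 1 (\<lambda>x. u r x - u t x)) \<longlongrightarrow> 0) (at t within {s..})) \<and>
     (\<forall>t\<ge>s. (\<integral>\<^sup>+r. sob_sq L 2 (u r) \<partial>lebesgue_on {s..t}) < \<infinity>) \<and>
     (\<forall>w\<in>V L. \<forall>t\<ge>s.
        L2_inner L (u t) w
          + (\<integral>r. \<nu> * A_pairing L (u r) w + B_pairing L (u r) (u r) w \<partial>lebesgue_on {s..t})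
        = L2_inner L (u s) w + (\<integral>r. L2_inner L (f r) w \<partial>lebesgue_on {s..t}))"

text \<open>The semi-process as a relation: \<open>v t = S(t,s;us)\<close> for all \<open>t \<ge> s\<close>.\<close>

definition semi_process ::
  "real \<Rightarrow> real \<Rightarrow> (real \<Rightarrow> field) \<Rightarrow> real \<Rightarrow> field \<Rightarrow> (real \<Rightarrow> field) \<Rightarrow> bool" where
  "semi_process L \<nu> f s us v \<longleftrightarrow> nse_solution L \<nu> f s v \<and> aeq L (v s) us"

text \<open>Linearity up to null sets; together with the error bound it makes the operator well defined on
  classes of almost everywhere equal fields.\<close>

definition type_I_interpolant :: "real \<Rightarrow> real \<Rightarrow> real \<Rightarrow> (field \<Rightarrow> field) \<Rightarrow> bool" where
  "type_I_interpolant L c1 h I \<longleftrightarrow>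
     (\<forall>v\<in>V L. I v \<in> L2 L) \<and>
     (\<forall>v\<in>V L. \<forall>w\<in>V L. \<forall>a b.
        aeq L (I (\<lambda>x. a *\<^sub>R v x + b *\<^sub>R w x)) (\<lambda>x. a *\<^sub>R I v x + b *\<^sub>R I w x)) \<and>
     (\<forall>v\<in>V L. (L2_norm L (\<lambda>x. v x - I v x))\<^sup>2 \<le> c1 * h\<^sup>2 * (sob_norm L 1 v)\<^sup>2)"

text \<open>The sum is real already, as the coefficients at \<open>k\<close> and \<open>-k\<close> are conjugate; \<open>Re\<close> only
  adjusts the type.\<close>

definition spectral_proj :: "real \<Rightarrow> real \<Rightarrow> field \<Rightarrow> field" where
  "spectral_proj L lam u x =
     (\<chi> j. Re (\<Sum>k\<in>{k \<in> freqs L. (norm k)\<^sup>2 \<le> lam}. fourier_coeff L u k $ j * cis (k \<bullet> x)))"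

definition J_op :: "real \<Rightarrow> real \<Rightarrow> (field \<Rightarrow> field) \<Rightarrow> field \<Rightarrow> field" where
  "J_op L lam I u = spectral_proj L lam (leray L (I u))"

definition E_op :: "real \<Rightarrow> real \<Rightarrow> (field \<Rightarrow> field) \<Rightarrow> field \<Rightarrow> field" where
  "E_op L lam I u = (\<lambda>x. u x - J_op L lam I u x)"

text \<open>\<open>un n\<close> is the (re)initialised state at time \<open>t0 + n\<delta>\<close> and \<open>S n\<close> the trajectory issuing from it.\<close>

definition approximating_solution ::
  "real \<Rightarrow> real \<Rightarrow> (real \<Rightarrow> field) \<Rightarrow> real \<Rightarrow> real \<Rightarrow> real \<Rightarrow> (field \<Rightarrow> field)
     \<Rightarrow> (real \<Rightarrow> field) \<Rightarrow> (real \<Rightarrow> field) \<Rightarrow> bool" where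
  "approximating_solution L \<nu> f t0 \<delta> lam I U u \<longleftrightarrow>
     (\<exists>(un :: nat \<Rightarrow> field) (S :: nat \<Rightarrow> real \<Rightarrow> field).
        let tn = (\<lambda>n :: nat. t0 + real n * \<delta>) in
        aeq L (un 0) (J_op L lam I (U t0)) \<and>
        (\<forall>n. semi_process L \<nu> f (tn n) (un n) (S n) \<and>
             aeq L (un (Suc n))
               (\<lambda>x. E_op L lam I (S n (tn (Suc n))) x + J_op L lam I (U (tn (Suc n))) x) \<and>
             (\<forall>t\<in>{tn n..<tn (Suc n)}. aeq L (u t) (S n t))))"

end

theory Submission
  imports Defs
begin

text \<open>
  On \<open>[t\<^sub>n, t\<^sub>n\<^sub>+\<^sub>1]\<close> let \<open>w\<close> be the difference of the reference solution and the approximation. In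
  Fourier variables, with \<open>\<sigma> = 1/4\<close>, the quadratic term obeys
  \<open>\<parallel>B(U,U) - B(u,u)\<parallel>\<^sub>-\<^sub>\<sigma> \<le> C R \<parallel>w\<parallel>\<^sub>1\<close> and \<open>\<parallel>B(U,U) - B(u,u)\<parallel>\<^sub>-\<^sub>1\<^sub>-\<^sub>\<sigma> \<le> C R |w|\<close>, \<open>R\<close> bounding
  \<open>\<parallel>U\<parallel> + \<parallel>u\<parallel>\<close>; both follow from \<open>1 / (|k|\<^sup>\<sigma> |p|) \<le> |k|\<^sup>-\<^sup>1\<^sup>-\<^sup>\<sigma> + |p|\<^sup>-\<^sup>1\<^sup>-\<^sup>\<sigma>\<close> and the square summability
  of \<open>|k|\<^sup>-\<^sup>1\<^sup>-\<^sup>\<sigma>\<close> over a planar lattice. Duhamel's formula for each mode then gives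
  \<open>\<parallel>w(t)\<parallel> \<le> exp(-\<nu>\<lambda>\<^sub>1(t - t\<^sub>n)) \<parallel>w(t\<^sub>n)\<parallel> + C R \<integral> (t - r)\<^sup>-\<^sup>7\<^sup>/\<^sup>8 sqrt (\<parallel>w(r)\<parallel> |w(r)|) dr\<close>, and a
  Gronwall argument bounds \<open>|w(r)|\<close> by a multiple of \<open>|w(t\<^sub>n)|\<close>. The filtered update satisfies
  \<open>\<parallel>E w\<parallel>\<^sup>2 \<le> (1 + \<lambda> c\<^sub>1 h\<^sup>2) \<parallel>w\<parallel>\<^sup>2\<close> and \<open>|E w|\<^sup>2 \<le> (1/\<lambda> + c\<^sub>1 h\<^sup>2) \<parallel>w\<parallel>\<^sup>2\<close>. Hence for large \<open>\<lambda>\<close> and then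
  small \<open>h\<close> the integral is negligible, and one cycle contracts \<open>\<parallel>w\<parallel>\<close> by a factor
  \<open>\<gamma> < 1\<close>; a continuity argument keeps \<open>\<parallel>w\<parallel>\<close>, and with it \<open>R\<close>, bounded within the cycle.
\<close>

section \<open>The space \<open>L\<^sup>2\<close> on the torus\<close>

text \<open>The value \<sigma> = 1/4 is a compromise. Square summability of the weight
  \<open>|k|^(-1-\<sigma>)\<close> over a planar lattice needs \<sigma> > 0. Smoothed by the heat
  semigroup up to the V-norm, the two bounds on the nonlinearity come with time kernels of orders
  (1+\<sigma>)/2 = 5/8 and (2+\<sigma>)/2 = 9/8. The second is not integrable, but it carries the
  H-norm, which the filter makes small. The geometric mean has order (3+2\<sigma>)/4 = 7/8, is
  integrable as long as \<sigma> < 1/2, and still contains the square root of the H-norm. The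
  obstacle is a loop: the factor R involves the approximation, whose size is the very thing to be
  bounded. It is cut by fixing a radius \<open>b0\<close> for the initial error, and with it R,
  before \<kappa>, \<epsilon>, \<lambda> and h are chosen in this order; the induction over the
  cycles keeps the error below a fixed multiple of \<open>b0\<close>. Testing with single solenoidal
  modes turns the equation into scalar integral equations. Subtracting two of them cancels the
  forcing, which is only measurable in time, and leaves continuous integrands.\<close>

lemma Omega_cbox: "Omega L = cbox 0 (\<chi> i. L)"
  by (auto simp: Omega_def mem_box_cart)

locale torus =
  fixes L :: real
  assumes L_pos: "L > 0"
begin

abbreviation M where "M \<equiv> lebesgue_on (Omega L)"

lemma continuous_integrable:
  fixes g :: "real^2 \<Rightarrow> 'b::euclidean_space"
  assumes "continuous_on UNIV g"
  shows "integrable M g"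
  unfolding Omega_cbox
  by (rule continuous_imp_integrable) (rule continuous_on_subset[OF assms], simp)

lemma continuous_measurable:
  fixes g :: "real^2 \<Rightarrow> 'b::euclidean_space"
  assumes "continuous_on UNIV g"
  shows "g \<in> borel_measurable M"
  using continuous_integrable[OF assms] by (rule borel_measurable_integrable)

lemma continuous_in_L2: "continuous_on UNIV g \<Longrightarrow> g \<in> L2 L"
  unfolding L2_def
  by (auto intro!: continuous_measurable continuous_integrable continuous_intros)

lemma L2_measurable: "u \<in> L2 L \<Longrightarrow> u \<in> borel_measurable M"
  and L2_sq_integrable: "u \<in> L2 L \<Longrightarrow> integrable M (\<lambda>x. (norm (u x))\<^sup>2)"
  by (auto simp: L2_def)

lemma L2_inner_integrable:
  assumes "u \<in> L2 L" "v \<in> L2 L"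
  shows "integrable M (\<lambda>x. u x \<bullet> v x)"
proof (rule Bochner_Integration.integrable_bound)
  show "integrable M (\<lambda>x. (norm (u x))\<^sup>2 + (norm (v x))\<^sup>2)"
    using assms by (intro Bochner_Integration.integrable_add L2_sq_integrable)
  show "(\<lambda>x. u x \<bullet> v x) \<in> borel_measurable M"
    using assms[THEN L2_measurable] by measurable
  show "AE x in M. norm (u x \<bullet> v x) \<le> norm ((norm (u x))\<^sup>2 + (norm (v x))\<^sup>2)"
  proof (rule AE_I2)
    fix x
    have "\<bar>u x \<bullet> v x\<bar> \<le> norm (u x) * norm (v x)" by (rule Cauchy_Schwarz_ineq2)
    also have "\<dots> \<le> (norm (u x))\<^sup>2 + (norm (v x))\<^sup>2"
      using sum_squares_bound[of "norm (u x)" "norm (v x)"]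
        mult_nonneg_nonneg[OF norm_ge_zero[of "u x"] norm_ge_zero[of "v x"]] by linarith
    finally show "norm (u x \<bullet> v x) \<le> norm ((norm (u x))\<^sup>2 + (norm (v x))\<^sup>2)" by simp
  qed
qed

text \<open>The square has finite measure, so constant fields lie in \<open>L2\<close>, and pairing
  with them yields the components.\<close>

lemma L2_integrable:
  assumes "u \<in> L2 L" shows "integrable M u"
proof -
  have "integrable M (\<lambda>x. u x \<bullet> axis i 1)" for i
    using L2_inner_integrable[OF assms continuous_in_L2] continuous_on_const by blast
  then show ?thesis
    by (subst integrable_iff_component) (auto simp: inner_axis Omega_cbox)
qed

lemma L2_add: assumes "u \<in> L2 L" "v \<in> L2 L" shows "(\<lambda>x. u x + v x) \<in> L2 L"
proof -
  have "integrable M (\<lambda>x. u x \<bullet> u x + 2 * (u x \<bullet> v x) + v x \<bullet> v x)"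
    using assms by (intro Bochner_Integration.integrable_add integrable_mult_right L2_inner_integrable)
  also have "(\<lambda>x. u x \<bullet> u x + 2 * (u x \<bullet> v x) + v x \<bullet> v x) = (\<lambda>x. (norm (u x + v x))\<^sup>2)"
    by (auto simp: power2_norm_eq_inner inner_add algebra_simps inner_commute)
  finally show ?thesis using assms[THEN L2_measurable] unfolding L2_def by auto
qed

lemma L2_scale: "u \<in> L2 L \<Longrightarrow> (\<lambda>x. c *\<^sub>R u x) \<in> L2 L"
  unfolding L2_def by (auto simp: power_mult_distrib)

lemma L2_uminus: "u \<in> L2 L \<Longrightarrow> (\<lambda>x. - u x) \<in> L2 L"
  using L2_scale[of u "-1"] by simp

lemma L2_diff: "u \<in> L2 L \<Longrightarrow> v \<in> L2 L \<Longrightarrow> (\<lambda>x. u x - v x) \<in> L2 L"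
  using L2_add[of u "\<lambda>x. - v x"] L2_uminus by simp

lemma L2_inner_commute: "L2_inner L u v = L2_inner L v u"
  by (simp add: L2_inner_def inner_commute)

lemma L2_inner_add_left:
  "u \<in> L2 L \<Longrightarrow> v \<in> L2 L \<Longrightarrow> w \<in> L2 L \<Longrightarrow>
   L2_inner L (\<lambda>x. u x + v x) w = L2_inner L u w + L2_inner L v w"
  unfolding L2_inner_def by (simp add: inner_add_left L2_inner_integrable)

lemma L2_inner_scale_left: "L2_inner L (\<lambda>x. c *\<^sub>R u x) w = c * L2_inner L u w"
  unfolding L2_inner_def by simp

lemma L2_inner_uminus_left: "L2_inner L (\<lambda>x. - u x) w = - L2_inner L u w"
  unfolding L2_inner_def by simp

lemma L2_inner_diff_left:
  "u \<in> L2 L \<Longrightarrow> v \<in> L2 L \<Longrightarrow> w \<in> L2 L \<Longrightarrow>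
   L2_inner L (\<lambda>x. u x - v x) w = L2_inner L u w - L2_inner L v w"
  unfolding L2_inner_def by (simp add: inner_diff_left L2_inner_integrable)

lemma L2_inner_diff_right:
  "u \<in> L2 L \<Longrightarrow> v \<in> L2 L \<Longrightarrow> w \<in> L2 L \<Longrightarrow>
   L2_inner L w (\<lambda>x. u x - v x) = L2_inner L w u - L2_inner L w v"
  by (simp add: L2_inner_commute[of w] L2_inner_diff_left)

lemma L2_inner_add_right:
  "u \<in> L2 L \<Longrightarrow> v \<in> L2 L \<Longrightarrow> w \<in> L2 L \<Longrightarrow>
   L2_inner L w (\<lambda>x. u x + v x) = L2_inner L w u + L2_inner L w v"
  by (simp add: L2_inner_commute[of w] L2_inner_add_left)

lemma L2_inner_scale_right: "L2_inner L w (\<lambda>x. c *\<^sub>R u x) = c * L2_inner L w u"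
  by (simp add: L2_inner_commute[of w] L2_inner_scale_left)

lemma L2_inner_self_nonneg: "L2_inner L u u \<ge> 0"
  unfolding L2_inner_def by (rule Bochner_Integration.integral_nonneg) simp

lemma L2_norm_sq: "(L2_norm L u)\<^sup>2 = L2_inner L u u"
  by (simp add: L2_norm_def L2_inner_self_nonneg)

lemma L2_norm_nonneg: "L2_norm L u \<ge> 0"
  by (simp add: L2_norm_def L2_inner_self_nonneg)

lemma L2_norm_diff_commute: "L2_norm L (\<lambda>x. u x - v x) = L2_norm L (\<lambda>x. v x - u x)"
proof -
  have "(u x - v x) \<bullet> (u x - v x) = (v x - u x) \<bullet> (v x - u x)" for x
    by (simp add: inner_diff algebra_simps)
  then show ?thesis by (simp add: L2_norm_def L2_inner_def)
qed

lemma L2_norm_sq_add: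
  assumes "u \<in> L2 L" "v \<in> L2 L"
  shows "(L2_norm L (\<lambda>x. u x + v x))\<^sup>2 = (L2_norm L u)\<^sup>2 + 2 * L2_inner L u v + (L2_norm L v)\<^sup>2"
  unfolding L2_norm_sq using assms
  by (simp add: L2_inner_add_left L2_inner_add_right L2_add L2_inner_commute[of v u])

lemma L2_norm_sq_diff:
  assumes "u \<in> L2 L" "v \<in> L2 L"
  shows "(L2_norm L (\<lambda>x. u x - v x))\<^sup>2 = (L2_norm L u)\<^sup>2 - 2 * L2_inner L u v + (L2_norm L v)\<^sup>2"
  unfolding L2_norm_sq using assms
  by (simp add: L2_inner_diff_left L2_inner_diff_right L2_diff L2_inner_commute[of v u])

lemma L2_norm_scale: "L2_norm L (\<lambda>x. c *\<^sub>R u x) = \<bar>c\<bar> * L2_norm L u"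
  unfolding L2_norm_def
  by (simp add: L2_inner_scale_left L2_inner_scale_right real_sqrt_mult flip: mult.assoc)

text \<open>Fields are not identified up to null sets, so the form is only semidefinite. If one norm
  vanishes, a nonzero inner product would let a suitable linear combination have negative square;
  otherwise the combinations with coefficients \<open>b\<close> and \<open>a\<close>,
  \<open>b\<close> and \<open>- a\<close> give the two signs.\<close>

lemma L2_Cauchy_Schwarz:
  assumes u: "u \<in> L2 L" and v: "v \<in> L2 L"
  shows "\<bar>L2_inner L u v\<bar> \<le> L2_norm L u * L2_norm L v"
proof -
  define a b where "a = L2_norm L u" and "b = L2_norm L v"
  have ab: "a \<ge> 0" "b \<ge> 0" by (simp_all add: a_def b_def L2_norm_nonneg)
  have *: "0 \<le> a\<^sup>2 * s\<^sup>2 + 2 * (s * t) * L2_inner L u v + b\<^sup>2 * t\<^sup>2" for s t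
  proof -
    have "0 \<le> (L2_norm L (\<lambda>x. s *\<^sub>R u x + t *\<^sub>R v x))\<^sup>2" by simp
    also have "\<dots> = (s * a)\<^sup>2 + 2 * (s * (t * L2_inner L u v)) + (t * b)\<^sup>2"
      by (subst L2_norm_sq_add)
         (auto simp: L2_scale u v L2_inner_scale_left L2_inner_scale_right L2_norm_scale a_def b_def
            power_mult_distrib)
    finally show ?thesis by (simp add: algebra_simps power_mult_distrib)
  qed
  have **: "\<bar>L2_inner L u v\<bar> \<le> a * b"
  proof (cases "a * b = 0")
    case False
    then have p: "a * b > 0" using ab by (simp add: less_le)
    have "0 \<le> 2 * (a * b) * (a * b + L2_inner L u v)" "0 \<le> 2 * (a * b) * (a * b - L2_inner L u v)"
      using *[of b a] *[of b "-a"] by (simp_all add: algebra_simps power2_eq_square)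
    then have "0 \<le> a * b + L2_inner L u v" "0 \<le> a * b - L2_inner L u v"
      using p by (metis mult_pos_pos zero_le_mult_iff zero_less_numeral not_less)+
    then show ?thesis by linarith
  next
    case True
    have "L2_inner L u v = 0"
    proof (rule ccontr)
      assume n: "L2_inner L u v \<noteq> 0"
      define q where "q = L2_inner L u v"
      have q: "q \<noteq> 0" using n by (simp add: q_def)
      show False
      proof (cases "a = 0")
        case True
        have "0 \<le> 2 * (- (b\<^sup>2 + 1) / q) * q + b\<^sup>2"
          using *[of "- (b\<^sup>2 + 1) / q" 1] True by (simp add: q_def)
        also have "\<dots> = - 2 - b\<^sup>2" using q by (simp add: field_simps)
        finally show False using zero_le_power2[of b] by linarith
      next
        case False
        with \<open>a * b = 0\<close> have "b = 0" by simp
        then have "0 \<le> a\<^sup>2 + 2 * (- (a\<^sup>2 + 1) / q) * q"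
          using *[of 1 "- (a\<^sup>2 + 1) / q"] by (simp add: q_def)
        also have "\<dots> = - 2 - a\<^sup>2" using q by (simp add: field_simps)
        finally show False using zero_le_power2[of a] by linarith
      qed
    qed
    then show ?thesis using ab by simp
  qed
  then show ?thesis by (simp add: a_def b_def)
qed

lemma L2_triangle:
  assumes "u \<in> L2 L" "v \<in> L2 L"
  shows "L2_norm L (\<lambda>x. u x + v x) \<le> L2_norm L u + L2_norm L v"
proof (rule power2_le_imp_le)
  show "(L2_norm L (\<lambda>x. u x + v x))\<^sup>2 \<le> (L2_norm L u + L2_norm L v)\<^sup>2"
    unfolding L2_norm_sq_add[OF assms]
    using L2_Cauchy_Schwarz[OF assms] by (simp add: power2_sum)
qed (simp add: L2_norm_nonneg)

lemma L2_triangle_diff: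
  assumes "u \<in> L2 L" "v \<in> L2 L" "w \<in> L2 L"
  shows "L2_norm L (\<lambda>x. u x - w x) \<le> L2_norm L (\<lambda>x. u x - v x) + L2_norm L (\<lambda>x. v x - w x)"
  using L2_triangle[of "\<lambda>x. u x - v x" "\<lambda>x. v x - w x"] assms by (simp add: L2_diff)

lemma aeq_L2_norm:
  assumes "aeq L u v" "u \<in> borel_measurable M" "v \<in> borel_measurable M"
  shows "L2_norm L u = L2_norm L v"
  unfolding L2_norm_def L2_inner_def
  using assms by (intro arg_cong[of _ _ sqrt] integral_cong_AE) (auto simp: aeq_def)

section \<open>The frequency lattice\<close>

definition lat :: "(real^2) set" where "lat = insert 0 (freqs L)"

lemma lat_iff: "k \<in> lat \<longleftrightarrow> (\<exists>n1 n2 :: int. k = (2 * pi / L) *\<^sub>R vector [of_int n1, of_int n2])"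
proof -
  have 0: "0 = (2 * pi / L) *\<^sub>R (vector [of_int 0, of_int 0] :: real^2)"
    by (simp add: vec_eq_iff forall_2)
  show ?thesis
  proof
    assume "k \<in> lat"
    then consider "k = 0" | "k \<in> freqs L" unfolding lat_def by blast
    then show "\<exists>n1 n2 :: int. k = (2 * pi / L) *\<^sub>R vector [of_int n1, of_int n2]"
    proof cases
      case 1 show ?thesis unfolding 1 using 0 by blast
    next
      case 2 then show ?thesis unfolding freqs_def by blast
    qed
  next
    assume "\<exists>n1 n2 :: int. k = (2 * pi / L) *\<^sub>R vector [of_int n1, of_int n2]"
    then obtain n1 n2 :: int where k: "k = (2 * pi / L) *\<^sub>R vector [of_int n1, of_int n2]" by auto
    show "k \<in> lat"
    proof (cases "(n1, n2) = (0, 0)")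
      case True then show ?thesis using 0 k unfolding lat_def by (metis insertI1 prod.inject)
    next
      case False then show ?thesis using k unfolding lat_def freqs_def by blast
    qed
  qed
qed

text \<open>Closure under sums and differences is why the zero frequency is adjoined: products of
  exponentials then stay within \<open>lat\<close>.\<close>

lemma lat_add: "k \<in> lat \<Longrightarrow> l \<in> lat \<Longrightarrow> k + l \<in> lat"
proof -
  assume "k \<in> lat" "l \<in> lat"
  then obtain a b c d :: int where "k = (2 * pi / L) *\<^sub>R vector [of_int a, of_int b]"
      "l = (2 * pi / L) *\<^sub>R vector [of_int c, of_int d]" by (auto simp: lat_iff)
  then have "k + l = (2 * pi / L) *\<^sub>R vector [of_int (a + c), of_int (b + d)]"
    by (simp add: vec_eq_iff forall_2 algebra_simps add_divide_distrib)
  then show ?thesis unfolding lat_iff by blast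
qed

lemma lat_uminus: "k \<in> lat \<Longrightarrow> - k \<in> lat"
proof -
  assume "k \<in> lat"
  then obtain a b :: int where "k = (2 * pi / L) *\<^sub>R vector [of_int a, of_int b]"
    by (auto simp: lat_iff)
  then have "- k = (2 * pi / L) *\<^sub>R vector [of_int (- a), of_int (- b)]"
    by (simp add: vec_eq_iff forall_2 algebra_simps)
  then show ?thesis unfolding lat_iff by blast
qed

lemma lat_diff: "k \<in> lat \<Longrightarrow> l \<in> lat \<Longrightarrow> k - l \<in> lat"
  using lat_add[of k "- l"] lat_uminus by simp

lemma freqs_nz: "k \<in> freqs L \<Longrightarrow> k \<noteq> 0"
  using L_pos by (auto simp: freqs_def vec_eq_iff forall_2)

lemma freqs_iff: "k \<in> freqs L \<longleftrightarrow> k \<in> lat \<and> k \<noteq> 0"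
  using freqs_nz by (auto simp: lat_def)

lemma freqs_uminus: "k \<in> freqs L \<Longrightarrow> - k \<in> freqs L"
  by (auto simp: freqs_iff lat_uminus)

text \<open>A nonzero integer vector has length at least one. The bound is the square root of
  \<lambda>1, the source of both the Poincare inequality and the decay rate of a cycle.\<close>

lemma freqs_norm_ge: assumes "k \<in> freqs L" shows "norm k \<ge> 2 * pi / L"
proof -
  obtain a b :: int where k: "k = (2 * pi / L) *\<^sub>R vector [of_int a, of_int b]" and ab: "(a, b) \<noteq> (0, 0)"
    using assms by (auto simp: freqs_def)
  have "1 \<le> a\<^sup>2 + b\<^sup>2" using ab
    by (metis add.commute add_nonneg_pos int_one_le_iff_zero_less not_sum_power2_lt_zero
        linorder_neqE_linordered_idom sum_power2_eq_zero_iff prod.inject)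
  then have "1 \<le> (of_int a :: real)\<^sup>2 + (of_int b)\<^sup>2"
    by (metis of_int_1_le_iff of_int_add of_int_power)
  then have "1 \<le> norm (vector [of_int a, of_int b] :: real^2)"
    by (simp add: norm_vec_def L2_set_def sum_2)
  then show ?thesis using L_pos by (simp add: k mult_le_cancel_left1 divide_right_mono)
qed

lemma freqs_norm_pos: "k \<in> freqs L \<Longrightarrow> norm k > 0"
  using freqs_nz by simp

section \<open>Orthogonality of the exponentials on the square\<close>

lemma continuous_cis_inner: "continuous_on UNIV (\<lambda>x::real^2. cis (k \<bullet> x))"
  by (intro continuous_intros)

text \<open>Passes to \<open>lborel\<close>, where the plane is a product of lines and Fubini
  applies.\<close>

lemma integral_M_eq:
  fixes g :: "real^2 \<Rightarrow> 'b::euclidean_space"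
  assumes "continuous_on UNIV g"
  shows "integral\<^sup>L M g = (\<integral>x. indicator (Omega L) x *\<^sub>R g x \<partial>lborel)"
proof -
  have "integral\<^sup>L M g = (\<integral>x. indicator (Omega L) x *\<^sub>R g x \<partial>lebesgue)"
    by (subst integral_restrict_space) (auto simp: Omega_cbox)
  also have "\<dots> = (\<integral>x. indicator (Omega L) x *\<^sub>R g x \<partial>lborel)"
    using borel_measurable_continuous_onI[OF assms]
    by (intro integral_completion) (auto simp: Omega_cbox)
  finally show ?thesis .
qed

lemma integral_cis_interval:
  fixes n :: int
  shows "(\<integral>t. indicator {0..L} t *\<^sub>R cis (2 * pi / L * n * t) \<partial>lborel) = (if n = 0 then of_real L else 0)"
proof (cases "n = 0")
  case True
  then show ?thesis using L_pos by (simp add: scaleR_conv_of_real)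
next
  case False
  define c where "c = 2 * pi / L * n"
  have c: "c \<noteq> 0" using False L_pos by (simp add: c_def)
  have d: "((\<lambda>t. cis (c * t) / (\<i> * of_real c)) has_vector_derivative cis (c * t)) (at t within {0..L})" for t
  proof -
    have "((\<lambda>t. cis (c * t) * (1 / (\<i> * of_real c))) has_vector_derivative
        (of_real c * (\<i> * cis (c * t))) * (1 / (\<i> * of_real c))) (at t within {0..L})"
      by (rule has_vector_derivative_mult_left)
         (auto intro!: derivative_eq_intros simp: has_vector_derivative_def scaleR_conv_of_real algebra_simps)
    then show ?thesis using c by (simp add: field_simps)
  qed
  have e: "cis (c * L) = 1"
    using L_pos cis_multiple_2pi[of "of_int n"] by (simp add: c_def field_simps)
  have "(LBINT t=0..L. cis (c * t)) = cis (c * L) / (\<i> * of_real c) - cis (c * 0) / (\<i> * of_real c)"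
    unfolding zero_ereal_def using L_pos d
    by (intro interval_integral_FTC_finite) (auto intro!: continuous_intros simp: min_def max_def)
  also have "\<dots> = 0" by (simp add: e)
  finally have "(LBINT t=0..L. cis (c * t)) = 0" .
  then have "(LBINT t:{0..L}. cis (c * t)) = 0"
    using L_pos by (simp add: interval_integral_Icc zero_ereal_def)
  then show ?thesis using False by (simp add: set_lebesgue_integral_def c_def)
qed

lemma cis_sum: "finite I \<Longrightarrow> cis (\<Sum>i\<in>I. g i) = (\<Prod>i\<in>I. cis (g i))"
  by (induction I rule: finite_induct) (auto simp flip: cis_mult)

text \<open>The exponential, cut off to the square, is a product of one-dimensional factors
  \<open>F b\<close>, so the integral is a product over the two coordinates; a nonzero integer in
  one of them annihilates it.\<close>

lemma integral_cis:
  assumes "k \<in> lat"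
  shows "(\<integral>x. cis (k \<bullet> x) \<partial>M) = (if k = 0 then of_real (L\<^sup>2) else 0)"
proof -
  obtain n :: "2 \<Rightarrow> int" where n: "k $ i = 2 * pi / L * n i" for i
  proof -
    obtain a b :: int where "k = (2 * pi / L) *\<^sub>R vector [of_int a, of_int b]"
      using assms by (auto simp: lat_iff)
    then have "k $ i = 2 * pi / L * (if i = 1 then a else b)" for i
      using exhaust_2[of i] by auto
    then show ?thesis by (rule that)
  qed
  define F :: "real^2 \<Rightarrow> real \<Rightarrow> complex" where
    "F b t = indicator {0..L} t *\<^sub>R cis ((k \<bullet> b) * t)" for b t
  have Fm: "F b \<in> borel_measurable borel" for b
    unfolding F_def by (intro borel_measurable_scaleR borel_measurable_indicator
      borel_measurable_continuous_onI continuous_intros) auto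
  have Fi: "integrable lborel (F b)" for b
    unfolding F_def
    by (rule borel_integrable_compact) (auto intro!: continuous_intros)
  interpret P: product_sigma_finite "\<lambda>b::real^2. lborel :: real measure" ..
  have ind: "indicator (Omega L) x *\<^sub>R cis (k \<bullet> x) = (\<Prod>b\<in>Basis. F b (x \<bullet> b))" for x
  proof (cases "x \<in> Omega L")
    case True
    then have "x \<bullet> b \<in> {0..L}" if "b \<in> Basis" for b
      using that by (auto simp: Omega_cbox mem_box Basis_vec_def inner_axis)
    then have "(\<Prod>b\<in>Basis. F b (x \<bullet> b)) = (\<Prod>b\<in>Basis. cis ((k \<bullet> b) * (x \<bullet> b)))"
      by (intro prod.cong) (auto simp: F_def)
    also have "\<dots> = cis (k \<bullet> x)" by (simp add: cis_sum[symmetric] euclidean_inner[of k x])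
    finally show ?thesis using True by simp
  next
    case False
    then obtain i where "\<not> (0 \<le> x $ i \<and> x $ i \<le> L)" by (auto simp: Omega_def)
    then have "F (axis i 1) (x \<bullet> axis i 1) = 0" by (simp add: F_def inner_axis)
    moreover have "axis i 1 \<in> (Basis :: (real^2) set)" by (auto simp: Basis_vec_def)
    ultimately have "(\<Prod>b\<in>Basis. F b (x \<bullet> b)) = 0"
      by (metis finite_Basis prod_zero)
    then show ?thesis using False by simp
  qed
  have "(\<integral>x. cis (k \<bullet> x) \<partial>M) = (\<integral>x. indicator (Omega L) x *\<^sub>R cis (k \<bullet> x) \<partial>lborel)"
    by (rule integral_M_eq[OF continuous_cis_inner])
  also have "\<dots> = (\<integral>x. (\<Prod>b\<in>Basis. F b (x \<bullet> b)) \<partial>lborel)" by (simp add: ind)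
  also have "\<dots> = (\<integral>y. (\<Prod>b\<in>Basis. F b ((\<Sum>b\<in>Basis. y b *\<^sub>R b) \<bullet> b)) \<partial>(\<Pi>\<^sub>M b\<in>(Basis::(real^2) set). lborel))"
    unfolding lborel_eq[where 'a="real^2"]
    by (subst integral_distr) (auto intro!: borel_measurable_prod measurable_compose[OF _ Fm])
  also have "\<dots> = (\<integral>y. (\<Prod>b\<in>Basis. F b (y b)) \<partial>(\<Pi>\<^sub>M b\<in>(Basis::(real^2) set). lborel))"
    by (intro Bochner_Integration.integral_cong prod.cong) auto
  also have "\<dots> = (\<Prod>b\<in>Basis. \<integral>t. F b t \<partial>lborel)"
    by (rule P.product_integral_prod) (auto intro: Fi)
  also have "\<dots> = (\<Prod>i\<in>UNIV. \<integral>t. F (axis i 1) t \<partial>lborel)"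
  proof -
    have B: "(Basis :: (real^2) set) = (\<lambda>i. axis i 1) ` UNIV" by (auto simp: Basis_vec_def)
    show ?thesis unfolding B by (subst prod.reindex) (auto simp: inj_on_def axis_eq_axis)
  qed
  also have "\<dots> = (\<Prod>i\<in>UNIV. if n i = 0 then of_real L else 0)"
    using integral_cis_interval by (intro prod.cong) (simp_all add: F_def inner_axis n)
  also have "\<dots> = (if k = 0 then of_real (L\<^sup>2) else 0)"
    using L_pos by (auto simp: prod_2 n vec_eq_iff forall_2 power2_eq_square UNIV_2)
  finally show ?thesis .
qed

end

section \<open>Fourier coefficients and trigonometric polynomials\<close>

context torus begin

lemma component_measurable:
  "u \<in> borel_measurable N \<Longrightarrow> (\<lambda>x. (u x :: real^2) $ j) \<in> borel_measurable N"
  by (rule measurable_compose[of u _ borel "\<lambda>v. v $ j"])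
     (auto intro!: borel_measurable_continuous_onI continuous_intros)

lemma of_real_component_measurable:
  "u \<in> borel_measurable N \<Longrightarrow> (\<lambda>x. complex_of_real ((u x :: real^2) $ j)) \<in> borel_measurable N"
  by (rule measurable_compose[of u _ borel "\<lambda>v. complex_of_real (v $ j)"])
     (auto intro!: borel_measurable_continuous_onI continuous_intros)

lemma fc_integrable:
  assumes "u \<in> L2 L"
  shows "integrable M (\<lambda>x. complex_of_real (u x $ j) * cis (- (k \<bullet> x)))"
proof (rule Bochner_Integration.integrable_bound)
  show "integrable M u" by (rule L2_integrable[OF assms])
  have "(\<lambda>x. cis (- (k \<bullet> x))) \<in> borel_measurable M"
    by (intro continuous_measurable continuous_intros)
  then show "(\<lambda>x. complex_of_real (u x $ j) * cis (- (k \<bullet> x))) \<in> borel_measurable M"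
    by (intro borel_measurable_times of_real_component_measurable L2_measurable[OF assms])
  show "AE x in M. norm (complex_of_real (u x $ j) * cis (- (k \<bullet> x))) \<le> norm (u x)"
    by (intro AE_I2) (simp add: norm_mult component_le_norm_cart)
qed

lemma fc_component:
  "fourier_coeff L u k $ j = (\<integral>x. of_real (u x $ j) * cis (- (k \<bullet> x)) \<partial>M) / of_real (L\<^sup>2)"
  by (simp add: fourier_coeff_def)

lemma fc_add:
  assumes "u \<in> L2 L" "v \<in> L2 L"
  shows "fourier_coeff L (\<lambda>x. u x + v x) k = fourier_coeff L u k + fourier_coeff L v k"
  using fc_integrable[OF assms(1)] fc_integrable[OF assms(2)]
  by (simp add: vec_eq_iff fc_component distrib_right add_divide_distrib)

lemma fc_diff:
  assumes "u \<in> L2 L" "v \<in> L2 L"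
  shows "fourier_coeff L (\<lambda>x. u x - v x) k = fourier_coeff L u k - fourier_coeff L v k"
  using fc_integrable[OF assms(1)] fc_integrable[OF assms(2)]
  by (simp add: vec_eq_iff fc_component left_diff_distrib diff_divide_distrib)

lemma fc_aeq:
  assumes "aeq L u v" "u \<in> borel_measurable M" "v \<in> borel_measurable M"
  shows "fourier_coeff L u = fourier_coeff L v"
proof -
  have c: "(\<lambda>x. cis (- (k \<bullet> x))) \<in> borel_measurable M" for k
    by (intro continuous_measurable continuous_intros)
  have m: "(\<lambda>x. complex_of_real (w x $ j) * cis (- (k \<bullet> x))) \<in> borel_measurable M"
    if "w \<in> borel_measurable M" for w :: field and j k
    using that c by (intro borel_measurable_times of_real_component_measurable)
  have "AE x in M. complex_of_real (u x $ j) * cis (- (k \<bullet> x)) = of_real (v x $ j) * cis (- (k \<bullet> x))" for j k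
    using assms(1) unfolding aeq_def by eventually_elim simp
  then show ?thesis
    by (auto simp: fun_eq_iff vec_eq_iff fc_component intro!: integral_cong_AE m assms)
qed

definition cosm :: "real^2 \<Rightarrow> real^2 \<Rightarrow> field" where "cosm k a = (\<lambda>x. cos (k \<bullet> x) *\<^sub>R a)"
definition sinm :: "real^2 \<Rightarrow> real^2 \<Rightarrow> field" where "sinm k a = (\<lambda>x. sin (k \<bullet> x) *\<^sub>R a)"

lemma cosm_L2: "cosm k a \<in> L2 L" and sinm_L2: "sinm k a \<in> L2 L"
  unfolding cosm_def sinm_def by (intro continuous_in_L2 continuous_intros)+

text \<open>The bridge between the real inner products, in which projections and equations are
  stated, and the complex coefficients, in which the estimates are carried out.\<close>

lemma fc_dot:
  assumes "u \<in> L2 L"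
  shows "(\<Sum>j\<in>UNIV. of_real (a $ j) * fourier_coeff L u k $ j) =
    (of_real (L2_inner L u (cosm k a)) - \<i> * of_real (L2_inner L u (sinm k a))) / of_real (L\<^sup>2)"
proof -
  have "(\<Sum>j\<in>UNIV. of_real (a $ j) * (\<integral>x. of_real (u x $ j) * cis (- (k \<bullet> x)) \<partial>M))
      = (\<integral>x. (\<Sum>j\<in>UNIV. of_real (a $ j) * (of_real (u x $ j) * cis (- (k \<bullet> x)))) \<partial>M)"
    using fc_integrable[OF assms] by (subst Bochner_Integration.integral_sum) auto
  also have "\<dots> = (\<integral>x. complex_of_real (u x \<bullet> cosm k a x) - \<i> * of_real (u x \<bullet> sinm k a x) \<partial>M)"
    by (intro Bochner_Integration.integral_cong)
       (auto simp: cosm_def sinm_def inner_vec_def[of _ a] inner_vec_def[of _ "_ *\<^sub>R a"] sum_2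
          complex_eq_iff distrib_left mult_ac)
  also have "\<dots> = of_real (L2_inner L u (cosm k a)) - \<i> * of_real (L2_inner L u (sinm k a))"
    unfolding L2_inner_def
    using L2_inner_integrable[OF assms cosm_L2] L2_inner_integrable[OF assms sinm_L2]
    by (subst Bochner_Integration.integral_diff) auto
  finally show ?thesis
    by (simp add: fc_component sum_divide_distrib[symmetric])
qed

section \<open>Trigonometric polynomials in exponential form\<close>

definition exp_sum :: "(real^2 \<Rightarrow> complex) \<Rightarrow> bool" where
  "exp_sum f \<longleftrightarrow> (\<exists>G c. finite G \<and> G \<subseteq> lat \<and> f = (\<lambda>x. \<Sum>k\<in>G. c k * cis (k \<bullet> x)))"

lemma exp_sum_single: "k \<in> lat \<Longrightarrow> exp_sum (\<lambda>x. c * cis (k \<bullet> x))"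
  unfolding exp_sum_def by (rule exI[of _ "{k}"], rule exI[of _ "\<lambda>_. c"]) auto

lemma exp_sum_add: assumes "exp_sum f" "exp_sum g" shows "exp_sum (\<lambda>x. f x + g x)"
proof -
  obtain G c where f: "finite G" "G \<subseteq> lat" "f = (\<lambda>x. \<Sum>k\<in>G. c k * cis (k \<bullet> x))"
    using assms(1) unfolding exp_sum_def by blast
  obtain G' c' where g: "finite G'" "G' \<subseteq> lat" "g = (\<lambda>x. \<Sum>k\<in>G'. c' k * cis (k \<bullet> x))"
    using assms(2) unfolding exp_sum_def by blast
  have ext: "(\<Sum>k\<in>A. d k * cis (k \<bullet> x)) = (\<Sum>k\<in>G \<union> G'. (if k \<in> A then d k else 0) * cis (k \<bullet> x))"
    if "A \<subseteq> G \<union> G'" for A d x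
    using that f(1) g(1) by (intro sum.mono_neutral_cong_left) auto
  have "f x + g x = (\<Sum>k\<in>G \<union> G'. ((if k \<in> G then c k else 0) + (if k \<in> G' then c' k else 0)) * cis (k \<bullet> x))" for x
    unfolding f(3) g(3) using ext[of G c x] ext[of G' c' x] by (simp add: distrib_right sum.distrib)
  then show ?thesis
    unfolding exp_sum_def using f g
    by (intro exI[of _ "G \<union> G'"] exI[of _ "\<lambda>k. (if k \<in> G then c k else 0) + (if k \<in> G' then c' k else 0)"]) auto
qed

lemma exp_sum_0: "exp_sum (\<lambda>x. 0)"
  unfolding exp_sum_def by (rule exI[of _ "{}"]) auto

lemma exp_sum_sum: "finite I \<Longrightarrow> (\<And>i. i \<in> I \<Longrightarrow> exp_sum (f i)) \<Longrightarrow> exp_sum (\<lambda>x. \<Sum>i\<in>I. f i x)"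
  by (induction I rule: finite_induct) (auto intro: exp_sum_0 exp_sum_add)

text \<open>Equating a complex sum with a real component builds in the reality of the field, so no
  conjugate symmetry of \<open>c\<close> has to be recorded.\<close>

definition exp_form :: "(real^2) set \<Rightarrow> (real^2 \<Rightarrow> complex^2) \<Rightarrow> field \<Rightarrow> bool" where
  "exp_form G c u \<longleftrightarrow> finite G \<and> G \<subseteq> lat \<and>
     (\<forall>x j. complex_of_real (u x $ j) = (\<Sum>k\<in>G. c k $ j * cis (k \<bullet> x)))"

lemma trig_poly_exp_form_ex: assumes "u \<in> trig_poly L" shows "\<exists>G c. exp_form G c u"
proof -
  obtain F a b where F: "finite F" "F \<subseteq> lat"
    and u: "u = (\<lambda>x. \<Sum>k\<in>F. cos (k \<bullet> x) *\<^sub>R a k + sin (k \<bullet> x) *\<^sub>R b k)"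
    using assms unfolding trig_poly_def lat_def by blast
  have "exp_sum (\<lambda>x. complex_of_real (u x $ j))" for j
  proof -
    have "complex_of_real (u x $ j) =
       (\<Sum>k\<in>F. (of_real (a k $ j) - \<i> * of_real (b k $ j)) / 2 * cis (k \<bullet> x)
            + (of_real (a k $ j) + \<i> * of_real (b k $ j)) / 2 * cis ((- k) \<bullet> x))" for x
      unfolding u sum_component of_real_sum
      by (intro sum.cong) (auto simp: complex_eq_iff field_simps)
    moreover have "exp_sum (\<lambda>x. \<Sum>k\<in>F. (of_real (a k $ j) - \<i> * of_real (b k $ j)) / 2 * cis (k \<bullet> x)
            + (of_real (a k $ j) + \<i> * of_real (b k $ j)) / 2 * cis ((- k) \<bullet> x))"
      using F lat_uminus by (intro exp_sum_sum exp_sum_add exp_sum_single) auto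
    ultimately show ?thesis by (simp only:)
  qed
  then have "\<forall>j. \<exists>G c. finite G \<and> G \<subseteq> lat \<and>
      (\<lambda>x. complex_of_real (u x $ j)) = (\<lambda>x. \<Sum>k\<in>G. c k * cis (k \<bullet> x))"
    unfolding exp_sum_def by blast
  then obtain G c where G: "\<And>j. finite (G j)" "\<And>j. G j \<subseteq> lat"
    and c: "\<And>j. (\<lambda>x. complex_of_real (u x $ j)) = (\<lambda>x. \<Sum>k\<in>G j. c j k * cis (k \<bullet> x))"
    unfolding choice_iff by blast
  have "exp_form (\<Union>j. G j) (\<lambda>k. \<chi> j. if k \<in> G j then c j k else 0) u"
    unfolding exp_form_def
  proof (intro conjI allI)
    fix x j
    have "complex_of_real (u x $ j) = (\<Sum>k\<in>G j. c j k * cis (k \<bullet> x))"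
      using c[of j] by meson
    also have "\<dots> = (\<Sum>k\<in>(\<Union>j. G j). (\<chi> j. if k \<in> G j then c j k else 0) $ j * cis (k \<bullet> x))"
      using G by (intro sum.mono_neutral_cong_left) auto
    finally show "complex_of_real (u x $ j) = \<dots>" .
  qed (use G in auto)
  then show ?thesis by blast
qed

text \<open>Orthogonality of the exponentials makes the representation unique. The case distinction
  reflects that \<open>c\<close> is arbitrary outside \<open>G\<close>.\<close>

lemma exp_form_fc:
  assumes "exp_form G c u" "k \<in> lat"
  shows "fourier_coeff L u k = (if k \<in> G then c k else 0)"
proof -
  have G: "finite G" "G \<subseteq> lat" and u: "\<And>x j. complex_of_real (u x $ j) = (\<Sum>k\<in>G. c k $ j * cis (k \<bullet> x))"
    using assms by (auto simp: exp_form_def)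
  have "fourier_coeff L u k $ j = (if k \<in> G then c k else 0) $ j" for j
  proof -
    have "(\<integral>x. of_real (u x $ j) * cis (- (k \<bullet> x)) \<partial>M)
        = (\<integral>x. (\<Sum>l\<in>G. c l $ j * cis ((l - k) \<bullet> x)) \<partial>M)"
      by (intro Bochner_Integration.integral_cong)
         (auto simp: u sum_distrib_right mult.assoc cis_mult inner_diff_left)
    also have "\<dots> = (\<Sum>l\<in>G. c l $ j * (\<integral>x. cis ((l - k) \<bullet> x) \<partial>M))"
      by (subst Bochner_Integration.integral_sum)
         (auto intro!: continuous_integrable continuous_intros)
    also have "\<dots> = (\<Sum>l\<in>G. if l = k then c l $ j * of_real (L\<^sup>2) else 0)"
      using G assms(2) lat_diff by (intro sum.cong refl) (subst integral_cis, auto)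
    also have "\<dots> = (if k \<in> G then c k $ j * of_real (L\<^sup>2) else 0)"
      using G by simp
    finally show ?thesis using L_pos by (simp add: fc_component)
  qed
  then show ?thesis by (simp add: vec_eq_iff)
qed

lemma exp_form_fourier: "exp_form G c u \<Longrightarrow> exp_form G (fourier_coeff L u) u"
  using exp_form_fc[of G c u] unfolding exp_form_def by (auto simp: subset_iff)

lemma trig_poly_exp_form: "u \<in> trig_poly L \<Longrightarrow> \<exists>G. exp_form G (fourier_coeff L u) u"
  using trig_poly_exp_form_ex exp_form_fourier by blast

lemma exp_form_Re: "exp_form G c u \<Longrightarrow> u = (\<lambda>x. \<chi> j. Re (\<Sum>k\<in>G. c k $ j * cis (k \<bullet> x)))"
proof (rule ext, subst vec_eq_iff, rule allI)
  fix x j assume u: "exp_form G c u"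
  have "Re (complex_of_real (u x $ j)) = Re (\<Sum>k\<in>G. c k $ j * cis (k \<bullet> x))"
    using u unfolding exp_form_def by presburger
  then show "u x $ j = (\<chi> j. Re (\<Sum>k\<in>G. c k $ j * cis (k \<bullet> x))) $ j" by simp
qed

lemma exp_form_continuous: "exp_form G c u \<Longrightarrow> continuous_on UNIV u"
  by (subst exp_form_Re, assumption) (intro continuous_intros continuous_on_vec_lambda)

lemma exp_form_L2: "exp_form G c u \<Longrightarrow> u \<in> L2 L"
  by (intro continuous_in_L2 exp_form_continuous)

lemma trig_poly_L2: "u \<in> trig_poly L \<Longrightarrow> u \<in> L2 L"
  using trig_poly_exp_form exp_form_L2 by blast

text \<open>Differentiates the complex representation and takes real parts. The imaginary part of
  the result vanishes, being the derivative of the zero function.\<close>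

lemma exp_form_pd_derivative:
  assumes "exp_form G c u"
  shows "\<exists>d. ((\<lambda>s. u (x + s *\<^sub>R axis i 1)) has_vector_derivative d) (at 0) \<and>
    (\<forall>j. complex_of_real (d $ j) = (\<Sum>k\<in>G. (\<i> * of_real (k $ i) * c k $ j) * cis (k \<bullet> x)))"
proof -
  have u: "\<And>x j. complex_of_real (u x $ j) = (\<Sum>k\<in>G. c k $ j * cis (k \<bullet> x))"
    using assms by (auto simp: exp_form_def)
  define D where "D j = (\<Sum>k\<in>G. (\<i> * of_real (k $ i) * c k $ j) * cis (k \<bullet> x))" for j
  have 1: "((\<lambda>s. c k $ j * cis (k \<bullet> (x + s *\<^sub>R axis i 1))) has_vector_derivative
      (\<i> * of_real (k $ i) * c k $ j) * cis (k \<bullet> x)) (at 0)" for k j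
  proof -
    have "((\<lambda>s. cis (k \<bullet> x + s * (k $ i))) has_vector_derivative
        of_real (k $ i) * (\<i> * cis (k \<bullet> x + 0 * (k $ i)))) (at 0)"
      by (auto intro!: derivative_eq_intros simp: has_vector_derivative_def scaleR_conv_of_real algebra_simps)
    then have "((\<lambda>s. c k $ j * cis (k \<bullet> x + s * (k $ i))) has_vector_derivative
        c k $ j * (of_real (k $ i) * (\<i> * cis (k \<bullet> x + 0 * (k $ i))))) (at 0)"
      by (rule has_vector_derivative_mult_right)
    then show ?thesis by (simp add: inner_add_right inner_axis algebra_simps)
  qed
  have 2: "((\<lambda>s. complex_of_real (u (x + s *\<^sub>R axis i 1) $ j)) has_vector_derivative D j) (at 0)" for j
    unfolding u D_def by (rule has_vector_derivative_sum) (rule 1)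
  have re: "((\<lambda>s. u (x + s *\<^sub>R axis i 1) $ j) has_vector_derivative Re (D j)) (at 0)" for j
    using bounded_linear.has_vector_derivative[OF bounded_linear_Re 2[of j]] by simp
  have im: "Im (D j) = 0" for j
  proof -
    have "((\<lambda>s. 0) has_vector_derivative Im (D j)) (at (0::real))"
      using bounded_linear.has_vector_derivative[OF bounded_linear_Im 2[of j]] by simp
    then show ?thesis
      by (metis has_vector_derivative_const vector_derivative_at)
  qed
  have "((\<lambda>s. u (x + s *\<^sub>R axis i 1)) has_vector_derivative (\<chi> j. Re (D j))) (at 0)"
    unfolding has_vector_derivative_def
  proof (subst has_derivative_componentwise_within, intro ballI)
    fix b :: "real^2" assume "b \<in> Basis"
    then obtain j where b: "b = axis j 1" by (auto simp: Basis_vec_def)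
    show "((\<lambda>s. u (x + s *\<^sub>R axis i 1) \<bullet> b) has_derivative (\<lambda>h. (h *\<^sub>R (\<chi> j. Re (D j))) \<bullet> b)) (at 0)"
      using re[of j] by (simp add: b inner_axis has_vector_derivative_def)
  qed
  moreover have "complex_of_real ((\<chi> j. Re (D j)) $ j) = D j" for j
    using im[of j] by (simp add: complex_eq_iff)
  ultimately show ?thesis unfolding D_def by blast
qed

lemma exp_form_pd:
  assumes "exp_form G c u"
  shows "exp_form G (\<lambda>k. \<chi> j. \<i> * of_real (k $ i) * c k $ j) (pd i u)"
proof -
  have "complex_of_real (pd i u x $ j) = (\<Sum>k\<in>G. (\<i> * of_real (k $ i) * c k $ j) * cis (k \<bullet> x))" for x j
  proof -
    obtain d where d: "((\<lambda>s. u (x + s *\<^sub>R axis i 1)) has_vector_derivative d) (at 0)"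
      "\<forall>j. complex_of_real (d $ j) = (\<Sum>k\<in>G. (\<i> * of_real (k $ i) * c k $ j) * cis (k \<bullet> x))"
      using exp_form_pd_derivative[OF assms] by blast
    have "pd i u x = d" unfolding pd_def by (rule vector_derivative_at) (rule d)
    then show ?thesis using d(2) by simp
  qed
  then show ?thesis using assms by (simp add: exp_form_def)
qed

lemma fc_pd:
  assumes "u \<in> trig_poly L" "k \<in> lat"
  shows "fourier_coeff L (pd i u) k = (\<chi> j. \<i> * of_real (k $ i) * fourier_coeff L u k $ j)"
proof -
  obtain G where G: "exp_form G (fourier_coeff L u) u" using trig_poly_exp_form[OF assms(1)] by blast
  show ?thesis
  proof (cases "k \<in> G")
    case True then show ?thesis using exp_form_fc[OF exp_form_pd[OF G] assms(2)] by simp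
  next
    case False
    then have "fourier_coeff L u k = 0" using exp_form_fc[OF G assms(2)] by (simp only: if_False)
    then show ?thesis using False exp_form_fc[OF exp_form_pd[OF G, of i] assms(2)] by (simp add: vec_eq_iff)
  qed
qed

text \<open>Parseval's identity against a finite sum. The pairing is bilinear rather than
  sesquilinear, hence the coefficient at \<open>- k\<close>.\<close>

lemma inner_exp_form:
  assumes u: "u \<in> L2 L" and v: "exp_form G d v"
  shows "complex_of_real (L2_inner L u v) =
    of_real (L\<^sup>2) * (\<Sum>k\<in>G. \<Sum>j\<in>UNIV. d k $ j * fourier_coeff L u (- k) $ j)"
proof -
  have G: "finite G" "G \<subseteq> lat" and vv: "\<And>x j. complex_of_real (v x $ j) = (\<Sum>k\<in>G. d k $ j * cis (k \<bullet> x))"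
    using v by (auto simp: exp_form_def)
  have i: "integrable M (\<lambda>x. complex_of_real (u x $ j) * cis (k \<bullet> x))" for j k
    using fc_integrable[OF u, of j "- k"] by simp
  have "complex_of_real (L2_inner L u v) = (\<integral>x. complex_of_real (u x \<bullet> v x) \<partial>M)"
    by (simp add: L2_inner_def)
  also have "\<dots> = (\<integral>x. (\<Sum>k\<in>G. \<Sum>j\<in>UNIV. d k $ j * (of_real (u x $ j) * cis (k \<bullet> x))) \<partial>M)"
    by (intro Bochner_Integration.integral_cong refl)
       (subst sum.swap, simp add: inner_vec_def vv sum_distrib_left mult_ac)
  also have "\<dots> = (\<Sum>k\<in>G. \<Sum>j\<in>UNIV. d k $ j * (\<integral>x. of_real (u x $ j) * cis (k \<bullet> x) \<partial>M))"
    using i by (simp add: Bochner_Integration.integral_sum)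
  also have "\<dots> = (\<Sum>k\<in>G. \<Sum>j\<in>UNIV. d k $ j * (of_real (L\<^sup>2) * fourier_coeff L u (- k) $ j))"
    using L_pos by (intro sum.cong refl) (simp add: fc_component)
  finally show ?thesis by (simp add: sum_distrib_left algebra_simps)
qed

lemma trig_poly_modes: "k \<in> lat \<Longrightarrow> cosm k a \<in> trig_poly L" "k \<in> lat \<Longrightarrow> sinm k a \<in> trig_poly L"
  unfolding trig_poly_def cosm_def sinm_def lat_def[symmetric]
   apply (rule CollectI, rule exI[of _ "{k}"], rule exI[of _ "\<lambda>_. a"], rule exI[of _ "\<lambda>_. 0"], simp)
  apply (rule CollectI, rule exI[of _ "{k}"], rule exI[of _ "\<lambda>_. 0"], rule exI[of _ "\<lambda>_. a"], simp)
  done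

lemma pd_cosm: "pd i (cosm k a) = sinm k (- (k $ i) *\<^sub>R a)"
proof
  fix x
  have "((\<lambda>s. cosm k a (x + s *\<^sub>R axis i 1)) has_vector_derivative sinm k (- (k $ i) *\<^sub>R a) x) (at 0)"
    unfolding cosm_def sinm_def has_vector_derivative_def
    by (auto intro!: derivative_eq_intros simp: inner_axis algebra_simps)
  then show "pd i (cosm k a) x = sinm k (- (k $ i) *\<^sub>R a) x"
    unfolding pd_def by (rule vector_derivative_at)
qed

lemma pd_sinm: "pd i (sinm k a) = cosm k ((k $ i) *\<^sub>R a)"
proof
  fix x
  have "((\<lambda>s. sinm k a (x + s *\<^sub>R axis i 1)) has_vector_derivative cosm k ((k $ i) *\<^sub>R a) x) (at 0)"
    unfolding cosm_def sinm_def has_vector_derivative_def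
    by (auto intro!: derivative_eq_intros simp: inner_axis algebra_simps)
  then show "pd i (sinm k a) x = cosm k ((k $ i) *\<^sub>R a) x"
    unfolding pd_def by (rule vector_derivative_at)
qed

text \<open>The cosine and sine fields at \<open>k\<close> suffice as test fields: differentiation
  exchanges them up to the factor \<open>k $ i\<close>, and together they determine the coefficient
  at \<open>k\<close>.\<close>

lemma weak_pd_fc:
  assumes u: "u \<in> L2 L" and g: "weak_pd L i u g" and k: "k \<in> lat"
  shows "fourier_coeff L g k = (\<chi> j. \<i> * of_real (k $ i) * fourier_coeff L u k $ j)"
proof -
  have gL: "g \<in> L2 L" and w: "\<And>\<phi>. \<phi> \<in> trig_poly L \<Longrightarrow> L2_inner L u (pd i \<phi>) = - L2_inner L g \<phi>"
    using g by (auto simp: weak_pd_def)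
  have "fourier_coeff L g k $ j = \<i> * of_real (k $ i) * fourier_coeff L u k $ j" for j
  proof -
    have s: "sinm k (c *\<^sub>R a) = (\<lambda>x. c *\<^sub>R sinm k a x)" "cosm k (c *\<^sub>R a) = (\<lambda>x. c *\<^sub>R cosm k a x)" for c a
      by (auto simp: sinm_def cosm_def)
    have 1: "L2_inner L g (cosm k a) = k $ i * L2_inner L u (sinm k a)"
         "L2_inner L g (sinm k a) = - (k $ i) * L2_inner L u (cosm k a)" for a
      using w[OF trig_poly_modes(1)[OF k, of a]] w[OF trig_poly_modes(2)[OF k, of a]]
      by (simp_all only: pd_cosm pd_sinm s L2_inner_scale_right)
    have e: "fourier_coeff L v k $ j = (\<Sum>j'\<in>UNIV. of_real (axis j 1 $ j') * fourier_coeff L v k $ j')" for v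
      by (simp add: axis_def if_distrib[of of_real] if_distrib[of "\<lambda>z. z * _"] cong: if_cong)
    show ?thesis
      unfolding e fc_dot[OF gL] fc_dot[OF u] 1 using L_pos
      by (simp add: field_simps)
  qed
  then show ?thesis by (simp add: vec_eq_iff)
qed

lemma weak_pd_trig_poly:
  assumes "u \<in> trig_poly L"
  shows "weak_pd L i u (pd i u)"
  unfolding weak_pd_def
proof (intro conjI ballI)
  obtain G where G: "exp_form G (fourier_coeff L u) u" using trig_poly_exp_form[OF assms] by blast
  show gL: "pd i u \<in> L2 L" using exp_form_L2[OF exp_form_pd[OF G]] .
  fix \<phi> assume "\<phi> \<in> trig_poly L"
  then obtain F where F: "exp_form F (fourier_coeff L \<phi>) \<phi>" using trig_poly_exp_form by blast
  have FL: "\<And>k. k \<in> F \<Longrightarrow> - k \<in> lat" using F lat_uminus by (auto simp: exp_form_def)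
  have "complex_of_real (L2_inner L u (pd i \<phi>)) = complex_of_real (- L2_inner L (pd i u) \<phi>)"
    unfolding of_real_minus inner_exp_form[OF trig_poly_L2[OF assms] exp_form_pd[OF F]] inner_exp_form[OF gL F]
    by (simp add: fc_pd[OF assms FL] sum_negf algebra_simps flip: sum_distrib_left)
  then show "L2_inner L u (pd i \<phi>) = - L2_inner L (pd i u) \<phi>" using of_real_eq_iff by blast
qed

section \<open>Bessel's inequality\<close>

lemma norm_sq_complex2: "(norm (z :: complex^2))\<^sup>2 = (\<Sum>j\<in>UNIV. (cmod (z $ j))\<^sup>2)"
  by (simp add: norm_vec_def L2_set_def sum_nonneg)

lemma component_sq_integrable:
  assumes u: "u \<in> L2 L" shows "integrable M (\<lambda>x. (u x $ j)\<^sup>2)"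
proof (rule Bochner_Integration.integrable_bound[OF L2_sq_integrable[OF u]])
  show "(\<lambda>x. (u x $ j)\<^sup>2) \<in> borel_measurable M"
    by (intro borel_measurable_power component_measurable L2_measurable[OF u])
  have "(u x $ j)\<^sup>2 \<le> (norm (u x))\<^sup>2" for x
    by (metis abs_norm_cancel abs_le_square_iff component_le_norm_cart)
  then show "AE x in M. norm ((u x $ j)\<^sup>2) \<le> norm ((norm (u x))\<^sup>2)"
    by (intro AE_I2) simp
qed

text \<open>The mean square distance from the component to its partial Fourier sum \<open>S\<close>
  is nonnegative. In its expansion the cross integral \<open>E1\<close> and the square integral
  \<open>E2\<close> are the same number, so one copy is left with a minus sign.\<close>

lemma Bessel_component:
  assumes u: "u \<in> L2 L" and F: "finite F" "F \<subseteq> lat"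
  shows "L\<^sup>2 * (\<Sum>k\<in>F. (cmod (fourier_coeff L u k $ j))\<^sup>2) \<le> (\<integral>x. (u x $ j)\<^sup>2 \<partial>M)"
proof -
  define c where "c k = fourier_coeff L u k $ j" for k
  define S where "S x = (\<Sum>k\<in>F. c k * cis (k \<bullet> x))" for x
  have Sc: "continuous_on UNIV S" unfolding S_def by (intro continuous_intros)
  have ii: "integrable M (\<lambda>x. complex_of_real (u x $ j) * cis (- (k \<bullet> x)))" for k
    by (rule fc_integrable[OF u])
  have I1: "integrable M (\<lambda>x. complex_of_real (u x $ j) * cnj (S x))"
  proof -
    have "integrable M (\<lambda>x. \<Sum>k\<in>F. cnj (c k) * (complex_of_real (u x $ j) * cis (- (k \<bullet> x))))"
      using ii by auto
    then show ?thesis by (simp add: S_def sum_distrib_left cis_cnj algebra_simps)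
  qed
  have E1: "(\<integral>x. complex_of_real (u x $ j) * cnj (S x) \<partial>M) = of_real (L\<^sup>2 * (\<Sum>k\<in>F. (cmod (c k))\<^sup>2))"
  proof -
    have "(\<integral>x. complex_of_real (u x $ j) * cnj (S x) \<partial>M) =
        (\<integral>x. (\<Sum>k\<in>F. cnj (c k) * (complex_of_real (u x $ j) * cis (- (k \<bullet> x)))) \<partial>M)"
      by (simp add: S_def sum_distrib_left cis_cnj algebra_simps)
    also have "\<dots> = (\<Sum>k\<in>F. cnj (c k) * (\<integral>x. complex_of_real (u x $ j) * cis (- (k \<bullet> x)) \<partial>M))"
      using ii by (subst Bochner_Integration.integral_sum) auto
    also have "\<dots> = (\<Sum>k\<in>F. cnj (c k) * (of_real (L\<^sup>2) * c k))"
      using L_pos by (intro sum.cong refl) (simp add: c_def fc_component)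
    finally show ?thesis
      by (simp add: sum_distrib_left complex_norm_square algebra_simps del: of_real_power)
  qed
  have E2: "(\<integral>x. complex_of_real ((cmod (S x))\<^sup>2) \<partial>M) = of_real (L\<^sup>2 * (\<Sum>k\<in>F. (cmod (c k))\<^sup>2))"
  proof -
    have "(\<integral>x. complex_of_real ((cmod (S x))\<^sup>2) \<partial>M) =
        (\<integral>x. (\<Sum>k\<in>F. \<Sum>l\<in>F. c k * cnj (c l) * cis ((k - l) \<bullet> x)) \<partial>M)"
      by (intro Bochner_Integration.integral_cong refl)
         (simp add: complex_norm_square S_def sum_product cis_cnj cis_mult inner_diff_left algebra_simps del: of_real_power)
    also have "\<dots> = (\<Sum>k\<in>F. \<Sum>l\<in>F. c k * cnj (c l) * (\<integral>x. cis ((k - l) \<bullet> x) \<partial>M))"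
      by (simp add: Bochner_Integration.integral_sum continuous_integrable continuous_cis_inner)
    also have "\<dots> = (\<Sum>k\<in>F. \<Sum>l\<in>F. if l = k then c k * cnj (c l) * of_real (L\<^sup>2) else 0)"
      using F lat_diff by (intro sum.cong refl) (subst integral_cis, auto)
    also have "\<dots> = (\<Sum>k\<in>F. c k * cnj (c k) * of_real (L\<^sup>2))"
      using F by simp
    finally show ?thesis
      by (simp add: sum_distrib_left complex_norm_square algebra_simps del: of_real_power)
  qed
  note I0 = component_sq_integrable[OF u, of j]
  have I2: "integrable M (\<lambda>x. (cmod (S x))\<^sup>2)"
    by (intro continuous_integrable continuous_intros Sc)
  have I3: "integrable M (\<lambda>x. Re (complex_of_real (u x $ j) * cnj (S x)))"
    using I1 by (rule integrable_Re)
  have R2: "(\<integral>x. (cmod (S x))\<^sup>2 \<partial>M) = L\<^sup>2 * (\<Sum>k\<in>F. (cmod (c k))\<^sup>2)"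
    using E2 unfolding integral_complex_of_real of_real_eq_iff .
  have R3: "(\<integral>x. Re (complex_of_real (u x $ j) * cnj (S x)) \<partial>M) = L\<^sup>2 * (\<Sum>k\<in>F. (cmod (c k))\<^sup>2)"
    using I1 E1 by (subst integral_Re) auto
  have "0 \<le> (\<integral>x. (u x $ j)\<^sup>2 - 2 * Re (complex_of_real (u x $ j) * cnj (S x)) + (cmod (S x))\<^sup>2 \<partial>M)"
  proof (rule Bochner_Integration.integral_nonneg)
    fix x
    have "(u x $ j)\<^sup>2 - 2 * Re (complex_of_real (u x $ j) * cnj (S x)) + (cmod (S x))\<^sup>2
        = (cmod (of_real (u x $ j) - S x))\<^sup>2"
      unfolding cmod_power2 by (simp add: power2_eq_square algebra_simps)
    then show "0 \<le> (u x $ j)\<^sup>2 - 2 * Re (complex_of_real (u x $ j) * cnj (S x)) + (cmod (S x))\<^sup>2"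
      by simp
  qed
  also have "\<dots> = (\<integral>x. (u x $ j)\<^sup>2 \<partial>M) - L\<^sup>2 * (\<Sum>k\<in>F. (cmod (c k))\<^sup>2)"
    using I0 I2 I3 R2 R3 by simp
  finally show ?thesis by (simp add: c_def)
qed

lemma Bessel:
  assumes u: "u \<in> L2 L" and F: "finite F" "F \<subseteq> lat"
  shows "L\<^sup>2 * (\<Sum>k\<in>F. (norm (fourier_coeff L u k))\<^sup>2) \<le> (L2_norm L u)\<^sup>2"
proof -
  note I0 = component_sq_integrable[OF u]
  have "L\<^sup>2 * (\<Sum>k\<in>F. (norm (fourier_coeff L u k))\<^sup>2)
     = (\<Sum>j\<in>UNIV. L\<^sup>2 * (\<Sum>k\<in>F. (cmod (fourier_coeff L u k $ j))\<^sup>2))"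
    unfolding norm_sq_complex2 by (subst sum.swap) (simp add: sum_distrib_left)
  also have "\<dots> \<le> (\<Sum>j\<in>UNIV. \<integral>x. (u x $ j)\<^sup>2 \<partial>M)"
    by (intro sum_mono Bessel_component[OF u F])
  also have "\<dots> = (\<integral>x. (\<Sum>j\<in>UNIV. (u x $ j)\<^sup>2) \<partial>M)"
    using I0 by (simp add: Bochner_Integration.integral_sum)
  also have "\<dots> = (L2_norm L u)\<^sup>2"
    unfolding L2_norm_sq L2_inner_def inner_vec_def by (simp add: power2_eq_square)
  finally show ?thesis .
qed

end

section \<open>Completeness and the Leray projection\<close>

lemma ennreal_suminf_ge_term: "g n \<le> (\<Sum>n. g n :: ennreal)"
  using sum_le_suminf[of g "{n}"] by simp

context torus begin

lemma nn_integral_L2: 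
  assumes "u \<in> L2 L"
  shows "(\<integral>\<^sup>+x. ennreal ((norm (u x))\<^sup>2) \<partial>M) = ennreal ((L2_norm L u)\<^sup>2)"
  using nn_integral_eq_integral[OF L2_sq_integrable[OF assms]]
  by (simp only: L2_norm_sq L2_inner_def power2_norm_eq_inner) simp

lemma L2_norm_leI:
  assumes "u \<in> borel_measurable M" "(\<integral>\<^sup>+x. ennreal ((norm (u x))\<^sup>2) \<partial>M) \<le> ennreal (c\<^sup>2)" "c \<ge> 0"
  shows "u \<in> L2 L" "L2_norm L u \<le> c"
proof -
  have "(\<integral>\<^sup>+x. ennreal (norm ((norm (u x))\<^sup>2)) \<partial>M) < \<infinity>"
    using assms(2) by (simp add: le_less_trans[OF _ ennreal_less_top])
  then have i: "integrable M (\<lambda>x. (norm (u x))\<^sup>2)"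
    using assms(1) unfolding integrable_iff_bounded by auto
  then show u: "u \<in> L2 L" using assms(1) by (simp add: L2_def)
  have "(L2_norm L u)\<^sup>2 \<le> c\<^sup>2" using assms(2) unfolding nn_integral_L2[OF u] by simp
  then show "L2_norm L u \<le> c" using assms(3) by (rule power2_le_imp_le)
qed

text \<open>Riesz-Fischer. Weighting the increments by powers of two makes the pointwise majorant
  integrable without Minkowski's inequality for infinite sums.\<close>

lemma L2_complete:
  assumes \<phi>: "\<And>n. \<phi> n \<in> L2 L"
    and C: "\<And>n m. n \<le> m \<Longrightarrow> L2_norm L (\<lambda>x. \<phi> m x - \<phi> n x) \<le> (1/2)^n"
  obtains h where "h \<in> L2 L" "\<And>n. L2_norm L (\<lambda>x. \<phi> n x - h x) \<le> (1/2)^n"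
proof -
  have m[measurable]: "\<phi> n \<in> borel_measurable M" for n by (rule L2_measurable[OF \<phi>])
  define d where "d n x = \<phi> (Suc n) x - \<phi> n x" for n x
  have dm[measurable]: "d n \<in> borel_measurable M" for n unfolding d_def[abs_def] by measurable
  have dL: "d n \<in> L2 L" for n unfolding d_def[abs_def] by (intro L2_diff \<phi>)
  have "(\<integral>\<^sup>+x. (\<Sum>n. ennreal (2^n * (norm (d n x))\<^sup>2)) \<partial>M)
      = (\<Sum>n. \<integral>\<^sup>+x. ennreal (2^n * (norm (d n x))\<^sup>2) \<partial>M)"
    by (rule nn_integral_suminf) measurable
  also have "\<dots> \<le> (\<Sum>n. ennreal ((1/2)^n))"
  proof (rule suminf_le)
    fix n
    have "(\<integral>\<^sup>+x. ennreal (2^n * (norm (d n x))\<^sup>2) \<partial>M) = ennreal (2^n) * ennreal ((L2_norm L (d n))\<^sup>2)"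
      unfolding nn_integral_L2[OF dL, symmetric]
      by (subst nn_integral_cmult[symmetric]) (auto simp: ennreal_mult)
    also have "\<dots> \<le> ennreal (2^n) * ennreal (((1/2)^n)\<^sup>2)"
      using C[of n "Suc n"] by (intro mult_left_mono ennreal_leI power_mono) (auto simp: d_def[abs_def] L2_norm_nonneg)
    also have "\<dots> = ennreal ((1/2)^n)"
      by (subst ennreal_mult[symmetric]) (auto simp: power2_eq_square power_mult_distrib[symmetric])
    finally show "(\<integral>\<^sup>+x. ennreal (2^n * (norm (d n x))\<^sup>2) \<partial>M) \<le> ennreal ((1/2)^n)" .
  qed auto
  also have "\<dots> < \<infinity>"
    by (subst suminf_ennreal2) (auto simp: summable_geometric)
  finally have fin: "(\<integral>\<^sup>+x. (\<Sum>n. ennreal (2^n * (norm (d n x))\<^sup>2)) \<partial>M) < \<infinity>" .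
  have "AE x in M. (\<Sum>n. ennreal (2^n * (norm (d n x))\<^sup>2)) \<noteq> \<infinity>"
    by (rule nn_integral_noteq_infinite) (use fin in auto)
  then have conv: "AE x in M. convergent (\<lambda>n. \<phi> n x)"
  proof eventually_elim
    fix x assume f: "(\<Sum>n. ennreal (2^n * (norm (d n x))\<^sup>2)) \<noteq> \<infinity>"
    define S where "S = enn2real (\<Sum>n. ennreal (2^n * (norm (d n x))\<^sup>2))"
    have S0: "S \<ge> 0" by (simp add: S_def)
    have "norm (d n x) \<le> sqrt S * (sqrt (1/2))^n" for n
    proof -
      have "ennreal (2^n * (norm (d n x))\<^sup>2) \<le> (\<Sum>n. ennreal (2^n * (norm (d n x))\<^sup>2))"
        by (rule ennreal_suminf_ge_term)
      also have "\<dots> = ennreal S" using f by (simp add: S_def less_top)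
      finally have "2^n * (norm (d n x))\<^sup>2 \<le> S" using S0 by simp
      then have "(norm (d n x))\<^sup>2 \<le> S * (1/2)^n" by (simp add: field_simps power_divide)
      then have "norm (d n x) \<le> sqrt (S * (1/2)^n)" by (simp add: real_le_rsqrt)
      also have "\<dots> = sqrt S * (sqrt (1/2))^n" by (simp add: real_sqrt_mult real_sqrt_power)
      finally show ?thesis .
    qed
    moreover have "summable (\<lambda>n. sqrt S * (sqrt (1/2))^n)"
      by (intro summable_mult summable_geometric) (simp add: real_sqrt_divide)
    ultimately have "summable (\<lambda>n. d n x)"
      by (intro summable_comparison_test[of "\<lambda>n. d n x" "\<lambda>n. sqrt S * (sqrt (1/2))^n"]) auto
    then have "convergent (\<lambda>n. \<Sum>i<n. d i x)" by (simp add: summable_iff_convergent)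
    then have "convergent (\<lambda>n. (\<Sum>i<n. d i x) + \<phi> 0 x)" by (intro convergent_add convergent_const)
    moreover have "(\<Sum>i<n. d i x) + \<phi> 0 x = \<phi> n x" for n
      unfolding d_def using sum_lessThan_telescope[of "\<lambda>n. \<phi> n x" n] by simp
    ultimately show "convergent (\<lambda>n. \<phi> n x)" by simp
  qed
  define h where "h x = lim (\<lambda>n. \<phi> n x)" for x
  have hm[measurable]: "h \<in> borel_measurable M"
    unfolding h_def[abs_def] by (rule borel_measurable_lim_metric) measurable
  have lim: "AE x in M. (\<lambda>n. \<phi> n x) \<longlonglongrightarrow> h x"
    using conv by eventually_elim (simp add: h_def convergent_LIMSEQ_iff)
  \<comment> \<open>Fatou's lemma in \<open>m\<close>: the Cauchy bound survives in the limit, and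
    square integrability of the difference, hence of \<open>h\<close>, comes with it.\<close>
  have bnd: "(\<lambda>x. \<phi> n x - h x) \<in> L2 L \<and> L2_norm L (\<lambda>x. \<phi> n x - h x) \<le> (1/2)^n" for n
  proof -
    have "(\<integral>\<^sup>+x. ennreal ((norm (\<phi> n x - h x))\<^sup>2) \<partial>M)
        = (\<integral>\<^sup>+x. liminf (\<lambda>m. ennreal ((norm (\<phi> m x - \<phi> n x))\<^sup>2)) \<partial>M)"
    proof (rule nn_integral_cong_AE)
      show "AE x in M. ennreal ((norm (\<phi> n x - h x))\<^sup>2) = liminf (\<lambda>m. ennreal ((norm (\<phi> m x - \<phi> n x))\<^sup>2))"
        using lim
      proof eventually_elim
        fix x assume "(\<lambda>n. \<phi> n x) \<longlonglongrightarrow> h x"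
        then have "(\<lambda>m. ennreal ((norm (\<phi> m x - \<phi> n x))\<^sup>2)) \<longlonglongrightarrow> ennreal ((norm (h x - \<phi> n x))\<^sup>2)"
          by (intro tendsto_intros)
        then have "liminf (\<lambda>m. ennreal ((norm (\<phi> m x - \<phi> n x))\<^sup>2)) = ennreal ((norm (h x - \<phi> n x))\<^sup>2)"
          by (intro lim_imp_Liminf) auto
        then show "ennreal ((norm (\<phi> n x - h x))\<^sup>2) = liminf (\<lambda>m. ennreal ((norm (\<phi> m x - \<phi> n x))\<^sup>2))"
          by (simp add: norm_minus_commute)
      qed
    qed
    also have "\<dots> \<le> liminf (\<lambda>m. \<integral>\<^sup>+x. ennreal ((norm (\<phi> m x - \<phi> n x))\<^sup>2) \<partial>M)"
      by (rule nn_integral_liminf) measurable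
    also have "\<dots> = liminf (\<lambda>m. ennreal ((L2_norm L (\<lambda>x. \<phi> m x - \<phi> n x))\<^sup>2))"
      by (subst nn_integral_L2) (auto intro: L2_diff \<phi>)
    also have "\<dots> \<le> limsup (\<lambda>m. ennreal ((L2_norm L (\<lambda>x. \<phi> m x - \<phi> n x))\<^sup>2))"
      by (rule Liminf_le_Limsup) simp
    also have "\<dots> \<le> ennreal (((1/2)^n)\<^sup>2)"
      by (rule Limsup_bounded)
         (auto simp: eventually_sequentially L2_norm_nonneg intro!: exI[of _ n] ennreal_leI power_mono C)
    finally show ?thesis by (intro conjI L2_norm_leI) auto
  qed
  have "h \<in> L2 L" using L2_diff[OF \<phi>[of 0] conjunct1[OF bnd[of 0]]] by simp
  then show ?thesis using bnd by (intro that[of h]) auto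
qed

section \<open>Linear structure of polynomial fields\<close>

lemma trig_poly_pd_derivative:
  assumes "u \<in> trig_poly L"
  shows "((\<lambda>s. u (x + s *\<^sub>R axis i 1)) has_vector_derivative pd i u x) (at 0)"
proof -
  obtain G c where "exp_form G c u" using trig_poly_exp_form_ex[OF assms] by blast
  from exp_form_pd_derivative[OF this, of x i] show ?thesis
    unfolding pd_def using vector_derivative_works differentiableI_vector by blast
qed

lemma trig_poly_add:
  assumes "u \<in> trig_poly L" "v \<in> trig_poly L"
  shows "(\<lambda>x. u x + v x) \<in> trig_poly L"
proof -
  obtain F a b where F: "finite F" "F \<subseteq> lat"
    and u: "u = (\<lambda>x. \<Sum>k\<in>F. cos (k \<bullet> x) *\<^sub>R a k + sin (k \<bullet> x) *\<^sub>R b k)"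
    using assms(1) unfolding trig_poly_def lat_def by blast
  obtain F' a' b' where F': "finite F'" "F' \<subseteq> lat"
    and v: "v = (\<lambda>x. \<Sum>k\<in>F'. cos (k \<bullet> x) *\<^sub>R a' k + sin (k \<bullet> x) *\<^sub>R b' k)"
    using assms(2) unfolding trig_poly_def lat_def by blast
  let ?e = "\<lambda>A (a :: real^2 \<Rightarrow> real^2) k. if k \<in> A then a k else 0"
  have ext: "(\<Sum>k\<in>A. cos (k \<bullet> x) *\<^sub>R p k + sin (k \<bullet> x) *\<^sub>R q k)
      = (\<Sum>k\<in>F \<union> F'. cos (k \<bullet> x) *\<^sub>R ?e A p k + sin (k \<bullet> x) *\<^sub>R ?e A q k)"
    if "A \<subseteq> F \<union> F'" for A p q x
    using that F F' by (intro sum.mono_neutral_cong_left) auto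
  have "u x + v x = (\<Sum>k\<in>F \<union> F'. cos (k \<bullet> x) *\<^sub>R (?e F a k + ?e F' a' k) + sin (k \<bullet> x) *\<^sub>R (?e F b k + ?e F' b' k))" for x
    unfolding u v ext[of F, OF Un_upper1] ext[of F', OF Un_upper2]
    by (simp only: sum.distrib[symmetric] scaleR_add_right add_ac)
  then show ?thesis
    unfolding trig_poly_def lat_def[symmetric] using F F'
    by (intro CollectI exI[of _ "F \<union> F'"] exI[of _ "\<lambda>k. ?e F a k + ?e F' a' k"]
        exI[of _ "\<lambda>k. ?e F b k + ?e F' b' k"]) auto
qed

lemma trig_poly_scale:
  assumes "u \<in> trig_poly L" shows "(\<lambda>x. c *\<^sub>R u x) \<in> trig_poly L"
proof -
  obtain F a b where F: "finite F" "F \<subseteq> lat"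
    and u: "u = (\<lambda>x. \<Sum>k\<in>F. cos (k \<bullet> x) *\<^sub>R a k + sin (k \<bullet> x) *\<^sub>R b k)"
    using assms(1) unfolding trig_poly_def lat_def by blast
  have "(\<lambda>x. c *\<^sub>R u x) = (\<lambda>x. \<Sum>k\<in>F. cos (k \<bullet> x) *\<^sub>R (c *\<^sub>R a k) + sin (k \<bullet> x) *\<^sub>R (c *\<^sub>R b k))"
    by (simp add: u scaleR_sum_right scaleR_add_right scaleR_left_commute del: scaleR_scaleR)
  with F show ?thesis unfolding trig_poly_def lat_def[symmetric]
    by (intro CollectI exI[of _ F] exI[of _ "\<lambda>k. c *\<^sub>R a k"] exI[of _ "\<lambda>k. c *\<^sub>R b k"] conjI)
qed

lemma pd_add:
  assumes "u \<in> trig_poly L" "v \<in> trig_poly L"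
  shows "pd i (\<lambda>x. u x + v x) x = pd i u x + pd i v x"
  unfolding pd_def[of i "\<lambda>x. u x + v x"]
  by (intro vector_derivative_at has_vector_derivative_add trig_poly_pd_derivative assms)

lemma pd_scale:
  assumes "u \<in> trig_poly L"
  shows "pd i (\<lambda>x. c *\<^sub>R u x) x = c *\<^sub>R pd i u x"
  unfolding pd_def[of i "\<lambda>x. c *\<^sub>R u x"]
  using bounded_linear.has_vector_derivative[OF bounded_linear_scaleR_right trig_poly_pd_derivative[OF assms]]
  by (rule vector_derivative_at)

lemma sol_poly_trig: "u \<in> sol_poly L \<Longrightarrow> u \<in> trig_poly L" by (simp add: sol_poly_def)

lemma sol_poly_L2: "u \<in> sol_poly L \<Longrightarrow> u \<in> L2 L" by (simp add: sol_poly_trig trig_poly_L2)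

lemma sol_poly_add:
  assumes "u \<in> sol_poly L" "v \<in> sol_poly L" shows "(\<lambda>x. u x + v x) \<in> sol_poly L"
  using assms unfolding sol_poly_def
  by (auto simp: trig_poly_add divergence_def pd_add sum.distrib L2_integrable[OF trig_poly_L2])

lemma sol_poly_scale:
  assumes "u \<in> sol_poly L" shows "(\<lambda>x. c *\<^sub>R u x) \<in> sol_poly L"
  using assms unfolding sol_poly_def
  by (auto simp: trig_poly_scale divergence_def pd_scale sum_distrib_left[symmetric])

lemma sol_poly_diff:
  assumes "u \<in> sol_poly L" "v \<in> sol_poly L" shows "(\<lambda>x. u x - v x) \<in> sol_poly L"
  using sol_poly_add[OF assms(1) sol_poly_scale[OF assms(2), of "-1"]] by simp

lemma zero_sol_poly: "(\<lambda>x. 0) \<in> sol_poly L"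
proof -
  have "(\<lambda>x. 0) \<in> trig_poly L" unfolding trig_poly_def
    by (intro CollectI exI[of _ "{}"]) auto
  from pd_scale[OF this, of _ 0] this show ?thesis by (auto simp: sol_poly_def divergence_def)
qed

section \<open>The closed space \<open>H\<close> and the projection onto it\<close>

lemma H_L2: "u \<in> H L \<Longrightarrow> u \<in> L2 L" by (simp add: H_def)

lemma sol_poly_H: assumes "u \<in> sol_poly L" shows "u \<in> H L"
  using assms sol_poly_L2 unfolding H_def
  by (auto intro!: bexI[of _ u] simp: L2_norm_def L2_inner_def)

lemma H_add: assumes "u \<in> H L" "v \<in> H L" shows "(\<lambda>x. u x + v x) \<in> H L"
  unfolding H_def
proof (intro CollectI conjI allI impI)
  show "(\<lambda>x. u x + v x) \<in> L2 L" using assms H_L2 L2_add by blast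
  fix e :: real assume "e > 0"
  then have e: "e / 2 > 0" by simp
  obtain \<phi> where \<phi>: "\<phi> \<in> sol_poly L" "L2_norm L (\<lambda>x. u x - \<phi> x) < e / 2"
    using assms(1) e unfolding H_def by blast
  obtain \<psi> where \<psi>: "\<psi> \<in> sol_poly L" "L2_norm L (\<lambda>x. v x - \<psi> x) < e / 2"
    using assms(2) e unfolding H_def by blast
  have "L2_norm L (\<lambda>x. (u x - \<phi> x) + (v x - \<psi> x)) \<le> L2_norm L (\<lambda>x. u x - \<phi> x) + L2_norm L (\<lambda>x. v x - \<psi> x)"
    using assms \<phi> \<psi> by (intro L2_triangle L2_diff H_L2 sol_poly_L2)
  also have "\<dots> < e" using \<phi>(2) \<psi>(2) by simp
  also have "(\<lambda>x. (u x - \<phi> x) + (v x - \<psi> x)) = (\<lambda>x. u x + v x - (\<phi> x + \<psi> x))" by (auto simp: algebra_simps)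
  finally show "\<exists>\<phi>\<in>sol_poly L. L2_norm L (\<lambda>x. u x + v x - \<phi> x) < e"
    by (rule bexI[of _ "\<lambda>x. \<phi> x + \<psi> x"]) (rule sol_poly_add[OF \<phi>(1) \<psi>(1)])
qed

lemma H_uminus: assumes "u \<in> H L" shows "(\<lambda>x. - u x) \<in> H L"
  unfolding H_def
proof (intro CollectI conjI allI impI)
  show "(\<lambda>x. - u x) \<in> L2 L" using assms H_L2 L2_uminus by blast
  fix e :: real assume "e > 0"
  then obtain \<phi> where \<phi>: "\<phi> \<in> sol_poly L" "L2_norm L (\<lambda>x. u x - \<phi> x) < e"
    using assms(1) unfolding H_def by blast
  have "L2_norm L (\<lambda>x. - u x - (-1) *\<^sub>R \<phi> x) < e"
    using \<phi>(2) L2_norm_diff_commute[of u \<phi>] by simp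
  then show "\<exists>\<phi>\<in>sol_poly L. L2_norm L (\<lambda>x. - u x - \<phi> x) < e"
    using sol_poly_scale[OF \<phi>(1), of "-1"] by (intro bexI) auto
qed

lemma H_diff: assumes "u \<in> H L" "v \<in> H L" shows "(\<lambda>x. u x - v x) \<in> H L"
  using H_add[OF assms(1) H_uminus[OF assms(2)]] by simp

text \<open>By continuity of the inner product it suffices to test with the dense set of
  polynomials. The \<open>+ 1\<close> in the choice of \<open>e\<close> allows \<open>r\<close> to
  have norm zero.\<close>

lemma H_orthogonalI:
  assumes r: "r \<in> L2 L" and o: "\<And>\<phi>. \<phi> \<in> sol_poly L \<Longrightarrow> L2_inner L r \<phi> = 0" and w: "w \<in> H L"
  shows "L2_inner L r w = 0"
proof (rule ccontr)
  assume n: "L2_inner L r w \<noteq> 0"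
  define e where "e = \<bar>L2_inner L r w\<bar> / (L2_norm L r + 1)"
  have p: "L2_norm L r + 1 > 0" using L2_norm_nonneg[of r] by linarith
  have "e > 0" using n p by (simp add: e_def)
  then obtain \<phi> where \<phi>: "\<phi> \<in> sol_poly L" "L2_norm L (\<lambda>x. w x - \<phi> x) < e"
    using w unfolding H_def by blast
  have "\<bar>L2_inner L r w\<bar> = \<bar>L2_inner L r (\<lambda>x. w x - \<phi> x)\<bar>"
    using o[OF \<phi>(1)] r H_L2[OF w] sol_poly_L2[OF \<phi>(1)] by (simp add: L2_inner_diff_right)
  also have "\<dots> \<le> L2_norm L r * L2_norm L (\<lambda>x. w x - \<phi> x)"
    using r H_L2[OF w] sol_poly_L2[OF \<phi>(1)] by (intro L2_Cauchy_Schwarz L2_diff)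
  also have "\<dots> \<le> L2_norm L r * e" using \<phi>(2) by (intro mult_left_mono) (auto simp: L2_norm_nonneg)
  also have "\<dots> < (L2_norm L r + 1) * e" using \<open>e > 0\<close> by (simp add: algebra_simps)
  also have "\<dots> = \<bar>L2_inner L r w\<bar>" using p by (simp add: e_def)
  finally show False by simp
qed

text \<open>The Hilbert space projection theorem, starting from a minimizing sequence of
  polynomials. Its excess \<open>(1/4)^n / 4\<close> is chosen so that the parallelogram law gives
  exactly the Cauchy rate \<open>(1/2)^n\<close> required by \<open>L2_complete\<close>.\<close>

lemma projection_exists:
  assumes g: "g \<in> L2 L"
  shows "\<exists>h. h \<in> H L \<and> (\<forall>w\<in>H L. L2_inner L (\<lambda>x. g x - h x) w = 0)"
proof -
  define N where "N \<phi> = (L2_norm L (\<lambda>x. g x - \<phi> x))\<^sup>2" for \<phi>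
  define d where "d = Inf (N ` sol_poly L)"
  have bdd: "bdd_below (N ` sol_poly L)" by (rule bdd_belowI[of _ 0]) (auto simp: N_def)
  have dle: "d \<le> N \<phi>" if "\<phi> \<in> sol_poly L" for \<phi>
    unfolding d_def using bdd that by (intro cInf_lower) auto
  have "\<exists>\<phi>\<in>sol_poly L. N \<phi> < d + e" if "e > 0" for e
    using cInf_lessD[of "N ` sol_poly L" "d + e"] that zero_sol_poly unfolding d_def by force
  then have "\<forall>n. \<exists>\<phi>. \<phi> \<in> sol_poly L \<and> N \<phi> < d + (1/4)^n / 4" by (metis divide_pos_pos zero_less_power zero_less_numeral zero_less_divide_1_iff)
  then obtain \<phi> where \<phi>: "\<And>n. \<phi> n \<in> sol_poly L" "\<And>n. N (\<phi> n) < d + (1/4)^n / 4" by metis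
  have \<phi>L: "\<phi> n \<in> L2 L" for n using \<phi>(1) sol_poly_L2 by blast
  have "L2_norm L (\<lambda>x. \<phi> m x - \<phi> n x) \<le> (1/2)^n" if "n \<le> m" for n m
  proof (rule power2_le_imp_le)
    define p q where "p = (\<lambda>x. g x - \<phi> n x)" and "q = (\<lambda>x. g x - \<phi> m x)"
    have pq: "p \<in> L2 L" "q \<in> L2 L" unfolding p_def q_def using g \<phi>L by (auto intro: L2_diff)
    have "(\<lambda>x. p x - q x) = (\<lambda>x. \<phi> m x - \<phi> n x)" by (auto simp: p_def q_def)
    moreover have "(\<lambda>x. p x + q x) = (\<lambda>x. 2 *\<^sub>R (g x - (1/2) *\<^sub>R (\<phi> n x + \<phi> m x)))"
      by (auto simp: p_def q_def algebra_simps scaleR_2)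
    moreover have "(L2_norm L (\<lambda>x. p x - q x))\<^sup>2 + (L2_norm L (\<lambda>x. p x + q x))\<^sup>2 = 2 * (L2_norm L p)\<^sup>2 + 2 * (L2_norm L q)\<^sup>2"
      using pq by (simp add: L2_norm_sq_add L2_norm_sq_diff)
    ultimately have "(L2_norm L (\<lambda>x. \<phi> m x - \<phi> n x))\<^sup>2 + 4 * N (\<lambda>x. (1/2) *\<^sub>R (\<phi> n x + \<phi> m x)) = 2 * N (\<phi> n) + 2 * N (\<phi> m)"
      unfolding N_def p_def q_def by (simp add: L2_norm_scale power_mult_distrib)
    moreover have "d \<le> N (\<lambda>x. (1/2) *\<^sub>R (\<phi> n x + \<phi> m x))"
      by (intro dle sol_poly_scale sol_poly_add \<phi>)
    moreover have "(1/4::real)^m \<le> (1/4)^n" using that by (intro power_decreasing) auto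
    ultimately have "(L2_norm L (\<lambda>x. \<phi> m x - \<phi> n x))\<^sup>2 \<le> (1/4)^n"
      using \<phi>(2)[of n] \<phi>(2)[of m] by linarith
    also have "(1/4::real)^n = ((1/2)^n)\<^sup>2"
      by (simp add: power_mult_distrib[symmetric] power2_eq_square)
    finally show "(L2_norm L (\<lambda>x. \<phi> m x - \<phi> n x))\<^sup>2 \<le> ((1/2)^n)\<^sup>2" .
  qed simp
  from L2_complete[OF \<phi>L this] obtain h where
    h: "h \<in> L2 L" "\<And>n. L2_norm L (\<lambda>x. \<phi> n x - h x) \<le> (1/2)^n" by blast
  have half: "(\<lambda>n. (1/2::real)^n) \<longlonglongrightarrow> 0" by (rule LIMSEQ_realpow_zero) auto
  have hH: "h \<in> H L"
    unfolding H_def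
  proof (intro CollectI conjI allI impI h)
    fix e :: real assume "e > 0"
    then obtain n where "(1/2::real)^n < e"
      using real_arch_pow_inv[of e "1/2"] by auto
    then show "\<exists>\<phi>\<in>sol_poly L. L2_norm L (\<lambda>x. h x - \<phi> x) < e"
      using h(2)[of n] \<phi>(1)[of n] L2_norm_diff_commute[of h "\<phi> n"]
      by (intro bexI[of _ "\<phi> n"]) auto
  qed
  define r where "r = (\<lambda>x. g x - h x)"
  have rL: "r \<in> L2 L" unfolding r_def by (intro L2_diff g h)
  have Nlim: "(L2_norm L r)\<^sup>2 \<le> d"
  proof -
    have "L2_norm L r \<le> sqrt (d + (1/4)^n / 4) + (1/2)^n" for n
    proof -
      have "L2_norm L r \<le> L2_norm L (\<lambda>x. g x - \<phi> n x) + L2_norm L (\<lambda>x. \<phi> n x - h x)"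
        unfolding r_def by (intro L2_triangle_diff g h \<phi>L)
      also have "L2_norm L (\<lambda>x. g x - \<phi> n x) \<le> sqrt (d + (1/4)^n / 4)"
        using \<phi>(2)[of n] by (intro real_le_rsqrt) (simp add: N_def)
      finally show ?thesis using h(2)[of n] by linarith
    qed
    moreover have "(\<lambda>n. sqrt (d + (1/4)^n / 4) + (1/2)^n) \<longlonglongrightarrow> sqrt (d + 0 / 4) + 0"
      by (intro tendsto_intros half LIMSEQ_realpow_zero) auto
    ultimately have "L2_norm L r \<le> sqrt d" by (intro LIMSEQ_le_const) auto
    moreover have "d \<ge> 0" unfolding d_def using zero_sol_poly
      by (intro cInf_greatest) (auto simp: N_def)
    ultimately show ?thesis using L2_norm_nonneg[of r]
      by (metis power_mono real_sqrt_pow2)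
  qed
  \<comment> \<open>The infimum \<open>d\<close> is taken over polynomials only; the competitor
    \<open>h + t \<psi>\<close> is reached as the limit of the polynomials
    \<open>\<phi> n + t \<psi>\<close>.\<close>
  have Nge: "d \<le> (L2_norm L (\<lambda>x. r x - t *\<^sub>R \<psi> x))\<^sup>2" if \<psi>: "\<psi> \<in> sol_poly L" for \<psi> t
  proof -
    have s: "sqrt d \<le> L2_norm L (\<lambda>x. r x - t *\<^sub>R \<psi> x) + (1/2)^n" for n
    proof -
      have L: "(\<lambda>x. \<phi> n x + t *\<^sub>R \<psi> x) \<in> L2 L" "(\<lambda>x. h x + t *\<^sub>R \<psi> x) \<in> L2 L"
        using sol_poly_L2[OF \<psi>] \<phi>L h by (auto intro: L2_add L2_scale)
      have "sqrt d \<le> L2_norm L (\<lambda>x. g x - (\<phi> n x + t *\<^sub>R \<psi> x))"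
        using dle[OF sol_poly_add[OF \<phi>(1)[of n] sol_poly_scale[OF \<psi>, of t]]] 
        by (intro real_le_lsqrt) (auto simp: N_def L2_norm_nonneg)
      also have "\<dots> \<le> L2_norm L (\<lambda>x. g x - (h x + t *\<^sub>R \<psi> x)) + L2_norm L (\<lambda>x. (h x + t *\<^sub>R \<psi> x) - (\<phi> n x + t *\<^sub>R \<psi> x))"
        by (intro L2_triangle_diff g L)
      also have "(\<lambda>x. (h x + t *\<^sub>R \<psi> x) - (\<phi> n x + t *\<^sub>R \<psi> x)) = (\<lambda>x. h x - \<phi> n x)" by auto
      also have "(\<lambda>x. g x - (h x + t *\<^sub>R \<psi> x)) = (\<lambda>x. r x - t *\<^sub>R \<psi> x)" by (auto simp: r_def)
      finally show ?thesis using h(2)[of n] L2_norm_diff_commute[of h "\<phi> n"] by linarith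
    qed
    have "(\<lambda>n. L2_norm L (\<lambda>x. r x - t *\<^sub>R \<psi> x) + (1/2)^n) \<longlonglongrightarrow> L2_norm L (\<lambda>x. r x - t *\<^sub>R \<psi> x) + 0"
      by (intro tendsto_intros half)
    then have "sqrt d \<le> L2_norm L (\<lambda>x. r x - t *\<^sub>R \<psi> x) + 0"
      by (rule LIMSEQ_le_const) (use s in auto)
    then show ?thesis by (simp add: real_le_lsqrt sqrt_le_D)
  qed
  have "L2_inner L r \<psi> = 0" if \<psi>: "\<psi> \<in> sol_poly L" for \<psi>
  proof -
    define a b where "a = L2_inner L r \<psi>" and "b = (L2_norm L \<psi>)\<^sup>2"
    have b: "b \<ge> 0" by (simp add: b_def)
    have q: "2 * t * a \<le> t\<^sup>2 * b" for t
      using Nge[OF \<psi>, of t] Nlim sol_poly_L2[OF \<psi>]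
      by (simp add: L2_norm_sq_diff rL L2_scale L2_inner_scale_right L2_norm_scale power_mult_distrib a_def b_def)
    \<comment> \<open>The optimal value of \<open>t\<close> would be \<open>a / b\<close>;
      \<open>b + 1\<close> avoids the case \<open>b = 0\<close> and still forces
      \<open>a = 0\<close>.\<close>
    have "2 * (a / (b + 1)) * a \<le> (a / (b + 1))\<^sup>2 * b" by (rule q)
    then have "2 * a\<^sup>2 * (b + 1) \<le> a\<^sup>2 * b" using b
      by (simp add: power2_eq_square divide_simps)
    then have "a\<^sup>2 * b + 2 * a\<^sup>2 \<le> 0" by (simp add: algebra_simps)
    moreover have "a\<^sup>2 * b \<ge> 0" using b by simp
    ultimately have "a\<^sup>2 \<le> 0" by linarith
    then show ?thesis by (simp add: a_def)
  qed
  then have "\<forall>w\<in>H L. L2_inner L (\<lambda>x. g x - h x) w = 0"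
    using H_orthogonalI[OF rL] unfolding r_def by blast
  with hH show ?thesis by blast
qed

lemma leray_H: "g \<in> L2 L \<Longrightarrow> leray L g \<in> H L"
  and leray_orthogonal: "g \<in> L2 L \<Longrightarrow> w \<in> H L \<Longrightarrow> L2_inner L (\<lambda>x. g x - leray L g x) w = 0"
  using someI_ex[OF projection_exists] unfolding leray_def by blast+

lemma leray_inner:
  assumes "g \<in> L2 L" "w \<in> H L" shows "L2_inner L (leray L g) w = L2_inner L g w"
  using leray_orthogonal[OF assms] assms leray_H[of g] H_L2 by (simp add: L2_inner_diff_left)

end

section \<open>Density of trigonometric polynomials\<close>

context torus begin

lemma exp_sum_scale: "exp_sum f \<Longrightarrow> exp_sum (\<lambda>x. c * f x)"
  unfolding exp_sum_def
proof (elim exE conjE)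
  fix G d assume "finite G" "G \<subseteq> lat" "f = (\<lambda>x. \<Sum>k\<in>G. d k * cis (k \<bullet> x))"
  then show "\<exists>G d. finite G \<and> G \<subseteq> lat \<and> (\<lambda>x. c * f x) = (\<lambda>x. \<Sum>k\<in>G. d k * cis (k \<bullet> x))"
    by (intro exI[of _ G] exI[of _ "\<lambda>k. c * d k"]) (simp add: sum_distrib_left mult.assoc)
qed

lemma exp_sum_mult: assumes "exp_sum f" "exp_sum g" shows "exp_sum (\<lambda>x. f x * g x)"
proof -
  obtain G c where f: "finite G" "G \<subseteq> lat" "f = (\<lambda>x. \<Sum>k\<in>G. c k * cis (k \<bullet> x))"
    using assms(1) unfolding exp_sum_def by blast
  obtain G' c' where g: "finite G'" "G' \<subseteq> lat" "g = (\<lambda>x. \<Sum>k\<in>G'. c' k * cis (k \<bullet> x))"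
    using assms(2) unfolding exp_sum_def by blast
  have "f x * g x = (\<Sum>k\<in>G. \<Sum>l\<in>G'. (c k * c' l) * cis ((k + l) \<bullet> x))" for x
    unfolding f(3) g(3) sum_product
    by (intro sum.cong refl) (simp add: inner_add_left cis_mult[symmetric] mult_ac)
  moreover have "exp_sum (\<lambda>x. \<Sum>k\<in>G. \<Sum>l\<in>G'. (c k * c' l) * cis ((k + l) \<bullet> x))"
    using f g by (intro exp_sum_sum exp_sum_single lat_add) auto
  ultimately show ?thesis by (simp only:)
qed

text \<open>Stone-Weierstrass is applied on the image of this embedding of the torus.\<close>

definition \<theta> :: "real^2 \<Rightarrow> complex \<times> complex" where
  "\<theta> x = (cis (2 * pi / L * x $ 1), cis (2 * pi / L * x $ 2))"

lemma zero_lat: "0 \<in> lat" by (simp add: lat_def)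

lemma exp_sum_cos_sin:
  assumes "k \<in> lat"
  shows "exp_sum (\<lambda>x. of_real (cos (k \<bullet> x)))" "exp_sum (\<lambda>x. of_real (sin (k \<bullet> x)))"
proof -
  have "(\<lambda>x. complex_of_real (cos (k \<bullet> x))) = (\<lambda>x. 1 / 2 * cis (k \<bullet> x) + 1 / 2 * cis ((- k) \<bullet> x))"
    by (auto simp: complex_eq_iff)
  then show "exp_sum (\<lambda>x. of_real (cos (k \<bullet> x)))"
    using exp_sum_add[OF exp_sum_single[OF assms] exp_sum_single[OF lat_uminus[OF assms]]] by metis
  have "(\<lambda>x. complex_of_real (sin (k \<bullet> x))) = (\<lambda>x. - \<i> / 2 * cis (k \<bullet> x) + \<i> / 2 * cis ((- k) \<bullet> x))"
    by (auto simp: complex_eq_iff)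
  then show "exp_sum (\<lambda>x. of_real (sin (k \<bullet> x)))"
    using exp_sum_add[OF exp_sum_single[OF assms] exp_sum_single[OF lat_uminus[OF assms]]] by metis
qed

text \<open>Linear functionals of \<open>\<theta> x\<close> are combinations of cosines and sines at
  the two basic frequencies, and exponential sums form an algebra. Hence the polynomials provided by
  Stone-Weierstrass are covered by the orthogonality hypothesis on \<open>r\<close>.\<close>

lemma polynomial_exp_sum:
  assumes "real_polynomial_function p"
  shows "exp_sum (\<lambda>x. complex_of_real (p (\<theta> x)))"
  using assms
proof (induction p rule: real_polynomial_function.induct)
  case (linear f)
  interpret f: bounded_linear f by (rule linear)
  define k1 k2 where "k1 = (2 * pi / L) *\<^sub>R (vector [of_int 1, of_int 0] :: real^2)"
    and "k2 = (2 * pi / L) *\<^sub>R (vector [of_int 0, of_int 1] :: real^2)"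
  have k: "k1 \<in> lat" "k2 \<in> lat" unfolding lat_iff k1_def k2_def by blast+
  have i: "k1 \<bullet> x = 2 * pi / L * x $ 1" "k2 \<bullet> x = 2 * pi / L * x $ 2" for x
    by (simp_all add: k1_def k2_def inner_vec_def sum_2)
  have "\<theta> x = cos (k1 \<bullet> x) *\<^sub>R (1, 0) + sin (k1 \<bullet> x) *\<^sub>R (\<i>, 0)
      + cos (k2 \<bullet> x) *\<^sub>R (0, 1) + sin (k2 \<bullet> x) *\<^sub>R (0, \<i>)" for x
    by (auto simp: \<theta>_def i complex_eq_iff)
  then have "complex_of_real (f (\<theta> x)) = of_real (f (1, 0)) * of_real (cos (k1 \<bullet> x))
      + of_real (f (\<i>, 0)) * of_real (sin (k1 \<bullet> x))
      + of_real (f (0, 1)) * of_real (cos (k2 \<bullet> x)) + of_real (f (0, \<i>)) * of_real (sin (k2 \<bullet> x))" for x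
    by (simp only: f.add f.scaleR real_scaleR_def of_real_add of_real_mult mult_ac)
  moreover have "exp_sum (\<lambda>x. of_real (f (1, 0)) * of_real (cos (k1 \<bullet> x))
      + of_real (f (\<i>, 0)) * of_real (sin (k1 \<bullet> x))
      + of_real (f (0, 1)) * of_real (cos (k2 \<bullet> x)) + of_real (f (0, \<i>)) * of_real (sin (k2 \<bullet> x)))"
    by (intro exp_sum_add exp_sum_scale exp_sum_cos_sin k)
  ultimately show ?case by (simp only:)
next
  case (const c)
  then show ?case using exp_sum_single[OF zero_lat, of "of_real c"] by simp
next
  case (add f g) then show ?case using exp_sum_add by fastforce
next
  case (mult f g) then show ?case using exp_sum_mult by fastforce
qed

section \<open>Completeness: a square integrable field without Fourier coefficients is null\<close>

context
  fixes r :: field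
  assumes r: "r \<in> L2 L" and r0: "\<And>k. k \<in> lat \<Longrightarrow> fourier_coeff L r k = 0"
begin

lemma component_integrable: "integrable M (\<lambda>x. r x $ j)"
  using L2_integrable[OF r] by (subst (asm) integrable_iff_component) (auto simp: Omega_cbox)

lemma component_mult_integrable:
  assumes "g \<in> borel_measurable M" "\<And>x. x \<in> Omega L \<Longrightarrow> \<bar>g x\<bar> \<le> (B :: real)"
  shows "integrable M (\<lambda>x. r x $ j * g x)"
proof (rule Bochner_Integration.integrable_bound)
  show "integrable M (\<lambda>x. B * (r x $ j))" using component_integrable by simp
  show "(\<lambda>x. r x $ j * g x) \<in> borel_measurable M"
    using assms(1) borel_measurable_integrable[OF component_integrable] by measurable
  show "AE x in M. norm (r x $ j * g x) \<le> norm (B * (r x $ j))"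
  proof (rule AE_I2)
    fix x assume "x \<in> space M"
    then have "\<bar>g x\<bar> \<le> \<bar>B\<bar>" using assms(2)[of x] by simp
    then show "norm (r x $ j * g x) \<le> norm (B * (r x $ j))"
      using mult_right_mono[of "\<bar>g x\<bar>" "\<bar>B\<bar>" "\<bar>r x $ j\<bar>"] by (simp add: abs_mult mult.commute)
  qed
qed

lemma orthogonal_exp_sum:
  assumes "exp_sum f" shows "(\<integral>x. complex_of_real (r x $ j) * f x \<partial>M) = 0"
proof -
  obtain G c where f: "finite G" "G \<subseteq> lat" "f = (\<lambda>x. \<Sum>k\<in>G. c k * cis (k \<bullet> x))"
    using assms unfolding exp_sum_def by blast
  have i: "integrable M (\<lambda>x. complex_of_real (r x $ j) * cis (k \<bullet> x))" for k
    using fc_integrable[OF r, of j "- k"] by simp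
  have z: "(\<integral>x. complex_of_real (r x $ j) * cis (k \<bullet> x) \<partial>M) = 0" if "k \<in> lat" for k
    using r0[OF lat_uminus[OF that]] L_pos fc_component[of r "- k" j] by simp
  have "(\<integral>x. complex_of_real (r x $ j) * f x \<partial>M)
      = (\<integral>x. (\<Sum>k\<in>G. c k * (complex_of_real (r x $ j) * cis (k \<bullet> x))) \<partial>M)"
    by (simp add: f(3) sum_distrib_left mult_ac)
  also have "\<dots> = (\<Sum>k\<in>G. c k * (\<integral>x. complex_of_real (r x $ j) * cis (k \<bullet> x) \<partial>M))"
    using i by (subst Bochner_Integration.integral_sum) auto
  also have "\<dots> = 0" using z f(2) by (intro sum.neutral) auto
  finally show ?thesis .
qed

text \<open>By \<open>fib\<close>, \<open>f\<close> descends to a function \<open>F\<close> on the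
  image of the square under \<open>\<theta>\<close>, whatever preimages are chosen. \<open>F\<close>
  is continuous because \<open>\<theta>\<close> maps closed subsets of the compact square to closed
  sets. A uniform polynomial approximation of \<open>F\<close> within \<open>e\<close> then changes
  the integral by at most \<open>e * K\<close>.\<close>

lemma orthogonal_periodic:
  assumes f: "continuous_on UNIV (f :: real^2 \<Rightarrow> real)"
    and fib: "\<And>x y. x \<in> Omega L \<Longrightarrow> y \<in> Omega L \<Longrightarrow> \<theta> x = \<theta> y \<Longrightarrow> f x = f y"
  shows "(\<integral>x. r x $ j * f x \<partial>M) = 0"
proof -
  have cO: "compact (Omega L)" unfolding Omega_cbox by (rule compact_cbox)
  have c\<theta>: "continuous_on S \<theta>" for S
    unfolding \<theta>_def by (intro continuous_intros)
  define F where "F z = f (SOME x. x \<in> Omega L \<and> \<theta> x = z)" for z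
  have F: "F (\<theta> x) = f x" if "x \<in> Omega L" for x
  proof -
    have "\<exists>y. y \<in> Omega L \<and> \<theta> y = \<theta> x" using that by blast
    then show ?thesis unfolding F_def using fib[OF _ that] by (metis (mono_tags, lifting) someI_ex)
  qed
  have cT: "compact (\<theta> ` Omega L)" by (intro compact_continuous_image c\<theta> cO)
  have cF: "continuous_on (\<theta> ` Omega L) F"
  proof (subst continuous_on_closed_vimage[OF compact_imp_closed[OF cT]], intro allI impI)
    fix B :: "real set" assume B: "closed B"
    have "F -` B \<inter> \<theta> ` Omega L = \<theta> ` (Omega L \<inter> f -` B)" using F by auto
    moreover have "closed (f -` B)"
      by (intro continuous_closed_vimage[OF B]) (use f in \<open>simp add: continuous_on_eq_continuous_at\<close>)
    ultimately show "closed (F -` B \<inter> \<theta> ` Omega L)"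
      by (metis c\<theta> cO compact_Int_closed compact_continuous_image compact_imp_closed)
  qed
  define K where "K = (\<integral>x. \<bar>r x $ j\<bar> \<partial>M)"
  have K0: "K \<ge> 0" unfolding K_def by (rule Bochner_Integration.integral_nonneg) simp
  obtain Bf where Bf: "\<And>x. x \<in> Omega L \<Longrightarrow> \<bar>f x\<bar> \<le> Bf"
    using compact_imp_bounded[OF compact_continuous_image[OF continuous_on_subset[OF f] cO]]
    unfolding bounded_iff by auto
  have "\<bar>\<integral>x. r x $ j * f x \<partial>M\<bar> \<le> e * K" if "e > 0" for e
  proof -
    obtain p where p: "real_polynomial_function p" "\<And>z. z \<in> \<theta> ` Omega L \<Longrightarrow> \<bar>F z - p z\<bar> < e"
      using Stone_Weierstrass_real_polynomial_function[OF cT cF \<open>e > 0\<close>] by blast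
    have pc: "continuous_on UNIV (\<lambda>x. p (\<theta> x))"
      using continuous_on_compose2[OF continuous_on_polymonial_function c\<theta>] p(1) real_polynomial_function_eq by blast
    have pb: "\<bar>p (\<theta> x)\<bar> \<le> Bf + e" if "x \<in> Omega L" for x
      using p(2)[of "\<theta> x"] F[OF that] Bf[OF that] that by (auto simp: abs_le_iff abs_less_iff)
    have "(\<integral>x. complex_of_real (r x $ j) * complex_of_real (p (\<theta> x)) \<partial>M) = 0"
      by (rule orthogonal_exp_sum[OF polynomial_exp_sum[OF p(1)]])
    then have p0: "(\<integral>x. r x $ j * p (\<theta> x) \<partial>M) = 0"
      unfolding of_real_mult[symmetric] integral_complex_of_real by simp
    have i1: "integrable M (\<lambda>x. r x $ j * f x)"
      by (rule component_mult_integrable[OF continuous_measurable[OF f] Bf])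
    have i2: "integrable M (\<lambda>x. r x $ j * p (\<theta> x))"
      by (rule component_mult_integrable[OF continuous_measurable[OF pc] pb])
    have "\<bar>\<integral>x. r x $ j * f x \<partial>M\<bar> = \<bar>\<integral>x. r x $ j * f x - r x $ j * p (\<theta> x) \<partial>M\<bar>"
      using i1 i2 p0 by simp
    also have "\<dots> \<le> (\<integral>x. e * \<bar>r x $ j\<bar> \<partial>M)"
    proof (rule integral_abs_bound[THEN order_trans], rule integral_mono)
      show "integrable M (\<lambda>x. \<bar>r x $ j * f x - r x $ j * p (\<theta> x)\<bar>)"
        using i1 i2 by (intro integrable_abs Bochner_Integration.integrable_diff)
      show "integrable M (\<lambda>x. e * \<bar>r x $ j\<bar>)" using component_integrable by simp
      fix x assume x: "x \<in> space M"
      have "\<bar>f x - p (\<theta> x)\<bar> \<le> e" using p(2)[of "\<theta> x"] F[of x] x by auto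
      then have "\<bar>r x $ j\<bar> * \<bar>f x - p (\<theta> x)\<bar> \<le> \<bar>r x $ j\<bar> * e" by (intro mult_left_mono) auto
      then show "\<bar>r x $ j * f x - r x $ j * p (\<theta> x)\<bar> \<le> e * \<bar>r x $ j\<bar>"
        unfolding right_diff_distrib[symmetric] abs_mult by (simp only: mult.commute)
    qed
    also have "\<dots> = e * K" by (simp add: K_def)
    finally show ?thesis .
  qed note b = this
  show ?thesis
  proof (rule ccontr)
    assume n: "(\<integral>x. r x $ j * f x \<partial>M) \<noteq> 0"
    define a where "a = \<bar>\<integral>x. r x $ j * f x \<partial>M\<bar>"
    have a: "a > 0" using n by (simp add: a_def)
    have "a \<le> a / (2 * (K + 1)) * K" unfolding a_def using a K0
      by (intro b) (auto simp: a_def)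
    also have "\<dots> < a"
    proof -
      have "0 \<le> K * a" using K0 a by simp
      then have "0 < K * a + a * 2" using a by linarith
      then show ?thesis using K0 by (simp add: field_simps)
    qed
    finally show False by simp
  qed
qed

text \<open>Coordinates with equal images differ by an integer multiple of \<open>L\<close>, and
  within the square that integer is -1, 0 or 1. So \<open>\<theta>\<close> glues only opposite
  sides.\<close>

lemma \<theta>_eq_cases:
  assumes "x \<in> Omega L" "y \<in> Omega L" "\<theta> x = \<theta> y" "x $ i \<noteq> y $ i"
  shows "x $ i \<in> {0, L} \<and> y $ i \<in> {0, L}"
proof -
  have "cis (2 * pi / L * x $ i) = cis (2 * pi / L * y $ i)"
    using assms(3) exhaust_2[of i] by (auto simp: \<theta>_def)
  then have "sin (2 * pi / L * x $ i) = sin (2 * pi / L * y $ i) \<and> cos (2 * pi / L * x $ i) = cos (2 * pi / L * y $ i)"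
    by (simp add: complex_eq_iff)
  then obtain n :: int where "2 * pi / L * x $ i = 2 * pi / L * y $ i + 2 * pi * n"
    unfolding sin_cos_eq_iff by (auto simp: algebra_simps)
  then have "2 * pi / L * x $ i = 2 * pi / L * (y $ i + n * L)" using L_pos by (simp add: distrib_left)
  then have n: "x $ i = y $ i + n * L" using L_pos by (subst (asm) mult_cancel_left) auto
  have xy: "0 \<le> x $ i" "x $ i \<le> L" "0 \<le> y $ i" "y $ i \<le> L" using assms(1,2) by (auto simp: Omega_def)
  have "real_of_int n * L \<le> 1 * L" "(-1) * L \<le> real_of_int n * L" using n xy by linarith+
  then have "real_of_int n \<le> 1" "-1 \<le> real_of_int n"
    using L_pos mult_le_cancel_right[of "real_of_int n" L 1] mult_le_cancel_right[of "-1" L "real_of_int n"] by auto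
  then have "n = 1 \<or> n = 0 \<or> n = -1" by linarith
  then show ?thesis using n xy assms(4) by auto
qed

text \<open>The cutoffs vanish on the boundary of the square, so that the products with \<open>g\<close> are periodic.\<close>

lemma orthogonal_continuous:
  assumes g: "continuous_on UNIV (g :: real^2 \<Rightarrow> real)" and b: "\<And>x. \<bar>g x\<bar> \<le> 1"
  shows "(\<integral>x. r x $ j * g x \<partial>M) = 0"
proof -
  define ch where "ch m x = (\<Prod>i\<in>UNIV. min 1 (real m * (x $ i * (L - x $ i))))" for m :: nat and x :: "real^2"
  have cc: "continuous_on UNIV (ch m)" for m unfolding ch_def by (intro continuous_intros)
  have chb: "\<bar>ch m x\<bar> \<le> 1" if "x \<in> Omega L" for m x
    unfolding ch_def abs_prod using that by (intro prod_le_1) (auto simp: Omega_def abs_le_iff min_def)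
  have z: "(\<integral>x. r x $ j * (g x * ch m x) \<partial>M) = 0" for m
  proof (rule orthogonal_periodic)
    show "continuous_on UNIV (\<lambda>x. g x * ch m x)" by (intro continuous_intros g cc)
    fix x y assume xy: "x \<in> Omega L" "y \<in> Omega L" "\<theta> x = \<theta> y"
    show "g x * ch m x = g y * ch m y"
    proof (cases "x = y")
      case False
      then obtain i where i: "x $ i \<noteq> y $ i" by (auto simp: vec_eq_iff)
      then have "x $ i * (L - x $ i) = 0" "y $ i * (L - y $ i) = 0"
        using \<theta>_eq_cases[OF xy i] by auto
      then have "ch m x = 0" "ch m y = 0"
        unfolding ch_def by (auto intro!: prod_zero exI[of _ i] simp: mult.assoc)
      then show ?thesis by simp
    qed simp
  qed
  have "(\<lambda>m. \<integral>x. r x $ j * (g x * ch m x) \<partial>M) \<longlonglongrightarrow> (\<integral>x. r x $ j * g x \<partial>M)"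
  proof (rule integral_dominated_convergence)
    show "integrable M (\<lambda>x. \<bar>r x $ j\<bar>)" using component_integrable by simp
    show "(\<lambda>x. r x $ j * g x) \<in> borel_measurable M"
      by (intro borel_measurable_integrable component_mult_integrable[OF continuous_measurable[OF g], of 1] b)
    show "(\<lambda>x. r x $ j * (g x * ch m x)) \<in> borel_measurable M" for m
      by (intro borel_measurable_times continuous_measurable g cc borel_measurable_integrable[OF component_integrable])
    show "AE x in M. norm (r x $ j * (g x * ch m x)) \<le> \<bar>r x $ j\<bar>" for m
    proof (rule AE_I2)
      fix x assume "x \<in> space M"
      then have "\<bar>g x\<bar> * \<bar>ch m x\<bar> \<le> 1 * 1" using b[of x] chb[of x m] by (intro mult_mono) auto
      then show "norm (r x $ j * (g x * ch m x)) \<le> \<bar>r x $ j\<bar>"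
        using mult_left_mono[of "\<bar>g x\<bar> * \<bar>ch m x\<bar>" 1 "\<bar>r x $ j\<bar>"] by (simp add: abs_mult)
    qed
    \<comment> \<open>The cutoffs tend to 1 only in the open square; its boundary is a null
      set.\<close>
    have neg: "negligible (cbox 0 (\<chi> i. L) - box 0 (\<chi> i. L) :: (real^2) set)"
      by (rule negligible_frontier_interval)
    have ae: "AE x in M. x \<in> box 0 (\<chi> i. L)"
    proof -
      have "AE x in lebesgue. x \<notin> cbox 0 (\<chi> i. L) - (box 0 (\<chi> i. L) :: (real^2) set)"
        by (rule AE_not_in) (use neg in \<open>simp only: negligible_iff_null_sets\<close>)
      then have "AE x in lebesgue. x \<in> cbox 0 (\<chi> i. L) \<longrightarrow> x \<in> (box 0 (\<chi> i. L) :: (real^2) set)"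
        by (rule eventually_mono) simp
      then show ?thesis unfolding Omega_cbox by (subst AE_restrict_space_iff) simp_all
    qed
    show "AE x in M. (\<lambda>m. r x $ j * (g x * ch m x)) \<longlonglongrightarrow> r x $ j * g x"
      using ae
    proof eventually_elim
      fix x :: "real^2" assume x: "x \<in> box 0 (\<chi> i. L)"
      have "(\<lambda>m. min 1 (real m * (x $ i * (L - x $ i)))) \<longlonglongrightarrow> 1" for i
      proof -
        have p: "x $ i * (L - x $ i) > 0" using x by (auto simp: mem_box_cart)
        obtain n0 :: nat where "1 / (x $ i * (L - x $ i)) < n0" using reals_Archimedean2 by blast
        then have "1 < real n0 * (x $ i * (L - x $ i))" using p by (simp add: field_simps)
        then have "1 \<le> real m * (x $ i * (L - x $ i))" if "m \<ge> n0" for m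
          using that p mult_right_mono[of "real n0" "real m" "x $ i * (L - x $ i)"] by linarith
        then have "eventually (\<lambda>m. min 1 (real m * (x $ i * (L - x $ i))) = 1) sequentially"
          unfolding eventually_sequentially by (metis min.absorb1)
        then show ?thesis by (rule tendsto_eventually)
      qed
      then have "(\<lambda>m. ch m x) \<longlonglongrightarrow> (\<Prod>i\<in>(UNIV::2 set). 1)" unfolding ch_def by (intro tendsto_prod)
      then have "(\<lambda>m. r x $ j * (g x * ch m x)) \<longlonglongrightarrow> r x $ j * (g x * (\<Prod>i\<in>(UNIV::2 set). 1))"
        by (intro tendsto_intros)
      then show "(\<lambda>m. r x $ j * (g x * ch m x)) \<longlonglongrightarrow> r x $ j * g x" by simp
    qed
  qed
  then show ?thesis unfolding z by (simp add: LIMSEQ_const_iff)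
qed

text \<open>The test function \<open>h\<close> is bounded and has the sign of the component, so a
  vanishing integral of the product forces the component to vanish almost everywhere. As
  \<open>h\<close> is merely measurable, it is approximated pointwise almost everywhere by
  continuous functions; truncating these to [-1,1] keeps the limit and provides the integrable
  majorant.\<close>

lemma component_AE_zero: "AE x in M. r x $ j = 0"
proof -
  define h where "h x = r x $ j / (1 + \<bar>r x $ j\<bar>)" for x
  have rm: "(\<lambda>x. r x $ j) \<in> borel_measurable M" by (rule borel_measurable_integrable[OF component_integrable])
  have hm: "h \<in> borel_measurable M" unfolding h_def[abs_def] using rm by measurable
  have hb: "\<bar>h x\<bar> \<le> 1" for x unfolding h_def by (simp add: abs_mult divide_simps)
  have SO: "Omega L \<in> sets lebesgue" by (auto simp: Omega_cbox)
  have "h measurable_on (Omega L)" using hm measurable_on_iff_borel_measurable[OF SO] by blast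
  then obtain N g where N: "negligible N" and g: "\<And>n. continuous_on UNIV (g n)"
    and lim: "\<And>x. x \<notin> N \<Longrightarrow> (\<lambda>n. g n x) \<longlonglongrightarrow> (if x \<in> Omega L then h x else 0)"
    unfolding measurable_on_def by blast
  define g' where "g' n x = max (-1) (min 1 (g n x))" for n x
  have g'c: "continuous_on UNIV (g' n)" for n unfolding g'_def by (intro continuous_intros g)
  have g'b: "\<bar>g' n x\<bar> \<le> 1" for n x unfolding g'_def by auto
  have z: "(\<integral>x. r x $ j * g' n x \<partial>M) = 0" for n by (rule orthogonal_continuous[OF g'c g'b])
  have rh: "integrable M (\<lambda>x. r x $ j * h x)" by (rule component_mult_integrable[OF hm hb])
  have "(\<lambda>n. \<integral>x. r x $ j * g' n x \<partial>M) \<longlonglongrightarrow> (\<integral>x. r x $ j * h x \<partial>M)"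
  proof (rule integral_dominated_convergence)
    show "integrable M (\<lambda>x. \<bar>r x $ j\<bar>)" using component_integrable by simp
    show "(\<lambda>x. r x $ j * h x) \<in> borel_measurable M" using rh by (rule borel_measurable_integrable)
    show "(\<lambda>x. r x $ j * g' n x) \<in> borel_measurable M" for n
      by (intro borel_measurable_times continuous_measurable g'c rm)
    show "AE x in M. norm (r x $ j * g' n x) \<le> \<bar>r x $ j\<bar>" for n
      using g'b[of n] by (intro AE_I2) (simp add: abs_mult mult_left_le)
    have "AE x in lebesgue. x \<notin> N" using N by (simp add: negligible_iff_null_sets AE_not_in)
    then have "AE x in M. x \<notin> N" using SO by (subst AE_restrict_space_iff) (auto elim: eventually_mono)
    moreover have "AE x in M. x \<in> Omega L" by (rule AE_I2) simp
    ultimately show "AE x in M. (\<lambda>n. r x $ j * g' n x) \<longlonglongrightarrow> r x $ j * h x"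
    proof eventually_elim
      fix x assume x: "x \<notin> N" "x \<in> Omega L"
      have "(\<lambda>n. g' n x) \<longlonglongrightarrow> max (-1) (min 1 (h x))"
        unfolding g'_def using lim[OF x(1)] x(2) by (intro tendsto_intros) simp
      moreover have "max (-1) (min 1 (h x)) = h x" using hb[of x] by auto
      ultimately show "(\<lambda>n. r x $ j * g' n x) \<longlonglongrightarrow> r x $ j * h x" by (intro tendsto_intros) simp
    qed
  qed
  then have "(\<integral>x. r x $ j * h x \<partial>M) = 0" unfolding z by (simp add: LIMSEQ_const_iff)
  moreover have "AE x in M. 0 \<le> r x $ j * h x" by (intro AE_I2) (simp add: h_def)
  ultimately have "AE x in M. r x $ j * h x = 0"
    using integral_nonneg_eq_0_iff_AE[OF rh] by blast
  then show ?thesis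
    by eventually_elim (auto simp: h_def add_nonneg_eq_0_iff)
qed

lemma L2_norm_zero_if_fc_zero: "L2_norm L r = 0"
proof -
  have "AE x in M. r x = 0"
    using component_AE_zero[of 1] component_AE_zero[of 2] by eventually_elim (simp add: vec_eq_iff forall_2)
  then have "AE x in M. r x \<bullet> r x = 0" by eventually_elim simp
  then have "(\<integral>x. r x \<bullet> r x \<partial>M) = (\<integral>x. 0 \<partial>M)"
    using L2_measurable[OF r] by (intro integral_cong_AE) auto
  then show ?thesis by (simp add: L2_norm_def L2_inner_def)
qed

end

end

section \<open>Sobolev norms\<close>

lemma powr_sq: "((x :: real) powr s)\<^sup>2 = x powr (2 * s)"
  by (simp only: power2_eq_square powr_add[symmetric] mult_2)

context torus begin

text \<open>With the factor \<open>L\<close> included, partial sums of the squared norm are squares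
  of \<open>L2_set\<close>, so that Minkowski and Cauchy-Schwarz for finite sums apply
  directly.\<close>

definition sob_term :: "real \<Rightarrow> field \<Rightarrow> real^2 \<Rightarrow> real" where
  "sob_term s u k = L * (norm k powr s * norm (fourier_coeff L u k))"

lemma sob_term_nonneg: "sob_term s u k \<ge> 0" using L_pos by (simp add: sob_term_def)

text \<open>Reduces every estimate of a Sobolev norm to finite sets of frequencies, on which limits
  and sums may be exchanged freely.\<close>

lemma sob_sq_SUP:
  "sob_sq L s u = (SUP F\<in>{F. finite F \<and> F \<subseteq> freqs L}. ennreal (\<Sum>k\<in>F. (sob_term s u k)\<^sup>2))"
proof -
  let ?g = "\<lambda>k. norm k powr (2 * s) * (norm (fourier_coeff L u k))\<^sup>2"
  have "sob_sq L s u = ennreal (L\<^sup>2) * (SUP F\<in>{F. finite F \<and> F \<subseteq> freqs L}. ennreal (\<Sum>k\<in>F. ?g k))"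
    unfolding sob_sq_def by (subst nonneg_infsum_complete) (simp_all add: sum_ennreal)
  also have "\<dots> = (SUP F\<in>{F. finite F \<and> F \<subseteq> freqs L}. ennreal (L\<^sup>2) * ennreal (\<Sum>k\<in>F. ?g k))"
    by (rule SUP_mult_left_ennreal)
  also have "\<dots> = (SUP F\<in>{F. finite F \<and> F \<subseteq> freqs L}. ennreal (\<Sum>k\<in>F. (sob_term s u k)\<^sup>2))"
    by (intro SUP_cong refl)
       (simp add: ennreal_mult[symmetric] sum_nonneg sum_distrib_left sob_term_def power_mult_distrib
          powr_sq)
  finally show ?thesis .
qed

definition sob_finite :: "real \<Rightarrow> field \<Rightarrow> bool" where "sob_finite s u \<longleftrightarrow> sob_sq L s u < \<infinity>"

lemma sob_norm_nonneg: "sob_norm L s u \<ge> 0" by (simp add: sob_norm_def)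

lemma L2_set_sob_term_le:
  assumes "sob_finite s u" "finite F" "F \<subseteq> freqs L"
  shows "L2_set (sob_term s u) F \<le> sob_norm L s u"
proof -
  have "ennreal (\<Sum>k\<in>F. (sob_term s u k)\<^sup>2) \<le> sob_sq L s u"
    unfolding sob_sq_SUP using assms by (intro SUP_upper) auto
  also have "\<dots> = ennreal (enn2real (sob_sq L s u))" using assms(1) by (simp add: sob_finite_def)
  finally show ?thesis unfolding L2_set_def sob_norm_def by simp
qed

text \<open>Finiteness is delivered with the bound because \<open>sob_norm\<close> alone does not
  show it: its value is 0 where the squared norm is infinite.\<close>

lemma sob_norm_leI:
  assumes "\<And>F. finite F \<Longrightarrow> F \<subseteq> freqs L \<Longrightarrow> L2_set (sob_term s u) F \<le> K" and K: "K \<ge> 0"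
  shows "sob_finite s u" "sob_norm L s u \<le> K"
proof -
  have *: "sob_sq L s u \<le> ennreal (K\<^sup>2)" unfolding sob_sq_SUP
  proof (rule SUP_least)
    fix F assume "F \<in> {F. finite F \<and> F \<subseteq> freqs L}"
    then have "(L2_set (sob_term s u) F)\<^sup>2 \<le> K\<^sup>2" using assms(1)[of F] by (intro power_mono) auto
    then show "ennreal (\<Sum>k\<in>F. (sob_term s u k)\<^sup>2) \<le> ennreal (K\<^sup>2)"
      by (intro ennreal_leI) (simp add: L2_set_def sum_nonneg)
  qed
  then show "sob_finite s u" unfolding sob_finite_def using le_less_trans by fastforce
  have "enn2real (sob_sq L s u) \<le> K\<^sup>2" using * by (simp add: enn2real_leI)
  then show "sob_norm L s u \<le> K" unfolding sob_norm_def using K by (simp add: real_le_lsqrt)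
qed

lemma sob_norm_cong:
  assumes "\<And>k. k \<in> freqs L \<Longrightarrow> norm (fourier_coeff L u k) = norm (fourier_coeff L v k)"
  shows "sob_sq L s u = sob_sq L s v"
  unfolding sob_sq_SUP using assms by (intro SUP_cong refl arg_cong[of _ _ ennreal] sum.cong) (auto simp: sob_term_def)

lemma sob_norm_aeq:
  assumes "aeq L u v" "u \<in> borel_measurable M" "v \<in> borel_measurable M"
  shows "sob_norm L s u = sob_norm L s v" "sob_finite s u \<longleftrightarrow> sob_finite s v"
  using sob_norm_cong[of u v s] fc_aeq[OF assms] by (simp_all add: sob_norm_def sob_finite_def)

text \<open>Only the moduli of the coefficients are compared, so that one statement serves sums,
  differences and the reverse triangle inequality.\<close>

lemma sob_norm_triangle_gen:
  assumes "sob_finite s u" "sob_finite s v"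
    and "\<And>k. k \<in> freqs L \<Longrightarrow> norm (fourier_coeff L w k) \<le> norm (fourier_coeff L u k) + norm (fourier_coeff L v k)"
  shows "sob_finite s w \<and> sob_norm L s w \<le> sob_norm L s u + sob_norm L s v"
proof -
  have "L2_set (sob_term s w) F \<le> sob_norm L s u + sob_norm L s v" if F: "finite F" "F \<subseteq> freqs L" for F
  proof -
    have "L2_set (sob_term s w) F \<le> L2_set (\<lambda>k. sob_term s u k + sob_term s v k) F"
    proof (rule L2_set_mono)
      fix k assume "k \<in> F"
      then have "norm k powr s * norm (fourier_coeff L w k) \<le> norm k powr s * (norm (fourier_coeff L u k) + norm (fourier_coeff L v k))"
        using assms(3) F by (intro mult_left_mono) auto
      then show "sob_term s w k \<le> sob_term s u k + sob_term s v k"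
        using L_pos by (simp add: sob_term_def flip: distrib_left)
    qed (simp add: sob_term_nonneg)
    also have "\<dots> \<le> L2_set (sob_term s u) F + L2_set (sob_term s v) F" by (rule L2_set_triangle_ineq)
    also have "\<dots> \<le> sob_norm L s u + sob_norm L s v" by (intro add_mono L2_set_sob_term_le assms F)
    finally show ?thesis .
  qed
  from sob_norm_leI[OF this] show ?thesis by (simp add: sob_norm_nonneg)
qed

lemma sob_norm_diff:
  assumes "sob_finite s u" "sob_finite s v" "u \<in> L2 L" "v \<in> L2 L"
  shows "sob_finite s (\<lambda>x. u x - v x)" "sob_norm L s (\<lambda>x. u x - v x) \<le> sob_norm L s u + sob_norm L s v"
  using sob_norm_triangle_gen[OF assms(1,2), of "\<lambda>x. u x - v x"] fc_diff[OF assms(3,4)] norm_triangle_ineq4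
  by auto

lemma sob_norm_diff_triangle:
  assumes "sob_finite s u" "sob_finite s v" "sob_finite s w" "u \<in> L2 L" "v \<in> L2 L" "w \<in> L2 L"
  shows "sob_norm L s (\<lambda>x. u x - w x) \<le> sob_norm L s (\<lambda>x. u x - v x) + sob_norm L s (\<lambda>x. v x - w x)"
proof -
  have "norm (fourier_coeff L (\<lambda>x. u x - w x) k) \<le> norm (fourier_coeff L (\<lambda>x. u x - v x) k) + norm (fourier_coeff L (\<lambda>x. v x - w x) k)" for k
    using assms norm_triangle_ineq[of "fourier_coeff L u k - fourier_coeff L v k" "fourier_coeff L v k - fourier_coeff L w k"]
    by (simp add: fc_diff)
  then show ?thesis
    using sob_norm_triangle_gen[OF sob_norm_diff(1) sob_norm_diff(1)] assms by blast
qed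

lemma sob_norm_diff_commute:
  assumes "u \<in> L2 L" "v \<in> L2 L"
  shows "sob_norm L s (\<lambda>x. u x - v x) = sob_norm L s (\<lambda>x. v x - u x)"
  unfolding sob_norm_def using assms
  by (subst sob_norm_cong[of _ "\<lambda>x. v x - u x"]) (auto simp: fc_diff norm_minus_commute)

lemma sob_norm_reverse:
  assumes "sob_finite s u" "sob_finite s v" "u \<in> L2 L" "v \<in> L2 L"
  shows "\<bar>sob_norm L s u - sob_norm L s v\<bar> \<le> sob_norm L s (\<lambda>x. u x - v x)"
proof -
  let ?d = "\<lambda>x. u x - v x"
  have d: "sob_finite s ?d" by (rule sob_norm_diff(1)[OF assms])
  have f: "fourier_coeff L ?d k = fourier_coeff L u k - fourier_coeff L v k" for k using assms by (simp add: fc_diff)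
  have "sob_norm L s u \<le> sob_norm L s ?d + sob_norm L s v"
    using sob_norm_triangle_gen[OF d assms(2), of u] f norm_triangle_sub by (metis add.commute)
  moreover have "sob_norm L s v \<le> sob_norm L s u + sob_norm L s ?d"
    using sob_norm_triangle_gen[OF assms(1) d, of v] f norm_triangle_sub by (metis norm_minus_commute)
  ultimately show ?thesis by linarith
qed

lemma freqs_lat: "freqs L \<subseteq> lat" by (auto simp: lat_def)

lemma trig_poly_sob_finite: assumes "u \<in> trig_poly L" shows "sob_finite s u"
proof -
  obtain G where G: "exp_form G (fourier_coeff L u) u" using trig_poly_exp_form[OF assms] by blast
  have fG: "finite G" using G by (simp add: exp_form_def)
  have z: "fourier_coeff L u k = 0" if "k \<in> lat" "k \<notin> G" for k
    using exp_form_fc[OF G that(1)] that(2) by (simp only: if_False)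
  show ?thesis
  proof (rule sob_norm_leI(1))
    fix F assume F: "finite F" "F \<subseteq> freqs L"
    have "L2_set (sob_term s u) F = L2_set (sob_term s u) (F \<inter> G)"
      unfolding L2_set_def using F z freqs_lat
      by (intro arg_cong[of _ _ sqrt] sum.mono_neutral_right) (auto simp: sob_term_def)
    also have "\<dots> \<le> L2_set (sob_term s u) G"
      unfolding L2_set_def using fG by (intro real_sqrt_le_mono sum_mono2) auto
    finally show "L2_set (sob_term s u) F \<le> L2_set (sob_term s u) G" .
  qed simp
qed

lemma lambda_min_sob_term: assumes "k \<in> freqs L" shows "2 * pi / L * sob_term 0 u k \<le> sob_term 1 u k"
proof -
  have "2 * pi / L * norm (fourier_coeff L u k) \<le> norm k * norm (fourier_coeff L u k)"
    by (intro mult_right_mono freqs_norm_ge assms) simp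
  then have "L * (2 * pi / L * norm (fourier_coeff L u k)) \<le> L * (norm k * norm (fourier_coeff L u k))"
    using L_pos by (intro mult_left_mono) auto
  then show ?thesis using freqs_norm_pos[OF assms] by (simp add: sob_term_def mult_ac)
qed

text \<open>The Poincare inequality, with the inverse square root of \<lambda>1 as constant, applied
  frequency by frequency.\<close>

lemma sob_finite_0: assumes "sob_finite 1 u" shows "sob_finite 0 u" "sob_norm L 0 u \<le> L / (2 * pi) * sob_norm L 1 u"
proof -
  have "L2_set (sob_term 0 u) F \<le> L / (2 * pi) * sob_norm L 1 u" if F: "finite F" "F \<subseteq> freqs L" for F
  proof -
    have "L2_set (sob_term 0 u) F \<le> L2_set (\<lambda>k. L / (2 * pi) * sob_term 1 u k) F"
    proof (intro L2_set_mono)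
      fix k assume "k \<in> F"
      then show "sob_term 0 u k \<le> L / (2 * pi) * sob_term 1 u k"
        using lambda_min_sob_term[of k u] F L_pos by (auto simp: field_simps)
    qed (simp add: sob_term_nonneg)
    also have "\<dots> = L / (2 * pi) * L2_set (sob_term 1 u) F" using L_pos by (intro L2_set_right_distrib[symmetric]) simp
    also have "\<dots> \<le> L / (2 * pi) * sob_norm L 1 u" using L_pos by (intro mult_left_mono L2_set_sob_term_le F assms) auto
    finally show ?thesis .
  qed
  from sob_norm_leI[OF this] show "sob_finite 0 u" "sob_norm L 0 u \<le> L / (2 * pi) * sob_norm L 1 u"
    using L_pos by (simp_all add: sob_norm_nonneg)
qed

text \<open>\<open>H1_norm\<close> is computed from arbitrarily chosen weak derivatives; that it is subadditive rests on
  their uniqueness, hence on the completeness of the Fourier system.\<close>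

lemma weak_pd_unique:
  assumes u: "u \<in> L2 L" and g: "weak_pd L i u g" "weak_pd L i u g'"
  shows "L2_norm L g = L2_norm L g'"
proof -
  have gL: "g \<in> L2 L" "g' \<in> L2 L" using g by (auto simp: weak_pd_def)
  have "L2_norm L (\<lambda>x. g x - g' x) = 0"
    by (rule L2_norm_zero_if_fc_zero[OF L2_diff[OF gL]])
       (simp add: fc_diff[OF gL] weak_pd_fc[OF u g(1)] weak_pd_fc[OF u g(2)])
  moreover have "L2_norm L p \<le> L2_norm L q + L2_norm L (\<lambda>x. p x - q x)" if "p \<in> L2 L" "q \<in> L2 L" for p q
    using L2_triangle[OF that(2) L2_diff[OF that]] by simp
  ultimately show ?thesis
    using gL L2_norm_diff_commute[of g g'] by (metis add.right_neutral antisym)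
qed

lemma weak_pd_diff:
  assumes "weak_pd L i u g" "weak_pd L i v g'" "u \<in> L2 L" "v \<in> L2 L"
  shows "weak_pd L i (\<lambda>x. u x - v x) (\<lambda>x. g x - g' x)"
proof -
  have "pd i \<phi> \<in> L2 L" if "\<phi> \<in> trig_poly L" for \<phi>
    using weak_pd_trig_poly[OF that] by (simp add: weak_pd_def)
  then show ?thesis using assms
    by (auto simp: weak_pd_def L2_diff L2_inner_diff_left trig_poly_L2)
qed

section \<open>The norm of \<open>H1\<close> and the space \<open>V\<close>\<close>

lemma H1_norm_eq:
  assumes "u \<in> L2 L" "\<And>i. weak_pd L i u (g i)"
  shows "H1_norm L u = sqrt ((L2_norm L u)\<^sup>2 + (\<Sum>i\<in>UNIV. (L2_norm L (g i))\<^sup>2))"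
proof -
  have "L2_norm L (SOME g. weak_pd L i u g) = L2_norm L (g i)" for i
    using weak_pd_unique[OF assms(1) someI[of "weak_pd L i u", OF assms(2)] assms(2)] .
  then show ?thesis by (simp add: H1_norm_def)
qed

lemma H1_L2: "u \<in> H1 L \<Longrightarrow> u \<in> L2 L" by (simp add: H1_def)

lemma H1_weak: assumes "u \<in> H1 L" obtains g where "\<And>i. weak_pd L i u (g i)"
  using assms unfolding H1_def by (auto simp: choice_iff)

lemma H1_norm_nonneg: "H1_norm L u \<ge> 0"
  by (simp add: H1_norm_def sum_nonneg)

lemma H1_norm_components:
  assumes "u \<in> L2 L" "\<And>i. weak_pd L i u (g i)"
  shows "L2_norm L u \<le> H1_norm L u" "L2_norm L (g i) \<le> H1_norm L u"
    "H1_norm L u \<le> L2_norm L u + (\<Sum>i\<in>UNIV. L2_norm L (g i))"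
proof -
  have n: "L2_norm L (g i) \<ge> 0" for i by (rule L2_norm_nonneg)
  show "L2_norm L u \<le> H1_norm L u"
    unfolding H1_norm_eq[OF assms] by (intro real_le_rsqrt) (simp add: sum_nonneg)
  have "(L2_norm L (g i))\<^sup>2 \<le> (\<Sum>i\<in>UNIV. (L2_norm L (g i))\<^sup>2)"
    by (rule member_le_sum) auto
  also have "\<dots> \<le> (L2_norm L u)\<^sup>2 + (\<Sum>i\<in>UNIV. (L2_norm L (g i))\<^sup>2)" by simp
  finally show "L2_norm L (g i) \<le> H1_norm L u"
    unfolding H1_norm_eq[OF assms] by (rule real_le_rsqrt)
  show "H1_norm L u \<le> L2_norm L u + (\<Sum>i\<in>UNIV. L2_norm L (g i))"
    unfolding H1_norm_eq[OF assms]
    by (intro real_le_lsqrt add_nonneg_nonneg sum_nonneg L2_norm_nonneg)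
       (simp add: sum_2 power2_eq_square algebra_simps L2_norm_nonneg add_nonneg_nonneg)
qed

text \<open>The factor 3 counts the field and its two derivatives. It is crude, but the closure
  arguments only need some constant.\<close>

lemma H1_diff:
  assumes "u \<in> H1 L" "v \<in> H1 L"
  shows "(\<lambda>x. u x - v x) \<in> H1 L" "H1_norm L (\<lambda>x. u x - v x) \<le> 3 * (H1_norm L u + H1_norm L v)"
proof -
  obtain g where g: "\<And>i. weak_pd L i u (g i)" using H1_weak[OF assms(1)] by blast
  obtain g' where g': "\<And>i. weak_pd L i v (g' i)" using H1_weak[OF assms(2)] by blast
  note L = H1_L2[OF assms(1)] H1_L2[OF assms(2)]
  have w: "weak_pd L i (\<lambda>x. u x - v x) (\<lambda>x. g i x - g' i x)" for i
    by (rule weak_pd_diff[OF g g' L])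
  then show "(\<lambda>x. u x - v x) \<in> H1 L" using L2_diff[OF L] unfolding H1_def by blast
  have tri: "L2_norm L (\<lambda>x. p x - q x) \<le> L2_norm L p + L2_norm L q" if "p \<in> L2 L" "q \<in> L2 L" for p q
    using L2_triangle[OF that(1) L2_uminus[OF that(2)]] L2_norm_scale[of "-1" q] by simp
  have gL: "g i \<in> L2 L" "g' i \<in> L2 L" for i using g g' by (auto simp: weak_pd_def)
  have "H1_norm L (\<lambda>x. u x - v x) \<le> L2_norm L (\<lambda>x. u x - v x) + (\<Sum>i\<in>UNIV. L2_norm L (\<lambda>x. g i x - g' i x))"
    by (rule H1_norm_components(3)[OF L2_diff[OF L] w])
  also have "\<dots> \<le> (H1_norm L u + H1_norm L v) + (\<Sum>i\<in>(UNIV::2 set). H1_norm L u + H1_norm L v)"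
  proof (intro add_mono sum_mono)
    show "L2_norm L (\<lambda>x. u x - v x) \<le> H1_norm L u + H1_norm L v"
      using tri[OF L] H1_norm_components(1)[OF L(1), of g, OF g] H1_norm_components(1)[OF L(2), of g', OF g']
      by linarith
    show "L2_norm L (\<lambda>x. g i x - g' i x) \<le> H1_norm L u + H1_norm L v" for i
      using tri[OF gL, of i i] H1_norm_components(2)[OF L(1), of g i, OF g] H1_norm_components(2)[OF L(2), of g' i, OF g']
      by linarith
  qed
  finally show "H1_norm L (\<lambda>x. u x - v x) \<le> 3 * (H1_norm L u + H1_norm L v)" by (simp add: sum_2)
qed

lemma trig_poly_H1: "u \<in> trig_poly L \<Longrightarrow> u \<in> H1 L"
  using weak_pd_trig_poly trig_poly_L2 unfolding H1_def by blast

text \<open>Multiplication by \<open>k $ i\<close> is the weak derivative on the Fourier side, so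
  the claim is Bessel's inequality for the two weak derivatives.\<close>

lemma H1_sob:
  assumes "u \<in> H1 L" shows "sob_finite 1 u" "sob_norm L 1 u \<le> H1_norm L u"
proof -
  obtain g where g: "\<And>i. weak_pd L i u (g i)" using H1_weak[OF assms] by blast
  note L = H1_L2[OF assms]
  have gL: "g i \<in> L2 L" for i using g by (auto simp: weak_pd_def)
  have "L2_set (sob_term 1 u) F \<le> H1_norm L u" if F: "finite F" "F \<subseteq> freqs L" for F
  proof -
    have Fl: "F \<subseteq> lat" using F freqs_lat by auto
    have "(sob_term 1 u k)\<^sup>2 = (\<Sum>i\<in>UNIV. L\<^sup>2 * (norm (fourier_coeff L (g i) k))\<^sup>2)" if "k \<in> F" for k
    proof -
      have k: "k \<in> lat" using that Fl by auto
      have "(norm (fourier_coeff L (g i) k))\<^sup>2 = (k $ i)\<^sup>2 * (norm (fourier_coeff L u k))\<^sup>2" for i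
        unfolding weak_pd_fc[OF L g k] norm_sq_complex2
        by (simp add: norm_mult power_mult_distrib sum_distrib_left)
      moreover have "(norm k)\<^sup>2 = (\<Sum>i\<in>UNIV. (k $ i)\<^sup>2)"
        by (simp add: norm_vec_def L2_set_def sum_nonneg)
      ultimately show ?thesis using freqs_norm_pos[of k] that F
        by (auto simp: sob_term_def power_mult_distrib sum_distrib_left sum_distrib_right mult.assoc)
    qed
    then have "(\<Sum>k\<in>F. (sob_term 1 u k)\<^sup>2) = (\<Sum>i\<in>UNIV. L\<^sup>2 * (\<Sum>k\<in>F. (norm (fourier_coeff L (g i) k))\<^sup>2))"
      by (subst sum_distrib_left, subst sum.swap) simp
    also have "\<dots> \<le> (\<Sum>i\<in>UNIV. (L2_norm L (g i))\<^sup>2)"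
      by (intro sum_mono Bessel gL F Fl)
    also have "\<dots> \<le> (L2_norm L u)\<^sup>2 + (\<Sum>i\<in>UNIV. (L2_norm L (g i))\<^sup>2)" by simp
    finally show ?thesis unfolding L2_set_def H1_norm_eq[OF L g] by simp
  qed
  from sob_norm_leI[OF this H1_norm_nonneg] show "sob_finite 1 u" "sob_norm L 1 u \<le> H1_norm L u" by blast+
qed

lemma V_H1: "u \<in> V L \<Longrightarrow> u \<in> H1 L" by (simp add: V_def)
lemma V_L2: "u \<in> V L \<Longrightarrow> u \<in> L2 L" by (simp add: V_def H1_L2)
lemma V_sob_finite: "u \<in> V L \<Longrightarrow> sob_finite 1 u" by (simp add: V_H1 H1_sob)

lemma V_diff: assumes "u \<in> V L" "v \<in> V L" shows "(\<lambda>x. u x - v x) \<in> V L"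
  unfolding V_def
proof (intro CollectI conjI allI impI H1_diff V_H1 assms)
  fix e :: real assume "e > 0"
  then have e: "e / 6 > 0" by simp
  obtain \<phi> where \<phi>: "\<phi> \<in> sol_poly L" "H1_norm L (\<lambda>x. u x - \<phi> x) < e / 6"
    using assms(1) e unfolding V_def by blast
  obtain \<psi> where \<psi>: "\<psi> \<in> sol_poly L" "H1_norm L (\<lambda>x. v x - \<psi> x) < e / 6"
    using assms(2) e unfolding V_def by blast
  have "H1_norm L (\<lambda>x. (u x - \<phi> x) - (v x - \<psi> x)) \<le> 3 * (H1_norm L (\<lambda>x. u x - \<phi> x) + H1_norm L (\<lambda>x. v x - \<psi> x))"
    by (intro H1_diff V_H1 assms trig_poly_H1 sol_poly_trig \<phi> \<psi>)
  also have "\<dots> < e" using \<phi>(2) \<psi>(2) by simp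
  also have "(\<lambda>x. (u x - \<phi> x) - (v x - \<psi> x)) = (\<lambda>x. (u x - v x) - (\<phi> x - \<psi> x))" by (auto simp: algebra_simps)
  finally show "\<exists>p\<in>sol_poly L. H1_norm L (\<lambda>x. u x - v x - p x) < e"
    by (rule bexI[of _ "\<lambda>x. \<phi> x - \<psi> x"]) (intro sol_poly_diff \<phi> \<psi>)
qed

lemma V_H: assumes "u \<in> V L" shows "u \<in> H L"
  unfolding H_def
proof (intro CollectI conjI allI impI V_L2 assms)
  fix e :: real assume "e > 0"
  then obtain \<phi> where \<phi>: "\<phi> \<in> sol_poly L" "H1_norm L (\<lambda>x. u x - \<phi> x) < e"
    using assms unfolding V_def by blast
  have h: "(\<lambda>x. u x - \<phi> x) \<in> H1 L" by (intro H1_diff V_H1 assms trig_poly_H1 sol_poly_trig \<phi>)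
  obtain g where "\<And>i. weak_pd L i (\<lambda>x. u x - \<phi> x) (g i)" using H1_weak[OF h] by blast
  then have "L2_norm L (\<lambda>x. u x - \<phi> x) < e"
    using H1_norm_components(1)[OF H1_L2[OF h]] \<phi>(2) by fastforce
  then show "\<exists>\<phi>\<in>sol_poly L. L2_norm L (\<lambda>x. u x - \<phi> x) < e" using \<phi>(1) by blast
qed

text \<open>Without an approximating sequence every number would satisfy the descriptions in
  \<open>A_pairing\<close> and \<open>B_pairing\<close>; its existence is what makes their values
  unique.\<close>

lemma V_limit_exists: assumes "u \<in> V L" shows "\<exists>\<phi>. V_limit L \<phi> u"
proof -
  have "\<exists>\<phi>. \<phi> \<in> sol_poly L \<and> sob_norm L 1 (\<lambda>x. \<phi> x - u x) \<le> (1/2)^n" for n :: nat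
  proof -
    obtain \<phi> where \<phi>: "\<phi> \<in> sol_poly L" "H1_norm L (\<lambda>x. u x - \<phi> x) < (1/2)^n"
      using assms unfolding V_def by (auto dest!: spec[of _ "(1/2)^n"])
    have h: "(\<lambda>x. u x - \<phi> x) \<in> H1 L" by (intro H1_diff V_H1 assms trig_poly_H1 sol_poly_trig \<phi>)
    have "sob_norm L 1 (\<lambda>x. \<phi> x - u x) = sob_norm L 1 (\<lambda>x. u x - \<phi> x)"
      using sob_norm_diff_commute[OF sol_poly_L2[OF \<phi>(1)] V_L2[OF assms]] .
    then show ?thesis using H1_sob(2)[OF h] \<phi> by (intro exI[of _ \<phi>]) auto
  qed
  then obtain \<phi> where \<phi>: "\<And>n. \<phi> n \<in> sol_poly L" "\<And>n. sob_norm L 1 (\<lambda>x. \<phi> n x - u x) \<le> (1/2)^n"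
    by metis
  have "(\<lambda>n. sob_norm L 1 (\<lambda>x. \<phi> n x - u x)) \<longlonglongrightarrow> 0"
    by (rule tendsto_sandwich[OF _ _ tendsto_const LIMSEQ_realpow_zero[of "1/2"]])
       (auto simp: sob_norm_nonneg \<phi>)
  then show ?thesis using \<phi>(1) unfolding V_limit_def by blast
qed

lemma sol_poly_V: assumes "u \<in> sol_poly L" shows "u \<in> V L"
proof -
  have "weak_pd L i (\<lambda>x. u x - u x) (\<lambda>x. 0)" for i
    using weak_pd_diff[OF weak_pd_trig_poly weak_pd_trig_poly] assms sol_poly_trig sol_poly_L2
    by fastforce
  then have "H1_norm L (\<lambda>x. u x - u x) = 0"
    using H1_norm_eq[of "\<lambda>x. u x - u x" "\<lambda>i x. 0"] sol_poly_L2[OF assms]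
    by (simp add: L2_norm_def L2_inner_def continuous_in_L2)
  then show ?thesis using assms unfolding V_def
    by (auto simp: trig_poly_H1 sol_poly_trig intro!: bexI[of _ u])
qed

end

section \<open>Solenoidal modes and the spectral filter\<close>

context torus begin

lemma sol_poly_fc_div:
  assumes "u \<in> sol_poly L" "k \<in> lat"
  shows "(\<Sum>i\<in>UNIV. of_real (k $ i) * fourier_coeff L u k $ i) = 0"
proof -
  have u: "u \<in> trig_poly L" and d: "\<And>x. divergence u x = 0" using assms(1) by (auto simp: sol_poly_def)
  have gL: "pd i u \<in> L2 L" for i using weak_pd_trig_poly[OF u] by (simp add: weak_pd_def)
  have "(\<Sum>i\<in>UNIV. fourier_coeff L (pd i u) k $ i)
      = (\<integral>x. (\<Sum>i\<in>UNIV. of_real (pd i u x $ i) * cis (- (k \<bullet> x))) \<partial>M) / of_real (L\<^sup>2)"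
    using fc_integrable[OF gL]
    by (simp add: fc_component sum_divide_distrib Bochner_Integration.integral_sum)
  also have "\<dots> = (\<integral>x. of_real (divergence u x) * cis (- (k \<bullet> x)) \<partial>M) / of_real (L\<^sup>2)"
    by (simp add: divergence_def sum_distrib_right)
  also have "\<dots> = 0" by (simp add: d)
  finally have "\<i> * (\<Sum>i\<in>UNIV. of_real (k $ i) * fourier_coeff L u k $ i) = 0"
    by (simp add: fc_pd[OF u assms(2)] sum_distrib_left mult.assoc)
  then show ?thesis by simp
qed

lemma sol_poly_fc_0:
  assumes "u \<in> sol_poly L" shows "fourier_coeff L u 0 = 0"
proof -
  have z: "(\<integral>x. u x \<partial>M) = 0" using assms by (simp add: sol_poly_def)
  have "(\<integral>x. complex_of_real (u x $ j) \<partial>M) = 0" for j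
  proof -
    have "(\<integral>x. u x $ j \<partial>M) = (\<integral>x. u x \<partial>M) $ j"
      by (rule integral_bounded_linear[OF bounded_linear_vec_nth L2_integrable[OF sol_poly_L2[OF assms]]])
    then show ?thesis by (simp add: z)
  qed
  then show ?thesis by (simp add: vec_eq_iff fc_component)
qed

text \<open>In the plane the divergence-free amplitudes at a nonzero \<open>k\<close> form a complex
  line, spanned by this unit vector. A solenoidal field is thus described by one complex number per
  frequency, its \<open>mode_coeff\<close>.\<close>

definition perp :: "real^2 \<Rightarrow> real^2" where
  "perp k = (1 / norm k) *\<^sub>R vector [- (k $ 2), k $ 1]"

lemma norm_sq_2: "(norm (k :: real^2))\<^sup>2 = (k $ 1)\<^sup>2 + (k $ 2)\<^sup>2"
  by (simp add: norm_vec_def L2_set_def sum_2)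

lemma norm_perp: "k \<noteq> 0 \<Longrightarrow> norm (perp k) = 1"
proof -
  assume "k \<noteq> 0"
  have "(norm (vector [- (k $ 2), k $ 1] :: real^2))\<^sup>2 = (norm k)\<^sup>2" by (simp add: norm_sq_2)
  then have "norm (vector [- (k $ 2), k $ 1] :: real^2) = norm k" by simp
  then show ?thesis using \<open>k \<noteq> 0\<close> by (simp add: perp_def)
qed

lemma perp_orthogonal: "(\<Sum>i\<in>UNIV. k $ i * perp k $ i) = 0"
  by (simp add: perp_def sum_2)

definition mode_coeff :: "real^2 \<Rightarrow> field \<Rightarrow> complex" where
  "mode_coeff k u = (\<Sum>j\<in>UNIV. of_real (perp k $ j) * fourier_coeff L u k $ j)"

abbreviation cos_mode where "cos_mode k \<equiv> cosm k (perp k)"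
abbreviation sin_mode where "sin_mode k \<equiv> sinm k (perp k)"

lemma mode_coeff_inner:
  assumes "u \<in> L2 L"
  shows "mode_coeff k u = (of_real (L2_inner L u (cos_mode k)) - \<i> * of_real (L2_inner L u (sin_mode k))) / of_real (L\<^sup>2)"
  unfolding mode_coeff_def by (rule fc_dot[OF assms])

lemma inner_cos_mode: "u \<in> L2 L \<Longrightarrow> L2_inner L u (cos_mode k) = L\<^sup>2 * Re (mode_coeff k u)"
  and inner_sin_mode: "u \<in> L2 L \<Longrightarrow> L2_inner L u (sin_mode k) = - (L\<^sup>2 * Im (mode_coeff k u))"
  using L_pos by (simp_all add: mode_coeff_inner Re_divide_of_real Im_divide_of_real del: of_real_power)

lemma cmod_dot_le: "cmod (\<Sum>i\<in>UNIV. of_real ((a::real^2) $ i) * (z::complex^2) $ i) \<le> norm a * norm z"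
proof -
  have "cmod (\<Sum>i\<in>UNIV. of_real (a $ i) * z $ i) \<le> (\<Sum>i\<in>UNIV. \<bar>a $ i\<bar> * \<bar>cmod (z $ i)\<bar>)"
    by (rule order_trans[OF norm_sum]) (simp add: norm_mult)
  also have "\<dots> \<le> L2_set (\<lambda>i. a $ i) UNIV * L2_set (\<lambda>i. cmod (z $ i)) UNIV"
    by (rule L2_set_mult_ineq)
  also have "\<dots> = norm a * norm z" by (simp add: norm_vec_def L2_set_def)
  finally show ?thesis .
qed

lemma mode_coeff_le: "k \<noteq> 0 \<Longrightarrow> cmod (mode_coeff k u) \<le> norm (fourier_coeff L u k)"
  unfolding mode_coeff_def using cmod_dot_le[of "perp k" "fourier_coeff L u k"] by (simp add: norm_perp)

text \<open>A complex vector orthogonal to \<open>k\<close> is a multiple of \<open>perp k\<close>,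
  so passing to the scalar coefficient loses nothing. In the proof \<open>w\<close> is
  \<open>norm k\<close> times that coefficient, and both components of the vector, multiplied by the
  square of \<open>norm k\<close>, are expressed through it.\<close>

lemma norm_fc_mode_coeff:
  assumes "k \<noteq> 0" "(\<Sum>i\<in>UNIV. of_real (k $ i) * fourier_coeff L u k $ i) = 0"
  shows "norm (fourier_coeff L u k) = cmod (mode_coeff k u)"
proof -
  define z where "z = fourier_coeff L u k"
  have n: "norm k > 0" "(norm k)\<^sup>2 = (k $ 1)\<^sup>2 + (k $ 2)\<^sup>2" using assms(1) by (simp_all add: norm_sq_2)
  have o: "of_real (k $ 1) * z $ 1 + of_real (k $ 2) * z $ 2 = 0"
    using assms(2) by (simp add: z_def sum_2)
  define w where "w = - of_real (k $ 2) * z $ 1 + of_real (k $ 1) * z $ 2"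
  have tw: "of_real (norm k) * mode_coeff k u = w" using n(1)
    by (simp add: mode_coeff_def perp_def sum_2 z_def w_def field_simps)
  have e1: "of_real ((norm k)\<^sup>2) * z $ 1 = - of_real (k $ 2) * w"
  proof -
    have "of_real ((norm k)\<^sup>2) * z $ 1 = of_real (k $ 1) * (of_real (k $ 1) * z $ 1 + of_real (k $ 2) * z $ 2) - of_real (k $ 2) * w"
      unfolding n(2) w_def by (simp add: power2_eq_square algebra_simps)
    then show ?thesis by (simp add: o)
  qed
  have e2: "of_real ((norm k)\<^sup>2) * z $ 2 = of_real (k $ 1) * w"
  proof -
    have "of_real ((norm k)\<^sup>2) * z $ 2 = of_real (k $ 2) * (of_real (k $ 1) * z $ 1 + of_real (k $ 2) * z $ 2) + of_real (k $ 1) * w"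
      unfolding n(2) w_def by (simp add: power2_eq_square algebra_simps)
    then show ?thesis by (simp add: o)
  qed
  have "cmod (of_real ((norm k)\<^sup>2) * z $ 1) = \<bar>k $ 2\<bar> * cmod w" "cmod (of_real ((norm k)\<^sup>2) * z $ 2) = \<bar>k $ 1\<bar> * cmod w"
    unfolding e1 e2 by (simp_all add: norm_mult)
  then have m: "(norm k)\<^sup>2 * cmod (z $ 1) = \<bar>k $ 2\<bar> * cmod w" "(norm k)\<^sup>2 * cmod (z $ 2) = \<bar>k $ 1\<bar> * cmod w"
    by (simp_all add: norm_mult del: of_real_power)
  have "((norm k)\<^sup>2 * norm z)\<^sup>2 = ((norm k)\<^sup>2 * cmod (z $ 1))\<^sup>2 + ((norm k)\<^sup>2 * cmod (z $ 2))\<^sup>2"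
    by (simp only: power_mult_distrib norm_sq_complex2 sum_2 distrib_left)
  also have "\<dots> = (norm k * cmod w)\<^sup>2"
    unfolding m by (simp add: power_mult_distrib n(2) algebra_simps)
  finally have "(norm k)\<^sup>2 * norm z = norm k * cmod w"
    using n(1) by (simp add: power2_eq_iff_nonneg)
  also have "cmod w = norm k * cmod (mode_coeff k u)" unfolding tw[symmetric] by (simp add: norm_mult)
  finally show ?thesis using n(1) by (simp add: z_def power2_eq_square)
qed

text \<open>Makes these fields admissible test fields in \<open>H\<close> and \<open>V\<close>, from
  which the scalar equations of the modes are obtained.\<close>

lemma modes_sol_poly:
  assumes "k \<in> freqs L" shows "cos_mode k \<in> sol_poly L" "sin_mode k \<in> sol_poly L"
proof -
  have k: "k \<in> lat" "k \<noteq> 0" using assms by (auto simp: freqs_iff)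
  have o: "k $ 1 * perp k $ 1 + k $ 2 * perp k $ 2 = 0" using perp_orthogonal[of k] by (simp add: sum_2)
  have d: "divergence (cos_mode k) x = 0" "divergence (sin_mode k) x = 0" for x
  proof -
    have "divergence (cos_mode k) x = - sin (k \<bullet> x) * (k $ 1 * perp k $ 1 + k $ 2 * perp k $ 2)"
      "divergence (sin_mode k) x = cos (k \<bullet> x) * (k $ 1 * perp k $ 1 + k $ 2 * perp k $ 2)"
      unfolding divergence_def pd_cosm pd_sinm by (simp_all add: sinm_def cosm_def sum_2 algebra_simps)
    then show "divergence (cos_mode k) x = 0" "divergence (sin_mode k) x = 0" using o by simp_all
  qed
  have i: "(\<integral>x. cis (k \<bullet> x) \<partial>M) = 0" using integral_cis[OF k(1)] k(2) by simp
  have c: "integrable M (\<lambda>x. cis (k \<bullet> x))" by (rule continuous_integrable[OF continuous_cis_inner])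
  have "(\<integral>x. cos (k \<bullet> x) \<partial>M) = 0" "(\<integral>x. sin (k \<bullet> x) \<partial>M) = 0"
    using integral_Re[OF c] integral_Im[OF c] i by simp_all
  moreover have "integrable M (\<lambda>x. cos (k \<bullet> x))" "integrable M (\<lambda>x. sin (k \<bullet> x))"
    by (intro continuous_integrable continuous_intros)+
  ultimately have "(\<integral>x. cos_mode k x \<partial>M) = 0" "(\<integral>x. sin_mode k x \<partial>M) = 0"
    unfolding cosm_def sinm_def by (simp_all add: integral_scaleR_left)
  then show "cos_mode k \<in> sol_poly L" "sin_mode k \<in> sol_poly L"
    using d trig_poly_modes[OF k(1)] by (auto simp: sol_poly_def)
qed

section \<open>Limits of coefficients along polynomial approximations\<close>

lemma norm_fc_le_sob:
  assumes "sob_finite s u" "k \<in> freqs L"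
  shows "norm k powr s * norm (fourier_coeff L u k) \<le> sob_norm L s u / L"
proof -
  have "sob_term s u k = L2_set (sob_term s u) {k}" by (simp add: L2_set_def sob_term_nonneg)
  also have "\<dots> \<le> sob_norm L s u" using assms by (intro L2_set_sob_term_le) auto
  finally show ?thesis using L_pos by (simp add: sob_term_def field_simps)
qed

lemma V_limit_sob_finite:
  assumes "u \<in> V L" "V_limit L \<phi> u"
  shows "sob_finite 1 (\<phi> n)" "\<phi> n \<in> L2 L" "\<phi> n \<in> sol_poly L"
    "sob_finite 1 (\<lambda>x. \<phi> n x - u x)" "(\<lambda>n. sob_norm L 1 (\<lambda>x. \<phi> n x - u x)) \<longlonglongrightarrow> 0"
proof -
  show p: "\<phi> n \<in> sol_poly L" and "(\<lambda>n. sob_norm L 1 (\<lambda>x. \<phi> n x - u x)) \<longlonglongrightarrow> 0"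
    using assms(2) by (auto simp: V_limit_def)
  show "sob_finite 1 (\<phi> n)" "\<phi> n \<in> L2 L" using trig_poly_sob_finite sol_poly_trig sol_poly_L2 p by blast+
  then show "sob_finite 1 (\<lambda>x. \<phi> n x - u x)" using sob_norm_diff(1) V_sob_finite V_L2 assms(1) by blast
qed

lemma V_limit_fc:
  assumes "u \<in> V L" "V_limit L \<phi> u" "k \<in> freqs L"
  shows "(\<lambda>n. fourier_coeff L (\<phi> n) k) \<longlonglongrightarrow> fourier_coeff L u k"
proof -
  note l = V_limit_sob_finite[OF assms(1,2)]
  have "norm (fourier_coeff L (\<phi> n) k - fourier_coeff L u k) \<le> sob_norm L 1 (\<lambda>x. \<phi> n x - u x) / L / norm k" for n
  proof -
    have "norm k * norm (fourier_coeff L (\<phi> n) k - fourier_coeff L u k) \<le> sob_norm L 1 (\<lambda>x. \<phi> n x - u x) / L"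
      using norm_fc_le_sob[OF l(4) assms(3), of n] freqs_norm_pos[OF assms(3)] fc_diff[OF l(2)[of n] V_L2[OF assms(1)]]
      by simp
    then show ?thesis using freqs_norm_pos[OF assms(3)] by (simp only: pos_le_divide_eq mult.commute)
  qed
  note b = this
  have "(\<lambda>n. sob_norm L 1 (\<lambda>x. \<phi> n x - u x) / L / norm k) \<longlonglongrightarrow> 0 / L / norm k"
    by (intro tendsto_divide l tendsto_const) (use L_pos freqs_norm_pos[OF assms(3)] in auto)
  then have t: "(\<lambda>n. sob_norm L 1 (\<lambda>x. \<phi> n x - u x) / L / norm k) \<longlonglongrightarrow> 0"
    by (simp only: div_0)
  have "(\<lambda>n. fourier_coeff L (\<phi> n) k - fourier_coeff L u k) \<longlonglongrightarrow> 0"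
    by (rule Lim_null_comparison[OF always_eventually t]) (use b in blast)
  then show ?thesis by (rule LIM_zero_cancel)
qed

lemma V_fc_div:
  assumes "u \<in> V L" "k \<in> freqs L"
  shows "(\<Sum>i\<in>UNIV. of_real (k $ i) * fourier_coeff L u k $ i) = 0"
proof -
  obtain \<phi> where \<phi>: "V_limit L \<phi> u" using V_limit_exists[OF assms(1)] by blast
  have "(\<lambda>n. \<Sum>i\<in>UNIV. of_real (k $ i) * fourier_coeff L (\<phi> n) k $ i) \<longlonglongrightarrow> (\<Sum>i\<in>UNIV. of_real (k $ i) * fourier_coeff L u k $ i)"
    by (intro tendsto_intros V_limit_fc[OF assms(1) \<phi> assms(2)])
  moreover have "(\<Sum>i\<in>UNIV. of_real (k $ i) * fourier_coeff L (\<phi> n) k $ i) = 0" for n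
    using sol_poly_fc_div[OF V_limit_sob_finite(3)[OF assms(1) \<phi>]] assms(2) freqs_iff by blast
  ultimately show ?thesis by (simp add: LIMSEQ_const_iff)
qed

lemma V_norm_fc:
  assumes "u \<in> V L" "k \<in> freqs L" shows "norm (fourier_coeff L u k) = cmod (mode_coeff k u)"
  by (rule norm_fc_mode_coeff[OF freqs_nz[OF assms(2)] V_fc_div[OF assms]])

lemma mode_coeff_diff: "u \<in> L2 L \<Longrightarrow> v \<in> L2 L \<Longrightarrow> mode_coeff k (\<lambda>x. u x - v x) = mode_coeff k u - mode_coeff k v"
  by (simp add: mode_coeff_def fc_diff algebra_simps sum_subtractf)

lemma mode_coeff_add: "u \<in> L2 L \<Longrightarrow> v \<in> L2 L \<Longrightarrow> mode_coeff k (\<lambda>x. u x + v x) = mode_coeff k u + mode_coeff k v"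
  by (simp add: mode_coeff_def fc_add algebra_simps sum.distrib)

lemma V_limit_mode_coeff:
  assumes "u \<in> V L" "V_limit L \<phi> u" "k \<in> freqs L"
  shows "(\<lambda>n. mode_coeff k (\<phi> n)) \<longlonglongrightarrow> mode_coeff k u"
  unfolding mode_coeff_def by (intro tendsto_intros V_limit_fc[OF assms])

section \<open>Laplacian, Leray projection and the pairing \<open>A\<close> on single modes\<close>

lemma trig_poly_pd: assumes "u \<in> trig_poly L" shows "pd i u \<in> trig_poly L"
proof -
  obtain F a b where F: "finite F" "F \<subseteq> lat"
    and u: "u = (\<lambda>x. \<Sum>k\<in>F. cos (k \<bullet> x) *\<^sub>R a k + sin (k \<bullet> x) *\<^sub>R b k)"
    using assms unfolding trig_poly_def lat_def by blast
  have "pd i u = (\<lambda>x. \<Sum>k\<in>F. cos (k \<bullet> x) *\<^sub>R (k $ i *\<^sub>R b k) + sin (k \<bullet> x) *\<^sub>R (- (k $ i) *\<^sub>R a k))"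
  proof
    fix x
    have "((\<lambda>s. u (x + s *\<^sub>R axis i 1)) has_vector_derivative
       (\<Sum>k\<in>F. cos (k \<bullet> x) *\<^sub>R (k $ i *\<^sub>R b k) + sin (k \<bullet> x) *\<^sub>R (- (k $ i) *\<^sub>R a k))) (at 0)"
      unfolding u
    proof (rule has_vector_derivative_sum)
      fix k :: "real^2"
      show "((\<lambda>s. cos (k \<bullet> (x + s *\<^sub>R axis i 1)) *\<^sub>R a k + sin (k \<bullet> (x + s *\<^sub>R axis i 1)) *\<^sub>R b k)
          has_vector_derivative (cos (k \<bullet> x) *\<^sub>R (k $ i *\<^sub>R b k) + sin (k \<bullet> x) *\<^sub>R (- (k $ i) *\<^sub>R a k))) (at 0)"
        unfolding has_vector_derivative_def
        by (auto intro!: derivative_eq_intros simp: inner_axis algebra_simps)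
    qed
    then show "pd i u x = (\<Sum>k\<in>F. cos (k \<bullet> x) *\<^sub>R (k $ i *\<^sub>R b k) + sin (k \<bullet> x) *\<^sub>R (- (k $ i) *\<^sub>R a k))"
      unfolding pd_def by (rule vector_derivative_at)
  qed
  with F show ?thesis unfolding trig_poly_def lat_def[symmetric]
    by (intro CollectI exI[of _ F] exI[of _ "\<lambda>k. k $ i *\<^sub>R b k"] exI[of _ "\<lambda>k. - (k $ i) *\<^sub>R a k"] conjI)
qed

lemma laplacian_fc:
  assumes "u \<in> trig_poly L" "k \<in> lat"
  shows "laplacian u \<in> trig_poly L" "mode_coeff k (laplacian u) = - of_real ((norm k)\<^sup>2) * mode_coeff k u"
proof -
  have l: "laplacian u = (\<lambda>x. pd 1 (pd 1 u) x + pd 2 (pd 2 u) x)"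
    by (simp add: laplacian_def fun_eq_iff sum_2)
  have p: "pd i (pd i u) \<in> trig_poly L" for i by (intro trig_poly_pd assms)
  show "laplacian u \<in> trig_poly L" unfolding l by (intro trig_poly_add p)
  have "mode_coeff k (pd i (pd i u)) = - of_real ((k $ i)\<^sup>2) * mode_coeff k u" for i
    unfolding mode_coeff_def fc_pd[OF trig_poly_pd[OF assms(1)] assms(2)] fc_pd[OF assms]
    by (simp add: sum_distrib_left algebra_simps power2_eq_square)
  then show "mode_coeff k (laplacian u) = - of_real ((norm k)\<^sup>2) * mode_coeff k u"
    unfolding l mode_coeff_add[OF trig_poly_L2[OF p] trig_poly_L2[OF p]] norm_sq_2 by (simp add: algebra_simps)
qed

text \<open>What the projection removes is orthogonal to \<open>H\<close>, hence to both solenoidal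
  modes at \<open>k\<close>.\<close>

lemma leray_mode_coeff:
  assumes "g \<in> L2 L" "k \<in> freqs L"
  shows "mode_coeff k (leray L g) = mode_coeff k g"
  unfolding mode_coeff_inner[OF assms(1)] mode_coeff_inner[OF H_L2[OF leray_H[OF assms(1)]]]
  by (simp add: leray_inner[OF assms(1)] sol_poly_H modes_sol_poly assms(2))

text \<open>On polynomials the operator is diagonal with eigenvalue the square of
  \<open>norm k\<close>, and coefficients converge along every approximation. So all approximating
  sequences give the stated limit, which identifies the described value.\<close>

lemma A_pairing_modes:
  assumes u: "u \<in> V L" and k: "k \<in> freqs L"
  shows "A_pairing L u (cos_mode k) = (norm k)\<^sup>2 * L2_inner L u (cos_mode k)"
    "A_pairing L u (sin_mode k) = (norm k)\<^sup>2 * L2_inner L u (sin_mode k)"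
proof -
  have kl: "k \<in> lat" using k freqs_lat by blast
  note uL = V_L2[OF u]
  have lim: "(\<lambda>n. L2_inner L (\<lambda>x. - leray L (laplacian (\<phi> n)) x) (cos_mode k)) \<longlonglongrightarrow> (norm k)\<^sup>2 * L2_inner L u (cos_mode k)"
       "(\<lambda>n. L2_inner L (\<lambda>x. - leray L (laplacian (\<phi> n)) x) (sin_mode k)) \<longlonglongrightarrow> (norm k)\<^sup>2 * L2_inner L u (sin_mode k)"
    if \<phi>: "V_limit L \<phi> u" for \<phi>
  proof -
    note l = V_limit_sob_finite[OF u \<phi>]
    have lp: "laplacian (\<phi> n) \<in> L2 L" for n
      by (intro trig_poly_L2 laplacian_fc(1)[OF _ kl] sol_poly_trig l)
    have ll: "leray L (laplacian (\<phi> n)) \<in> L2 L" for n by (intro H_L2 leray_H lp)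
    have t: "mode_coeff k (leray L (laplacian (\<phi> n))) = - of_real ((norm k)\<^sup>2) * mode_coeff k (\<phi> n)" for n
      unfolding leray_mode_coeff[OF lp k] by (intro laplacian_fc(2)[OF _ kl] sol_poly_trig l)
    have T: "(\<lambda>n. mode_coeff k (\<phi> n)) \<longlonglongrightarrow> mode_coeff k u" by (rule V_limit_mode_coeff[OF u \<phi> k])
    have "(\<lambda>n. (norm k)\<^sup>2 * (L\<^sup>2 * Re (mode_coeff k (\<phi> n)))) \<longlonglongrightarrow> (norm k)\<^sup>2 * (L\<^sup>2 * Re (mode_coeff k u))"
      "(\<lambda>n. (norm k)\<^sup>2 * - (L\<^sup>2 * Im (mode_coeff k (\<phi> n)))) \<longlonglongrightarrow> (norm k)\<^sup>2 * - (L\<^sup>2 * Im (mode_coeff k u))"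
      by (intro tendsto_intros T)+
    moreover have "L2_inner L (\<lambda>x. - leray L (laplacian (\<phi> n)) x) (cos_mode k) = (norm k)\<^sup>2 * (L\<^sup>2 * Re (mode_coeff k (\<phi> n)))"
       "L2_inner L (\<lambda>x. - leray L (laplacian (\<phi> n)) x) (sin_mode k) = (norm k)\<^sup>2 * - (L\<^sup>2 * Im (mode_coeff k (\<phi> n)))" for n
      unfolding L2_inner_uminus_left inner_cos_mode[OF ll] inner_sin_mode[OF ll] t by (simp_all del: of_real_power)
    ultimately show "(\<lambda>n. L2_inner L (\<lambda>x. - leray L (laplacian (\<phi> n)) x) (cos_mode k)) \<longlonglongrightarrow> (norm k)\<^sup>2 * L2_inner L u (cos_mode k)"
       "(\<lambda>n. L2_inner L (\<lambda>x. - leray L (laplacian (\<phi> n)) x) (sin_mode k)) \<longlonglongrightarrow> (norm k)\<^sup>2 * L2_inner L u (sin_mode k)"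
      unfolding inner_cos_mode[OF uL] inner_sin_mode[OF uL] by simp_all
  qed
  obtain \<phi> where \<phi>: "V_limit L \<phi> u" using V_limit_exists[OF u] by blast
  show "A_pairing L u (cos_mode k) = (norm k)\<^sup>2 * L2_inner L u (cos_mode k)"
    unfolding A_pairing_def using lim(1) \<phi> LIMSEQ_unique by (intro the_equality) blast+
  show "A_pairing L u (sin_mode k) = (norm k)\<^sup>2 * L2_inner L u (sin_mode k)"
    unfolding A_pairing_def using lim(2) \<phi> LIMSEQ_unique by (intro the_equality) blast+
qed

section \<open>The spectral filter\<close>

lemma finite_low_freqs: "finite {k \<in> freqs L. (norm k)\<^sup>2 \<le> lam}"
proof -
  define B where "B = sqrt \<bar>lam\<bar> * L / (2 * pi)"
  define I where "I = {n :: int. \<bar>real_of_int n\<bar> \<le> B}"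
  have "I \<subseteq> {- \<lceil>B\<rceil>..\<lceil>B\<rceil>}"
  proof
    fix n assume "n \<in> I"
    then have "real_of_int n \<le> B" "- real_of_int n \<le> B" unfolding I_def by (auto simp: abs_le_iff)
    then have "real_of_int n \<le> \<lceil>B\<rceil>" "real_of_int (- n) \<le> \<lceil>B\<rceil>"
      using le_of_int_ceiling[of B] by linarith+
    then show "n \<in> {- \<lceil>B\<rceil>..\<lceil>B\<rceil>}" by (auto simp only: of_int_le_iff atLeastAtMost_iff minus_le_iff)
  qed
  then have fI: "finite I" by (rule finite_subset) simp
  have "{k \<in> freqs L. (norm k)\<^sup>2 \<le> lam} \<subseteq> (\<lambda>(a, b). (2 * pi / L) *\<^sub>R vector [of_int a, of_int b]) ` (I \<times> I)"
  proof
    fix k assume "k \<in> {k \<in> freqs L. (norm k)\<^sup>2 \<le> lam}"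
    then have "k \<in> lat" and n: "(norm k)\<^sup>2 \<le> lam" using freqs_lat by auto
    then obtain a b :: int where k: "k = (2 * pi / L) *\<^sub>R vector [of_int a, of_int b]"
      unfolding lat_iff by blast
    have "norm k \<le> sqrt \<bar>lam\<bar>" using n by (intro real_le_rsqrt) auto
    then have "\<bar>k $ i\<bar> \<le> sqrt \<bar>lam\<bar>" for i using component_le_norm_cart[of k i] by linarith
    from this[of 1] this[of 2] have "a \<in> I" "b \<in> I"
      using L_pos by (auto simp: k I_def B_def abs_mult field_simps)
    then show "k \<in> (\<lambda>(a, b). (2 * pi / L) *\<^sub>R vector [of_int a, of_int b]) ` (I \<times> I)"
      using k by force
  qed
  then show ?thesis by (rule finite_subset) (simp add: fI)
qed

lemma fc_uminus: "fourier_coeff L u (- k) $ j = cnj (fourier_coeff L u k $ j)"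
proof -
  have "(\<integral>x. of_real (u x $ j) * cis (- (- k \<bullet> x)) \<partial>M) = (\<integral>x. cnj (of_real (u x $ j) * cis (- (k \<bullet> x))) \<partial>M)"
    by (simp add: cis_cnj)
  also have "\<dots> = cnj (\<integral>x. of_real (u x $ j) * cis (- (k \<bullet> x)) \<partial>M)" by (rule Bochner_Integration.integral_cnj)
  finally show ?thesis by (simp add: fc_component)
qed

text \<open>The set of low frequencies is symmetric under negation, so the defining sum equals its
  own conjugate and taking its real part discards nothing.\<close>

lemma spectral_proj_exp_form:
  "exp_form {k \<in> freqs L. (norm k)\<^sup>2 \<le> lam} (fourier_coeff L u) (spectral_proj L lam u)"
  unfolding exp_form_def
proof (intro conjI allI finite_low_freqs)
  let ?G = "{k \<in> freqs L. (norm k)\<^sup>2 \<le> lam}"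
  show "?G \<subseteq> lat" using freqs_lat by auto
  fix x j
  let ?S = "\<Sum>k\<in>?G. fourier_coeff L u k $ j * cis (k \<bullet> x)"
  have "cnj ?S = (\<Sum>k\<in>?G. fourier_coeff L u (- k) $ j * cis (- k \<bullet> x))"
    by (simp add: fc_uminus cis_cnj)
  also have "\<dots> = ?S"
    by (rule sum.reindex_bij_witness[of _ uminus uminus]) (auto simp: freqs_uminus)
  finally have "Im (cnj ?S) = Im ?S" by (rule arg_cong)
  then have "Im ?S = 0" by (simp only: cnj.sel)
  then show "complex_of_real (spectral_proj L lam u x $ j) = ?S"
    by (simp add: spectral_proj_def complex_eq_iff)
qed

lemma spectral_proj_L2: "spectral_proj L lam u \<in> L2 L"
  using exp_form_L2[OF spectral_proj_exp_form] .

lemma spectral_proj_fc: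
  assumes "k \<in> freqs L"
  shows "fourier_coeff L (spectral_proj L lam u) k = (if (norm k)\<^sup>2 \<le> lam then fourier_coeff L u k else 0)"
  using exp_form_fc[OF spectral_proj_exp_form, of k lam u] assms freqs_lat by auto

text \<open>Above the cutoff the filtered field is \<open>w\<close> itself; below it is \<open>w - d\<close>, bounded by Bessel and
  Pythagoras, as \<open>d\<close> is the projection of \<open>g\<close> and \<open>w\<close> lies in \<open>H\<close>.\<close>

lemma filter_estimate:
  assumes w: "w \<in> V L" and d: "d \<in> H L" and g: "g \<in> L2 L"
    and orth: "\<And>v. v \<in> H L \<Longrightarrow> L2_inner L (\<lambda>x. g x - d x) v = 0"
    and K: "(L2_norm L (\<lambda>x. w x - g x))\<^sup>2 \<le> K" and lam: "lam > 0"
    and w': "\<And>k. k \<in> freqs L \<Longrightarrow> norm (fourier_coeff L w' k)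
       = norm (fourier_coeff L w k - (if (norm k)\<^sup>2 \<le> lam then fourier_coeff L d k else 0))"
  shows "sob_finite 1 w'" "(sob_norm L 1 w')\<^sup>2 \<le> (sob_norm L 1 w)\<^sup>2 + lam * K"
    "(sob_norm L 0 w')\<^sup>2 \<le> (sob_norm L 1 w)\<^sup>2 / lam + K"
proof -
  define e where "e = (\<lambda>x. w x - d x)"
  have wL: "w \<in> L2 L" and dL: "d \<in> L2 L" using w d V_L2 H_L2 by auto
  have eH: "e \<in> H L" unfolding e_def by (intro H_diff V_H w d)
  have "(\<lambda>x. w x - g x) = (\<lambda>x. e x + (d x - g x))" by (auto simp: e_def)
  then have "(L2_norm L (\<lambda>x. w x - g x))\<^sup>2 = (L2_norm L e)\<^sup>2 + 2 * L2_inner L e (\<lambda>x. d x - g x) + (L2_norm L (\<lambda>x. d x - g x))\<^sup>2"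
    by (simp add: L2_norm_sq_add H_L2[OF eH] L2_diff dL g)
  moreover have "L2_inner L e (\<lambda>x. d x - g x) = 0"
    using orth[OF eH] dL g H_L2[OF eH] by (simp add: L2_inner_commute[of e] L2_inner_diff_left)
  ultimately have eK: "(L2_norm L e)\<^sup>2 \<le> K" using K zero_le_power2[of "L2_norm L (\<lambda>x. d x - g x)"] by linarith
  have K0: "K \<ge> 0" using eK zero_le_power2 order_trans by blast
  let ?low = "\<lambda>F. {k \<in> F. (norm k)\<^sup>2 \<le> lam}"
  have fe: "fourier_coeff L e k = fourier_coeff L w k - fourier_coeff L d k" for k
    unfolding e_def by (rule fc_diff[OF wL dL])
  have split: "(\<Sum>k\<in>F. f k) = (\<Sum>k\<in>?low F. f k) + (\<Sum>k\<in>F - ?low F. f k)" if "finite F" for f :: "real^2 \<Rightarrow> real" and F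
    using that by (subst add.commute, intro sum.subset_diff) auto
  have low: "(\<Sum>k\<in>?low F. (sob_term 0 w' k)\<^sup>2) \<le> K" if F: "finite F" "F \<subseteq> freqs L" for F
  proof -
    have "(\<Sum>k\<in>?low F. (sob_term 0 w' k)\<^sup>2) = L\<^sup>2 * (\<Sum>k\<in>?low F. (norm (fourier_coeff L e k))\<^sup>2)"
      unfolding sum_distrib_left using F w' freqs_nz by (intro sum.cong) (auto simp: sob_term_def fe power_mult_distrib)
    also have "\<dots> \<le> (L2_norm L e)\<^sup>2" using F freqs_lat by (intro Bessel H_L2 eH) auto
    finally show ?thesis using eK by simp
  qed
  have high: "(\<Sum>k\<in>F - ?low F. (sob_term 1 w' k)\<^sup>2) \<le> (sob_norm L 1 w)\<^sup>2" if F: "finite F" "F \<subseteq> freqs L" for F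
  proof -
    have "(\<Sum>k\<in>F - ?low F. (sob_term 1 w' k)\<^sup>2) = (\<Sum>k\<in>F - ?low F. (sob_term 1 w k)\<^sup>2)"
      using F w' by (intro sum.cong) (auto simp: sob_term_def)
    also have "\<dots> = (L2_set (sob_term 1 w) (F - ?low F))\<^sup>2" by (simp add: L2_set_def sum_nonneg)
    also have "\<dots> \<le> (sob_norm L 1 w)\<^sup>2" using F by (intro power_mono L2_set_sob_term_le V_sob_finite w) auto
    finally show ?thesis .
  qed
  have s1: "(sob_term 1 u k)\<^sup>2 = (norm k)\<^sup>2 * (sob_term 0 u k)\<^sup>2" if "k \<in> freqs L" for u k
    using freqs_norm_pos[OF that] by (simp add: sob_term_def power_mult_distrib)
  \<comment> \<open>Below the cutoff a derivative costs at most a factor \<open>lam\<close> in the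
    squared norm; above it, as used for \<open>n0\<close>, dropping a derivative gains the factor
    \<open>1 / lam\<close>.\<close>
  have n1: "L2_set (sob_term 1 w') F \<le> sqrt ((sob_norm L 1 w)\<^sup>2 + lam * K)" if F: "finite F" "F \<subseteq> freqs L" for F
  proof -
    have "(\<Sum>k\<in>?low F. (sob_term 1 w' k)\<^sup>2) \<le> (\<Sum>k\<in>?low F. lam * (sob_term 0 w' k)\<^sup>2)"
    proof (intro sum_mono)
      fix k assume k: "k \<in> ?low F"
      then have "k \<in> freqs L" using F by auto
      from s1[OF this, of w'] k show "(sob_term 1 w' k)\<^sup>2 \<le> lam * (sob_term 0 w' k)\<^sup>2" by (auto intro!: mult_right_mono)
    qed
    also have "\<dots> \<le> lam * K" using low[OF F] lam by (simp add: sum_distrib_left[symmetric])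
    finally show ?thesis unfolding L2_set_def split[OF F(1)] using high[OF F] by simp
  qed
  have n0: "L2_set (sob_term 0 w') F \<le> sqrt ((sob_norm L 1 w)\<^sup>2 / lam + K)" if F: "finite F" "F \<subseteq> freqs L" for F
  proof -
    have "(\<Sum>k\<in>F - ?low F. (sob_term 0 w' k)\<^sup>2) \<le> (\<Sum>k\<in>F - ?low F. (sob_term 1 w' k)\<^sup>2 / lam)"
    proof (intro sum_mono)
      fix k assume k: "k \<in> F - ?low F"
      then have "lam * (sob_term 0 w' k)\<^sup>2 \<le> (norm k)\<^sup>2 * (sob_term 0 w' k)\<^sup>2" by (intro mult_right_mono) auto
      then show "(sob_term 0 w' k)\<^sup>2 \<le> (sob_term 1 w' k)\<^sup>2 / lam" using s1[of k w'] k F lam by (auto simp: field_simps)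
    qed
    also have "\<dots> \<le> (sob_norm L 1 w)\<^sup>2 / lam" using high[OF F] lam
      by (simp add: sum_divide_distrib[symmetric] divide_right_mono)
    finally show ?thesis unfolding L2_set_def split[OF F(1)] using low[OF F] by simp
  qed
  have p: "(sob_norm L 1 w)\<^sup>2 + lam * K \<ge> 0" "(sob_norm L 1 w)\<^sup>2 / lam + K \<ge> 0" using K0 lam by simp_all
  from sob_norm_leI[OF n1] p(1) show "sob_finite 1 w'" by simp
  have "sob_norm L 1 w' \<le> sqrt ((sob_norm L 1 w)\<^sup>2 + lam * K)" using sob_norm_leI(2)[OF n1] p(1) by simp
  then show "(sob_norm L 1 w')\<^sup>2 \<le> (sob_norm L 1 w)\<^sup>2 + lam * K"
    using power_mono[OF _ sob_norm_nonneg, of 1 w' _ 2] p(1) by fastforce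
  have "sob_norm L 0 w' \<le> sqrt ((sob_norm L 1 w)\<^sup>2 / lam + K)" using sob_norm_leI(2)[OF n0] p(2) by simp
  then show "(sob_norm L 0 w')\<^sup>2 \<le> (sob_norm L 1 w)\<^sup>2 / lam + K"
    using power_mono[OF _ sob_norm_nonneg, of 0 w' _ 2] p(2) by fastforce
qed

end

section \<open>Trilinear estimates\<close>

text \<open>In the relation \<open>p + q = k\<close>, once one of the three frequencies is fixed,
  each of the other two determines the other. The related pairs therefore project injectively to
  both factors, and Cauchy-Schwarz over the pairs produces the full norms with constant one.\<close>

lemma sum_triple_le:
  fixes b c :: "'a \<Rightarrow> real"
  assumes "finite B" "finite C" and b: "\<And>x. b x \<ge> 0" and c: "\<And>x. c x \<ge> 0"
    and inj1: "\<And>q k k'. R q k \<Longrightarrow> R q k' \<Longrightarrow> k = k'"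
    and inj2: "\<And>q q' k. R q k \<Longrightarrow> R q' k \<Longrightarrow> q = q'"
  shows "(\<Sum>q\<in>B. \<Sum>k\<in>C. if R q k then b q * c k else 0) \<le> L2_set b B * L2_set c C"
proof -
  define P where "P = {z \<in> B \<times> C. R (fst z) (snd z)}"
  have fP: "finite P" unfolding P_def using assms by auto
  have i1: "inj_on fst P" and i2: "inj_on snd P"
    unfolding P_def inj_on_def using inj1 inj2 by (auto simp: prod_eq_iff)
  have "(\<Sum>q\<in>B. \<Sum>k\<in>C. if R q k then b q * c k else 0) = (\<Sum>z\<in>B \<times> C. if R (fst z) (snd z) then b (fst z) * c (snd z) else 0)"
    by (simp add: sum.cartesian_product case_prod_beta)
  also have "\<dots> = (\<Sum>z\<in>P. \<bar>(b \<circ> fst) z\<bar> * \<bar>(c \<circ> snd) z\<bar>)"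
    unfolding P_def using assms by (subst sum.inter_filter) (auto intro!: sum.cong simp: b c)
  also have "\<dots> \<le> L2_set (b \<circ> fst) P * L2_set (c \<circ> snd) P" by (rule L2_set_mult_ineq)
  also have "L2_set (b \<circ> fst) P = L2_set b (fst ` P)"
    unfolding L2_set_def using i1 by (simp add: sum.reindex o_def)
  also have "L2_set (c \<circ> snd) P = L2_set c (snd ` P)"
    unfolding L2_set_def using i2 by (simp add: sum.reindex o_def)
  also have "L2_set b (fst ` P) * L2_set c (snd ` P) \<le> L2_set b B * L2_set c C"
    using assms(1,2) unfolding L2_set_def
    by (intro mult_mono real_sqrt_le_mono sum_mono2 real_sqrt_ge_zero sum_nonneg) (auto simp: P_def)
  finally show ?thesis .
qed

text \<open>A one-dimensional weight decaying like \<open>|n|^(-5/4)\<close>. The product over two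
  coordinates dominates the squared planar weight up to a constant, so the planar sum splits into
  two convergent sums over the integers.\<close>

definition int_weight :: "int \<Rightarrow> real" where "int_weight n = (1 + (real_of_int n)\<^sup>2) powr (- 5/8)"

lemma int_weight_bounded: "\<exists>Z. \<forall>S. finite S \<longrightarrow> sum int_weight S \<le> Z"
proof -
  define f where "f n = int_weight (int n)" for n :: nat
  have sin_mode: "summable f"
  proof (rule summable_comparison_test)
    show "\<exists>N. \<forall>n\<ge>N. norm (f n) \<le> real n powr (- 5/4)"
    proof (intro exI[of _ 1] allI impI)
      fix n :: nat assume n: "n \<ge> 1"
      have "(1 + (real n)\<^sup>2) powr (- 5/8) \<le> ((real n)\<^sup>2) powr (- 5/8)"
        using n by (intro powr_mono2') auto
      also have "\<dots> = real n powr (- 5/4)"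
        using n by (simp add: powr_powr flip: powr_numeral)
      finally show "norm (f n) \<le> real n powr (- 5/4)" by (simp add: f_def int_weight_def)
    qed
    show "summable (\<lambda>n. real n powr (- 5/4))" by (simp add: summable_real_powr_iff)
  qed
  have f0: "f n \<ge> 0" for n by (simp add: f_def int_weight_def)
  have "sum int_weight S \<le> suminf f + suminf f" if S: "finite S" for S
  proof -
    have h: "sum int_weight T \<le> suminf f" if T: "finite T" "inj_on (\<lambda>n. nat \<bar>n\<bar>) T" for T
    proof -
      have "sum int_weight T = sum f ((\<lambda>n. nat \<bar>n\<bar>) ` T)"
        using T by (subst sum.reindex) (auto simp: f_def int_weight_def)
      also have "\<dots> \<le> suminf f" using T f0 by (intro sum_le_suminf sin_mode) auto
      finally show ?thesis .
    qed
    have "sum int_weight S = sum int_weight {n \<in> S. n \<ge> 0} + sum int_weight {n \<in> S. \<not> n \<ge> 0}"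
      using S by (subst sum.union_disjoint[symmetric]) (auto intro!: arg_cong[of _ _ "sum int_weight"])
    also have "\<dots> \<le> suminf f + suminf f"
      using S by (intro add_mono h) (auto simp: inj_on_def)
    finally show ?thesis .
  qed
  then show ?thesis by blast
qed

context torus begin

text \<open>The weight \<open>|k|\<^sup>-\<^sup>1\<^sup>-\<^sup>\<sigma>\<close> for \<open>\<sigma> = 1/4\<close>.\<close>

definition lat_weight :: "real^2 \<Rightarrow> real" where "lat_weight k = norm k powr (- 5/4)"

lemma lat_weight_nonneg: "lat_weight k \<ge> 0" by (simp add: lat_weight_def)

text \<open>With \<open>s\<close> the sum of the squares of \<open>a\<close> and \<open>b\<close>,
  the product of \<open>1 + a^2\<close> and \<open>1 + b^2\<close> is at most
  \<open>1 + s + s^2 / 4\<close>, which for \<open>s \<ge> 1\<close> is at most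
  \<open>9/4 * s^2\<close>. The negative power reverses this.\<close>

lemma lat_weight_freq_bound:
  assumes "k = (2 * pi / L) *\<^sub>R vector [of_int a, of_int b]" "k \<noteq> 0"
  shows "(lat_weight k)\<^sup>2 \<le> (2 * pi / L) powr (- 5/2) * (4/9) powr (- 5/8) * (int_weight a * int_weight b)"
proof -
  define s where "s = (real_of_int a)\<^sup>2 + (real_of_int b)\<^sup>2"
  have c: "2 * pi / L > 0" using L_pos by simp
  have "(a, b) \<noteq> (0, 0)"
  proof
    assume "(a, b) = (0, 0)"
    then have "k = 0" unfolding assms(1) by (simp add: vec_eq_iff forall_2)
    then show False using assms(2) by simp
  qed
  then have "1 \<le> a\<^sup>2 + b\<^sup>2"
    by (metis add.commute add_nonneg_pos int_one_le_iff_zero_less not_sum_power2_lt_zero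
        linorder_neqE_linordered_idom sum_power2_eq_zero_iff prod.inject)
  then have s1: "1 \<le> s" unfolding s_def by (metis of_int_1_le_iff of_int_add of_int_power)
  have n: "norm k = (2 * pi / L) * sqrt s"
  proof -
    have "norm (vector [of_int a, of_int b] :: real^2) = sqrt s" by (simp add: norm_vec_def L2_set_def sum_2 s_def)
    then show ?thesis unfolding assms(1) norm_scaleR using L_pos by simp
  qed
  have ab: "(real_of_int a)\<^sup>2 * (real_of_int b)\<^sup>2 \<le> s\<^sup>2 / 4"
    using zero_le_power2[of "(real_of_int a)\<^sup>2 - (real_of_int b)\<^sup>2"]
    by (simp add: s_def power2_eq_square algebra_simps)
  have "(1 + (real_of_int a)\<^sup>2) * (1 + (real_of_int b)\<^sup>2) = 1 + s + (real_of_int a)\<^sup>2 * (real_of_int b)\<^sup>2"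
    by (simp add: s_def algebra_simps)
  also have "\<dots> \<le> 1 + s + s\<^sup>2 / 4" using ab by simp
  also have "\<dots> \<le> 9 / 4 * s\<^sup>2"
  proof -
    have "s * 1 \<le> s * s" using s1 by (intro mult_left_mono) auto
    then have "s \<le> s\<^sup>2" by (simp add: power2_eq_square)
    then have "1 \<le> s\<^sup>2" "s \<le> s\<^sup>2" using s1 by linarith+
    then show ?thesis by linarith
  qed
  finally have m: "4 / 9 * ((1 + (real_of_int a)\<^sup>2) * (1 + (real_of_int b)\<^sup>2)) \<le> s\<^sup>2" by simp
  have "(lat_weight k)\<^sup>2 = ((2 * pi / L) * sqrt s) powr (- 5/2)"
    unfolding lat_weight_def powr_sq n by simp
  also have "\<dots> = (2 * pi / L) powr (- 5/2) * (s\<^sup>2) powr (- 5/8)"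
    using c s1 by (subst powr_mult) (auto simp: powr_half_sqrt[symmetric] powr_powr simp flip: powr_numeral)
  also have "(s\<^sup>2) powr (- 5/8) \<le> (4 / 9 * ((1 + (real_of_int a)\<^sup>2) * (1 + (real_of_int b)\<^sup>2))) powr (- 5/8)"
    using m by (intro powr_mono2') (auto intro!: mult_pos_pos add_pos_nonneg)
  also have "\<dots> = (4/9) powr (- 5/8) * (int_weight a * int_weight b)"
    unfolding int_weight_def by (simp only: powr_mult)
  finally show ?thesis by (simp add: mult.assoc mult_left_mono)
qed

lemma lat_weight_square_summable: "\<exists>B>0. \<forall>F. finite F \<longrightarrow> F \<subseteq> freqs L \<longrightarrow> L2_set lat_weight F \<le> B"
proof -
  obtain Z where Z: "\<And>S. finite S \<Longrightarrow> sum int_weight S \<le> Z" using int_weight_bounded by blast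
  have zs0: "int_weight n \<ge> 0" for n by (simp add: int_weight_def)
  have Z0: "Z \<ge> 0" using Z[of "{}"] by simp
  define C where "C = (2 * pi / L) powr (- 5/2) * (4/9) powr (- 5/8)"
  have C_nonneg: "C \<ge> 0" by (simp add: C_def)
  \<comment> \<open>Integer coordinates of a frequency; \<open>dec\<close> is injective on
    frequencies because \<open>k\<close> is recovered from them.\<close>
  define dec where "dec k = (SOME z. k = (2 * pi / L) *\<^sub>R vector [of_int (fst z), of_int (snd z)])" for k :: "real^2"
  have dec: "k = (2 * pi / L) *\<^sub>R vector [of_int (fst (dec k)), of_int (snd (dec k))]" if "k \<in> freqs L" for k
  proof -
    have "k \<in> lat" using that freqs_lat by blast
    then obtain a b :: int where "k = (2 * pi / L) *\<^sub>R vector [of_int a, of_int b]" unfolding lat_iff by blast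
    then have "k = (2 * pi / L) *\<^sub>R vector [of_int (fst (a, b)), of_int (snd (a, b))]" by simp
    then show ?thesis unfolding dec_def by (rule someI)
  qed
  have "L2_set lat_weight F \<le> sqrt (C * (Z * Z))" if F: "finite F" "F \<subseteq> freqs L" for F
  proof -
    have inj: "inj_on dec F" by (rule inj_onI) (metis dec F(2) subsetD)
    have "(\<Sum>k\<in>F. (lat_weight k)\<^sup>2) \<le> (\<Sum>k\<in>F. C * (int_weight (fst (dec k)) * int_weight (snd (dec k))))"
      unfolding C_def using F(2) dec freqs_nz by (intro sum_mono lat_weight_freq_bound) auto
    also have "\<dots> = C * (\<Sum>z\<in>dec ` F. int_weight (fst z) * int_weight (snd z))"
      using inj by (simp add: sum.reindex sum_distrib_left)
    \<comment> \<open>Enlarging the index set to a product of its projections makes the double sum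
      factor.\<close>
    also have "\<dots> \<le> C * (\<Sum>z\<in>(fst ` dec ` F) \<times> (snd ` dec ` F). int_weight (fst z) * int_weight (snd z))"
    proof (intro mult_left_mono sum_mono2 C_nonneg)
      show "dec ` F \<subseteq> (fst ` dec ` F) \<times> (snd ` dec ` F)" by (intro subsetI) (simp only: mem_Times_iff imageI simp_thms)
    qed (use F zs0 in auto)
    also have "\<dots> = C * (sum int_weight (fst ` dec ` F) * sum int_weight (snd ` dec ` F))"
      by (simp add: sum_product sum.cartesian_product case_prod_beta)
    also have "\<dots> \<le> C * (Z * Z)"
      using C_nonneg Z0 F zs0 by (intro mult_left_mono mult_mono Z sum_nonneg) auto
    finally show ?thesis unfolding L2_set_def by simp
  qed
  then have "L2_set lat_weight F \<le> sqrt (C * (Z * Z)) + 1" if "finite F" "F \<subseteq> freqs L" for F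
    using that by fastforce
  moreover have "sqrt (C * (Z * Z)) + 1 > 0" using C_nonneg Z0 by (simp add: add_nonneg_pos)
  ultimately show ?thesis by blast
qed

definition weight_bound where "weight_bound = (SOME B. B > 0 \<and> (\<forall>F. finite F \<longrightarrow> F \<subseteq> freqs L \<longrightarrow> L2_set lat_weight F \<le> B))"

lemma weight_bound_pos: "weight_bound > 0" and L2_set_lat_weight_le: "finite F \<Longrightarrow> F \<subseteq> freqs L \<Longrightarrow> L2_set lat_weight F \<le> weight_bound"
  using someI_ex[OF lat_weight_square_summable] unfolding weight_bound_def by blast+

text \<open>Duality: one factor of the square of \<open>L2_set d F\<close> is replaced by its
  convolution bound. For the weight at \<open>k\<close>, sum over the pairs (p,q) with
  \<open>k\<close> fixed and then pair the weight with \<open>d\<close>; for the weight at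
  \<open>p\<close>, sum over the pairs (q,k) with \<open>p\<close> fixed and then pair the weight
  with \<open>\<alpha>\<close>. Either way its square summability absorbs the weight, and the
  coefficients 2 and 1 add up to 3.\<close>

lemma convolution_estimate:
  assumes F: "finite F" "F \<subseteq> freqs L" and G: "finite G" "G \<subseteq> freqs L" and G': "finite G'"
    and nn: "\<And>k. d k \<ge> 0" "\<And>p. \<alpha> p \<ge> 0" "\<And>q. \<beta> q \<ge> 0"
    and le: "\<And>k. k \<in> F \<Longrightarrow> d k \<le> (\<Sum>p\<in>G. \<Sum>q\<in>G'. if p + q = k then \<alpha> p * \<beta> q * (2 * lat_weight k + lat_weight p) else 0)"
  shows "L2_set d F \<le> 3 * weight_bound * L2_set \<alpha> G * L2_set \<beta> G'"
proof -
  define D where "D = L2_set d F"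
  have D0: "D \<ge> 0" by (simp add: D_def)
  have "D\<^sup>2 = (\<Sum>k\<in>F. d k * d k)" by (simp add: D_def L2_set_def sum_nonneg power2_eq_square)
  also have "\<dots> \<le> (\<Sum>k\<in>F. d k * (\<Sum>p\<in>G. \<Sum>q\<in>G'. if p + q = k then \<alpha> p * \<beta> q * (2 * lat_weight k + lat_weight p) else 0))"
    by (intro sum_mono mult_left_mono le nn)
  also have "\<dots> = (\<Sum>k\<in>F. 2 * (d k * lat_weight k) * (\<Sum>p\<in>G. \<Sum>q\<in>G'. if p + q = k then \<alpha> p * \<beta> q else 0))
      + (\<Sum>k\<in>F. \<Sum>p\<in>G. \<Sum>q\<in>G'. (\<alpha> p * lat_weight p) * (if p + q = k then \<beta> q * d k else 0))"
    unfolding sum_distrib_left sum.distrib[symmetric]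
    by (intro sum.cong refl) (auto simp: algebra_simps)
  also have "(\<Sum>k\<in>F. \<Sum>p\<in>G. \<Sum>q\<in>G'. (\<alpha> p * lat_weight p) * (if p + q = k then \<beta> q * d k else 0))
      = (\<Sum>p\<in>G. \<Sum>k\<in>F. \<Sum>q\<in>G'. (\<alpha> p * lat_weight p) * (if p + q = k then \<beta> q * d k else 0))"
    by (rule sum.swap)
  also have "\<dots> = (\<Sum>p\<in>G. (\<alpha> p * lat_weight p) * (\<Sum>q\<in>G'. \<Sum>k\<in>F. if p + q = k then \<beta> q * d k else 0))"
    by (subst sum.swap[of _ _ F]) (simp add: sum_distrib_left)
  also have "(\<Sum>k\<in>F. 2 * (d k * lat_weight k) * (\<Sum>p\<in>G. \<Sum>q\<in>G'. if p + q = k then \<alpha> p * \<beta> q else 0))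
     \<le> (\<Sum>k\<in>F. 2 * (d k * lat_weight k) * (L2_set \<alpha> G * L2_set \<beta> G'))"
    by (intro sum_mono mult_left_mono sum_triple_le) (use G G' nn lat_weight_nonneg in auto)
  also have "\<dots> = 2 * (L2_set \<alpha> G * L2_set \<beta> G') * (\<Sum>k\<in>F. \<bar>d k\<bar> * \<bar>lat_weight k\<bar>)"
    by (simp add: sum_distrib_left sum_distrib_right nn lat_weight_nonneg algebra_simps)
  also have "\<dots> \<le> 2 * (L2_set \<alpha> G * L2_set \<beta> G') * (D * weight_bound)"
    unfolding D_def
    by (intro mult_left_mono order_trans[OF L2_set_mult_ineq] L2_set_lat_weight_le F) auto
  also have "(\<Sum>p\<in>G. (\<alpha> p * lat_weight p) * (\<Sum>q\<in>G'. \<Sum>k\<in>F. if p + q = k then \<beta> q * d k else 0))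
     \<le> (\<Sum>p\<in>G. (\<alpha> p * lat_weight p) * (L2_set \<beta> G' * D))"
    unfolding D_def
    by (intro sum_mono mult_left_mono sum_triple_le) (use F G' nn lat_weight_nonneg in auto)
  also have "\<dots> = (L2_set \<beta> G' * D) * (\<Sum>p\<in>G. \<bar>\<alpha> p\<bar> * \<bar>lat_weight p\<bar>)"
    by (simp add: sum_distrib_left sum_distrib_right nn lat_weight_nonneg algebra_simps)
  also have "\<dots> \<le> (L2_set \<beta> G' * D) * (L2_set \<alpha> G * weight_bound)"
    using D0 by (intro mult_left_mono order_trans[OF L2_set_mult_ineq] L2_set_lat_weight_le G) auto
  finally have "D\<^sup>2 \<le> (3 * weight_bound * L2_set \<alpha> G * L2_set \<beta> G') * D"
    by (simp add: algebra_simps)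
  then have "D * D \<le> (3 * weight_bound * L2_set \<alpha> G * L2_set \<beta> G') * D" by (simp add: power2_eq_square)
  moreover have "0 \<le> 3 * weight_bound * L2_set \<alpha> G * L2_set \<beta> G'" using weight_bound_pos by (intro mult_nonneg_nonneg) auto
  ultimately show ?thesis unfolding D_def[symmetric] using D0
    by (cases "D = 0") (auto simp: mult_le_cancel_right)
qed

text \<open>\<open>lat_weight\<close> times the norm is the power -1/4 of the norm. If
  \<open>k\<close> is the shorter vector its norm is replaced by that of \<open>p\<close> in this
  product; otherwise the power -1/4 itself is monotone.\<close>

lemma weight_ineq:
  assumes "k \<noteq> 0" "p \<noteq> 0"
  shows "norm k powr (- 1/4) \<le> norm p * (lat_weight k + lat_weight p)"
proof -
  have k: "norm k > 0" and p: "norm p > 0" using assms by simp_all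
  have w: "lat_weight z * norm z = norm z powr (- 1/4)" if "z \<noteq> 0" for z
    using powr_add[of "norm z" "- 5/4" 1] that by (simp add: lat_weight_def)
  show ?thesis
  proof (cases "norm k \<le> norm p")
    case True
    have "norm k powr (- 1/4) = norm k * lat_weight k" using w[OF assms(1)] by (simp add: mult.commute)
    also have "\<dots> \<le> norm p * lat_weight k" using True by (intro mult_right_mono lat_weight_nonneg)
    also have "\<dots> \<le> norm p * (lat_weight k + lat_weight p)" using lat_weight_nonneg[of p] p by simp
    finally show ?thesis .
  next
    case False
    then have "norm k powr (- 1/4) \<le> norm p powr (- 1/4)" using p by (intro powr_mono2') auto
    also have "\<dots> = norm p * lat_weight p" using w[OF assms(2)] by (simp add: mult.commute)
    also have "\<dots> \<le> norm p * (lat_weight k + lat_weight p)" using lat_weight_nonneg[of k] p by simp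
    finally show ?thesis .
  qed
qed

text \<open>Three distributions of the derivatives, brought to the form required by
  \<open>convolution_estimate\<close>. In the second the factor at \<open>q\<close> is measured
  without a derivative, so \<open>norm q\<close> is moved to \<open>p\<close> and \<open>k\<close>
  by the triangle inequality, the counterpart of an integration by parts. The share of
  \<open>k\<close> lowers its weight to the power -1/4, to which \<open>weight_ineq\<close> applies;
  hence the coefficient 2.\<close>

lemma weight_ineqs:
  assumes "k \<noteq> 0" "p \<noteq> 0" "p + q = k" "x \<ge> 0" "y \<ge> 0"
  shows "norm k powr (- 1/4) * (x * norm q * y) \<le> (norm p * x) * (norm q * y) * (2 * lat_weight k + lat_weight p)"
    and "lat_weight k * (x * norm q * y) \<le> (norm p * x) * y * (2 * lat_weight k + lat_weight p)"
    and "lat_weight k * (x * norm q * y) \<le> x * (norm q * y) * (2 * lat_weight k + lat_weight p)"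
proof -
  note w = weight_ineq[OF assms(1,2)]
  have xy: "0 \<le> x * norm q * y" "0 \<le> x * y" using assms by auto
  have "norm k powr (- 1/4) * (x * norm q * y) \<le> norm p * (lat_weight k + lat_weight p) * (x * norm q * y)"
    by (rule mult_right_mono[OF w xy(1)])
  also have "\<dots> \<le> norm p * (2 * lat_weight k + lat_weight p) * (x * norm q * y)"
    using lat_weight_nonneg[of k] by (intro mult_right_mono mult_left_mono xy) auto
  finally show "norm k powr (- 1/4) * (x * norm q * y) \<le> (norm p * x) * (norm q * y) * (2 * lat_weight k + lat_weight p)"
    by (simp add: mult_ac)
  have "norm q \<le> norm p + norm k" using assms(3) norm_triangle_ineq4[of k p] by (metis add.commute add_diff_cancel_left')
  then have "lat_weight k * norm q \<le> lat_weight k * (norm p + norm k)" by (intro mult_left_mono lat_weight_nonneg)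
  also have "\<dots> = norm p * lat_weight k + norm k powr (- 1/4)"
    using powr_add[of "norm k" "- 5/4" 1] assms(1) by (simp add: lat_weight_def algebra_simps)
  also have "\<dots> \<le> norm p * (2 * lat_weight k + lat_weight p)" using w by (simp add: algebra_simps)
  finally have "(lat_weight k * norm q) * (x * y) \<le> norm p * (2 * lat_weight k + lat_weight p) * (x * y)"
    by (rule mult_right_mono[OF _ xy(2)])
  then show "lat_weight k * (x * norm q * y) \<le> (norm p * x) * y * (2 * lat_weight k + lat_weight p)" by (simp add: mult_ac)
  have "lat_weight k * (x * norm q * y) \<le> (2 * lat_weight k + lat_weight p) * (x * norm q * y)"
    using lat_weight_nonneg[of k] lat_weight_nonneg[of p] by (intro mult_right_mono xy) auto
  then show "lat_weight k * (x * norm q * y) \<le> x * (norm q * y) * (2 * lat_weight k + lat_weight p)" by (simp add: mult_ac)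
qed

section \<open>The convection term of polynomial fields\<close>

lemma convection_L2:
  assumes "u \<in> trig_poly L" "v \<in> trig_poly L"
  shows "convection u v \<in> L2 L"
proof -
  have c: "continuous_on UNIV w" if "w \<in> trig_poly L" for w
    using trig_poly_exp_form[OF that] exp_form_continuous by blast
  show ?thesis unfolding convection_def[abs_def]
    by (intro continuous_in_L2 continuous_intros c trig_poly_pd assms)
qed

text \<open>Orthogonality leaves only the pairs with \<open>p + q = k\<close>; \<open>p\<close>
  belongs to the transporting field and \<open>q\<close>, which carries the derivative, to the
  transported one.\<close>

lemma mode_coeff_convection:
  assumes u: "exp_form G c u" and v: "exp_form G' d v" and k: "k \<in> lat"
  shows "mode_coeff k (convection u v) = (\<Sum>p\<in>G. \<Sum>q\<in>G'. if p + q = k then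
      \<i> * (\<Sum>i\<in>UNIV. of_real (q $ i) * c p $ i) * (\<Sum>j\<in>UNIV. of_real (perp k $ j) * d q $ j) else 0)"
proof -
  have uu: "complex_of_real (u x $ i) = (\<Sum>p\<in>G. c p $ i * cis (p \<bullet> x))" for x i using u by (simp add: exp_form_def)
  have vv: "complex_of_real (pd i v x $ j) = (\<Sum>q\<in>G'. (\<i> * of_real (q $ i) * d q $ j) * cis (q \<bullet> x))" for x i j
    using exp_form_pd[OF v, of i] by (simp add: exp_form_def)
  have GL: "finite G" "G \<subseteq> lat" "finite G'" "G' \<subseteq> lat" using u v by (auto simp: exp_form_def)
  have pq: "complex_of_real (convection u v x $ j) * cis (- (k \<bullet> x))
     = (\<Sum>p\<in>G. \<Sum>q\<in>G'. (\<i> * (\<Sum>i\<in>UNIV. of_real (q $ i) * c p $ i) * d q $ j) * cis ((p + q - k) \<bullet> x))" for x j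
  proof -
    have "complex_of_real (convection u v x $ j) = (\<Sum>i\<in>UNIV. complex_of_real (u x $ i) * complex_of_real (pd i v x $ j))"
      by (simp add: convection_def)
    also have "\<dots> = (\<Sum>p\<in>G. \<Sum>q\<in>G'. \<Sum>i\<in>UNIV. (c p $ i * cis (p \<bullet> x)) * ((\<i> * of_real (q $ i) * d q $ j) * cis (q \<bullet> x)))"
      unfolding uu vv sum_product by (subst sum.swap, rule sum.cong[OF refl], rule sum.swap)
    finally show ?thesis
      by (simp add: sum_distrib_right sum_distrib_left inner_add_left inner_diff_left cis_mult[symmetric]
          cis_divide[symmetric] divide_inverse cis_inverse mult_ac)
  qed
  have "fourier_coeff L (convection u v) k $ j = (\<Sum>p\<in>G. \<Sum>q\<in>G'. if p + q = k then
      \<i> * (\<Sum>i\<in>UNIV. of_real (q $ i) * c p $ i) * d q $ j else 0)" for j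
  proof -
    have "(\<integral>x. of_real (convection u v x $ j) * cis (- (k \<bullet> x)) \<partial>M)
      = (\<Sum>p\<in>G. \<Sum>q\<in>G'. (\<i> * (\<Sum>i\<in>UNIV. of_real (q $ i) * c p $ i) * d q $ j) * (\<integral>x. cis ((p + q - k) \<bullet> x) \<partial>M))"
      unfolding pq
      by (simp add: Bochner_Integration.integral_sum continuous_integrable continuous_cis_inner)
    also have "\<dots> = (\<Sum>p\<in>G. \<Sum>q\<in>G'. of_real (L\<^sup>2) * (if p + q = k then
        \<i> * (\<Sum>i\<in>UNIV. of_real (q $ i) * c p $ i) * d q $ j else 0))"
    proof (intro sum.cong refl)
      fix p q assume "p \<in> G" "q \<in> G'"
      then have "p + q - k \<in> lat" using GL k lat_add lat_diff by blast
      then show "(\<i> * (\<Sum>i\<in>UNIV. of_real (q $ i) * c p $ i) * d q $ j) * (\<integral>x. cis ((p + q - k) \<bullet> x) \<partial>M)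
         = of_real (L\<^sup>2) * (if p + q = k then \<i> * (\<Sum>i\<in>UNIV. of_real (q $ i) * c p $ i) * d q $ j else 0)"
        by (simp only: integral_cis) simp
    qed
    finally show ?thesis using L_pos
      by (simp add: fc_component sum_distrib_left[symmetric])
  qed
  then have "mode_coeff k (convection u v) = (\<Sum>j\<in>UNIV. \<Sum>p\<in>G. \<Sum>q\<in>G'. if p + q = k then
      of_real (perp k $ j) * (\<i> * (\<Sum>i\<in>UNIV. of_real (q $ i) * c p $ i) * d q $ j) else 0)"
    unfolding mode_coeff_def sum_distrib_left by (intro sum.cong refl) (simp add: sum_distrib_left if_distrib cong: if_cong)
  also have "\<dots> = (\<Sum>p\<in>G. \<Sum>q\<in>G'. \<Sum>j\<in>UNIV. if p + q = k then
      of_real (perp k $ j) * (\<i> * (\<Sum>i\<in>UNIV. of_real (q $ i) * c p $ i) * d q $ j) else 0)"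
    by (subst sum.swap, rule sum.cong[OF refl], rule sum.swap)
  also have "\<dots> = (\<Sum>p\<in>G. \<Sum>q\<in>G'. if p + q = k then
      \<i> * (\<Sum>i\<in>UNIV. of_real (q $ i) * c p $ i) * (\<Sum>j\<in>UNIV. of_real (perp k $ j) * d q $ j) else 0)"
    by (intro sum.cong refl) (auto simp: sum_2 algebra_simps)
  finally show ?thesis .
qed

lemma sol_poly_exp_form:
  assumes "u \<in> sol_poly L" obtains G where "finite G" "G \<subseteq> freqs L" "exp_form G (fourier_coeff L u) u"
proof -
  obtain G where G: "exp_form G (fourier_coeff L u) u" using trig_poly_exp_form[OF sol_poly_trig[OF assms]] by blast
  have fG: "finite G" "G \<subseteq> lat" using G by (auto simp: exp_form_def)
  have "exp_form (G - {0}) (fourier_coeff L u) u"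
    unfolding exp_form_def
  proof (intro conjI allI)
    fix x j
    have "complex_of_real (u x $ j) = (\<Sum>k\<in>G. fourier_coeff L u k $ j * cis (k \<bullet> x))" using G by (simp add: exp_form_def)
    also have "\<dots> = (\<Sum>k\<in>G - {0}. fourier_coeff L u k $ j * cis (k \<bullet> x))"
      using fG sol_poly_fc_0[OF assms] by (intro sum.mono_neutral_right) auto
    finally show "complex_of_real (u x $ j) = \<dots>" .
  qed (use fG in auto)
  moreover have "G - {0} \<subseteq> freqs L" using fG by (auto simp: lat_def)
  ultimately show ?thesis using that[of "G - {0}"] fG by blast
qed

text \<open>The constant of \<open>convolution_estimate\<close>, divided by one factor
  \<open>L\<close> for each of the two Sobolev norms, which contain it while bare coefficients do
  not.\<close>

definition nonlin_const where "nonlin_const = 3 * weight_bound / L\<^sup>2"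

lemma nonlin_const_pos: "nonlin_const > 0" using weight_bound_pos L_pos by (simp add: nonlin_const_def)

text \<open>All three are one convolution bound, stated as \<open>gen\<close>; they differ only in
  how the amplitude is split into \<open>\<alpha>\<close> at \<open>p\<close> and
  \<open>\<beta>\<close> at \<open>q\<close>.\<close>

lemma poly_estimates:
  assumes u: "u \<in> sol_poly L" and v: "v \<in> sol_poly L" and F: "finite F" "F \<subseteq> freqs L"
  shows "L2_set (\<lambda>k. norm k powr (- 1/4) * cmod (mode_coeff k (convection u v))) F \<le> nonlin_const * sob_norm L 1 u * sob_norm L 1 v"
    and "L2_set (\<lambda>k. lat_weight k * cmod (mode_coeff k (convection u v))) F \<le> nonlin_const * sob_norm L 1 u * sob_norm L 0 v"
    and "L2_set (\<lambda>k. lat_weight k * cmod (mode_coeff k (convection u v))) F \<le> nonlin_const * sob_norm L 0 u * sob_norm L 1 v"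
proof -
  obtain G where G: "finite G" "G \<subseteq> freqs L" "exp_form G (fourier_coeff L u) u" using sol_poly_exp_form[OF u] by blast
  obtain G' where G': "finite G'" "G' \<subseteq> freqs L" "exp_form G' (fourier_coeff L v) v" using sol_poly_exp_form[OF v] by blast
  let ?x = "\<lambda>p. norm (fourier_coeff L u p)" and ?y = "\<lambda>q. norm (fourier_coeff L v q)"
  have b: "cmod (mode_coeff k (convection u v)) \<le> (\<Sum>p\<in>G. \<Sum>q\<in>G'. if p + q = k then ?x p * norm q * ?y q else 0)"
    if "k \<in> F" for k
  proof -
    have k: "k \<in> lat" "k \<noteq> 0" using that F freqs_iff by auto
    show ?thesis
      unfolding mode_coeff_convection[OF G(3) G'(3) k(1)]
    proof (intro order_trans[OF norm_sum] sum_mono)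
      fix p q
      have "cmod (\<i> * (\<Sum>i\<in>UNIV. of_real (q $ i) * fourier_coeff L u p $ i) * (\<Sum>j\<in>UNIV. of_real (perp k $ j) * fourier_coeff L v q $ j))
         \<le> (norm q * ?x p) * (norm (perp k) * ?y q)"
        unfolding norm_mult norm_ii mult_1 by (intro mult_mono cmod_dot_le) auto
      then show "cmod (if p + q = k then \<i> * (\<Sum>i\<in>UNIV. of_real (q $ i) * fourier_coeff L u p $ i) * (\<Sum>j\<in>UNIV. of_real (perp k $ j) * fourier_coeff L v q $ j) else 0)
          \<le> (if p + q = k then ?x p * norm q * ?y q else 0)"
        using norm_perp[OF k(2)] by (simp add: mult_ac)
    qed
  qed
  have s1: "L2_set (\<lambda>p. norm p * norm (fourier_coeff L z p)) A \<le> sob_norm L 1 z / L"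
    and s0: "L2_set (\<lambda>p. norm (fourier_coeff L z p)) A \<le> sob_norm L 0 z / L"
    if "z \<in> sol_poly L" "finite A" "A \<subseteq> freqs L" for z A
  proof -
    have "L * L2_set (\<lambda>p. norm p * norm (fourier_coeff L z p)) A = L2_set (sob_term 1 z) A"
      using L_pos that(3) freqs_nz by (subst L2_set_right_distrib) (auto simp: sob_term_def L2_set_def intro!: sum.cong)
    also have "\<dots> \<le> sob_norm L 1 z" by (intro L2_set_sob_term_le trig_poly_sob_finite sol_poly_trig that)
    finally show "L2_set (\<lambda>p. norm p * norm (fourier_coeff L z p)) A \<le> sob_norm L 1 z / L"
      using L_pos by (simp add: field_simps)
    have "L * L2_set (\<lambda>p. norm (fourier_coeff L z p)) A = L2_set (sob_term 0 z) A"
      using L_pos that(3) freqs_nz by (subst L2_set_right_distrib) (auto simp: sob_term_def L2_set_def intro!: sum.cong)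
    also have "\<dots> \<le> sob_norm L 0 z" by (intro L2_set_sob_term_le trig_poly_sob_finite sol_poly_trig that)
    finally show "L2_set (\<lambda>p. norm (fourier_coeff L z p)) A \<le> sob_norm L 0 z / L"
      using L_pos by (simp add: field_simps)
  qed
  have gen: "L2_set (\<lambda>k. \<omega> k * cmod (mode_coeff k (convection u v))) F \<le> nonlin_const * X * Y"
    if om: "\<And>k. \<omega> k \<ge> 0" and nn: "\<And>p. \<alpha> p \<ge> 0" "\<And>q. \<beta> q \<ge> 0"
      and XY: "L2_set \<alpha> G \<le> X / L" "L2_set \<beta> G' \<le> Y / L"
      and ineq: "\<And>k p q. k \<noteq> 0 \<Longrightarrow> p \<noteq> 0 \<Longrightarrow> p + q = k \<Longrightarrow>
         \<omega> k * (?x p * norm q * ?y q) \<le> \<alpha> p * \<beta> q * (2 * lat_weight k + lat_weight p)" for \<omega> \<alpha> \<beta> X Y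
  proof -
    have "L2_set (\<lambda>k. \<omega> k * cmod (mode_coeff k (convection u v))) F \<le> 3 * weight_bound * L2_set \<alpha> G * L2_set \<beta> G'"
    proof (rule convolution_estimate[OF F G(1,2) G'(1)])
      fix k assume k: "k \<in> F"
      then have "\<omega> k * cmod (mode_coeff k (convection u v)) \<le> \<omega> k * (\<Sum>p\<in>G. \<Sum>q\<in>G'. if p + q = k then ?x p * norm q * ?y q else 0)"
        by (intro mult_left_mono b om)
      also have "\<dots> = (\<Sum>p\<in>G. \<Sum>q\<in>G'. if p + q = k then \<omega> k * (?x p * norm q * ?y q) else 0)"
        unfolding sum_distrib_left by (intro sum.cong refl) simp
      also have "\<dots> \<le> (\<Sum>p\<in>G. \<Sum>q\<in>G'. if p + q = k then \<alpha> p * \<beta> q * (2 * lat_weight k + lat_weight p) else 0)"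
        using k F(2) G(2) freqs_nz ineq by (intro sum_mono) (auto simp: subset_iff)
      finally show "\<omega> k * cmod (mode_coeff k (convection u v)) \<le> (\<Sum>p\<in>G. \<Sum>q\<in>G'. if p + q = k then \<alpha> p * \<beta> q * (2 * lat_weight k + lat_weight p) else 0)" .
    qed (use om nn in auto)
    also have "\<dots> \<le> 3 * weight_bound * (X / L) * (Y / L)"
    proof -
      have "0 \<le> X / L" using order_trans[OF L2_set_nonneg XY(1)] .
      then show ?thesis using weight_bound_pos XY by (intro mult_mono mult_nonneg_nonneg) auto
    qed
    also have "\<dots> = nonlin_const * X * Y" by (simp add: nonlin_const_def power2_eq_square)
    finally show ?thesis .
  qed
  show "L2_set (\<lambda>k. norm k powr (- 1/4) * cmod (mode_coeff k (convection u v))) F \<le> nonlin_const * sob_norm L 1 u * sob_norm L 1 v"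
  proof (rule gen[where \<alpha>="\<lambda>p. norm p * ?x p" and \<beta>="\<lambda>q. norm q * ?y q"])
    fix k p q :: "real^2" assume "k \<noteq> 0" "p \<noteq> 0" "p + q = k"
    then show "norm k powr (- 1/4) * (?x p * norm q * ?y q) \<le> norm p * ?x p * (norm q * ?y q) * (2 * lat_weight k + lat_weight p)"
      by (rule weight_ineqs(1)) simp_all
  qed (auto intro!: s1 u v G G')
  show "L2_set (\<lambda>k. lat_weight k * cmod (mode_coeff k (convection u v))) F \<le> nonlin_const * sob_norm L 1 u * sob_norm L 0 v"
    by (rule gen[where \<alpha>="\<lambda>p. norm p * ?x p" and \<beta>="?y"])
       (auto intro!: s1 s0 u v G G' weight_ineqs(2) lat_weight_nonneg)
  show "L2_set (\<lambda>k. lat_weight k * cmod (mode_coeff k (convection u v))) F \<le> nonlin_const * sob_norm L 0 u * sob_norm L 1 v"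
    by (rule gen[where \<alpha>="?x" and \<beta>="\<lambda>q. norm q * ?y q"])
       (auto intro!: s1 s0 u v G G' weight_ineqs(3) lat_weight_nonneg)
qed

end

section \<open>The pairing \<open>B\<close>\<close>

context torus begin

lemma pd_diff:
  assumes "u \<in> trig_poly L" "v \<in> trig_poly L"
  shows "pd i (\<lambda>x. u x - v x) x = pd i u x - pd i v x"
  using pd_add[OF assms(1) trig_poly_scale[OF assms(2), of "-1"]] pd_scale[OF assms(2), of _ "-1"] by simp

lemma mode_coeff_convection_diff_left:
  assumes "u \<in> trig_poly L" "u' \<in> trig_poly L" "v \<in> trig_poly L"
  shows "mode_coeff k (convection (\<lambda>x. u x - u' x) v) = mode_coeff k (convection u v) - mode_coeff k (convection u' v)"
proof -
  have "convection (\<lambda>x. u x - u' x) v = (\<lambda>x. convection u v x - convection u' v x)"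
    by (simp add: convection_def fun_eq_iff scaleR_left_diff_distrib sum_subtractf)
  then show ?thesis using assms by (simp add: mode_coeff_diff convection_L2)
qed

lemma mode_coeff_convection_diff_right:
  assumes "u \<in> trig_poly L" "v \<in> trig_poly L" "v' \<in> trig_poly L"
  shows "mode_coeff k (convection u (\<lambda>x. v x - v' x)) = mode_coeff k (convection u v) - mode_coeff k (convection u v')"
proof -
  have "convection u (\<lambda>x. v x - v' x) = (\<lambda>x. convection u v x - convection u v' x)"
    using assms by (simp add: convection_def fun_eq_iff pd_diff scaleR_right_diff_distrib sum_subtractf)
  then show ?thesis using assms by (simp add: mode_coeff_diff convection_L2)
qed

lemma mode_coeff_convection_le:
  assumes "u \<in> sol_poly L" "v \<in> sol_poly L" "k \<in> freqs L"
  shows "cmod (mode_coeff k (convection u v)) \<le> nonlin_const * norm k powr (1/4) * (sob_norm L 1 u * sob_norm L 1 v)"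
proof -
  have n: "norm k > 0" using freqs_norm_pos[OF assms(3)] .
  have "norm k powr (- 1/4) * cmod (mode_coeff k (convection u v)) \<le> nonlin_const * sob_norm L 1 u * sob_norm L 1 v"
    using poly_estimates(1)[OF assms(1,2), of "{k}"] assms(3) by (simp add: L2_set_def real_sqrt_mult real_sqrt_abs)
  then have "norm k powr (1/4) * (norm k powr (- 1/4) * cmod (mode_coeff k (convection u v)))
      \<le> norm k powr (1/4) * (nonlin_const * sob_norm L 1 u * sob_norm L 1 v)"
    by (intro mult_left_mono) auto
  moreover have "norm k powr (1/4) * norm k powr (- 1/4) = 1" using n by (simp flip: powr_add)
  ultimately show ?thesis by (simp add: mult_ac)
qed

text \<open>Two pairs of approximating sequences give asymptotically the same coefficients: this yields
  both convergence and independence of the approximation.\<close>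

lemma V_limit_convection_close:
  assumes u: "u \<in> V L" and v: "v \<in> V L" and k: "k \<in> freqs L" and e: "e > 0"
    and l: "V_limit L \<phi> u" "V_limit L \<psi> v" "V_limit L \<phi>' u" "V_limit L \<psi>' v"
  shows "\<exists>N. \<forall>n\<ge>N. \<forall>m\<ge>N. cmod (mode_coeff k (convection (\<phi> n) (\<psi> n)) - mode_coeff k (convection (\<phi>' m) (\<psi>' m))) < e"
proof -
  note lu = V_limit_sob_finite[OF u l(1)] and lu' = V_limit_sob_finite[OF u l(3)]
  note lv = V_limit_sob_finite[OF v l(2)] and lv' = V_limit_sob_finite[OF v l(4)]
  note uL = V_L2[OF u] V_sob_finite[OF u] and vL = V_L2[OF v] V_sob_finite[OF v]
  define nu nv where "nu = sob_norm L 1 u" and "nv = sob_norm L 1 v"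
  have nn: "nu \<ge> 0" "nv \<ge> 0" by (simp_all add: nu_def nv_def sob_norm_nonneg)
  define C where "C = nonlin_const * norm k powr (1/4)"
  have C: "C > 0" using nonlin_const_pos freqs_norm_pos[OF k] by (simp add: C_def)
  \<comment> \<open>The cap at 1 keeps the norms of the approximants within 1 of their limits. The
    difference of the coefficients will be bounded by \<open>2 * C * (nu + nv + 2) * t\<close>, and
    \<open>+ 3\<close> in the denominator makes this strictly less than \<open>e\<close>.\<close>
  define t where "t = min 1 (e / (2 * C * (nu + nv + 3)))"
  have t: "t > 0" "t \<le> 1" "2 * C * (nu + nv + 2) * t < e"
  proof -
    have p: "2 * C * (nu + nv + 3) > 0" using C nn by simp
    show "t > 0" "t \<le> 1" using e p by (auto simp: t_def)
    have "2 * C * (nu + nv + 2) * t < 2 * C * (nu + nv + 3) * t" using C \<open>t > 0\<close> by simp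
    also have "\<dots> \<le> 2 * C * (nu + nv + 3) * (e / (2 * C * (nu + nv + 3)))"
      using p by (intro mult_left_mono) (auto simp: t_def)
    also have "\<dots> = e" using p by (subst times_divide_eq_right, subst nonzero_mult_div_cancel_left) (simp_all only: less_irrefl not_False_eq_True, linarith?)
    finally show "2 * C * (nu + nv + 2) * t < e" .
  qed
  have ev: "\<forall>\<^sub>F n in sequentially. sob_norm L 1 (\<lambda>x. \<phi> n x - u x) < t \<and> sob_norm L 1 (\<lambda>x. \<psi> n x - v x) < t
     \<and> sob_norm L 1 (\<lambda>x. \<phi>' n x - u x) < t \<and> sob_norm L 1 (\<lambda>x. \<psi>' n x - v x) < t"
    using lu(5) lv(5) lu'(5) lv'(5) t(1) by (intro eventually_conj) (auto elim!: order_tendstoD(2))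
  then obtain N where N: "\<And>n. n \<ge> N \<Longrightarrow> sob_norm L 1 (\<lambda>x. \<phi> n x - u x) < t" "\<And>n. n \<ge> N \<Longrightarrow> sob_norm L 1 (\<lambda>x. \<psi> n x - v x) < t"
     "\<And>n. n \<ge> N \<Longrightarrow> sob_norm L 1 (\<lambda>x. \<phi>' n x - u x) < t" "\<And>n. n \<ge> N \<Longrightarrow> sob_norm L 1 (\<lambda>x. \<psi>' n x - v x) < t"
    unfolding eventually_sequentially by blast
  show ?thesis
  proof (intro exI[of _ N] allI impI)
    fix n m assume nm: "N \<le> n" "N \<le> m"
    have d1: "sob_norm L 1 (\<lambda>x. \<phi> n x - \<phi>' m x) \<le> 2 * t"
    proof -
      have "sob_norm L 1 (\<lambda>x. \<phi> n x - \<phi>' m x) \<le> sob_norm L 1 (\<lambda>x. \<phi> n x - u x) + sob_norm L 1 (\<lambda>x. u x - \<phi>' m x)"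
        by (intro sob_norm_diff_triangle lu lu' uL)
      then show ?thesis using N(1)[OF nm(1)] N(3)[OF nm(2)] sob_norm_diff_commute[OF uL(1) lu'(2)[of m], of 1] by linarith
    qed
    have d2: "sob_norm L 1 (\<lambda>x. \<psi> n x - \<psi>' m x) \<le> 2 * t"
    proof -
      have "sob_norm L 1 (\<lambda>x. \<psi> n x - \<psi>' m x) \<le> sob_norm L 1 (\<lambda>x. \<psi> n x - v x) + sob_norm L 1 (\<lambda>x. v x - \<psi>' m x)"
        by (intro sob_norm_diff_triangle lv lv' vL)
      then show ?thesis using N(2)[OF nm(1)] N(4)[OF nm(2)] sob_norm_diff_commute[OF vL(1) lv'(2)[of m], of 1] by linarith
    qed
    have b1: "sob_norm L 1 (\<psi> n) \<le> nv + 1"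
      using sob_norm_reverse[OF lv(1)[of n] vL(2) lv(2)[of n] vL(1)] N(2)[OF nm(1)] t(2) unfolding nv_def by linarith
    have b2: "sob_norm L 1 (\<phi>' m) \<le> nu + 1"
      using sob_norm_reverse[OF lu'(1)[of m] uL(2) lu'(2)[of m] uL(1)] N(3)[OF nm(2)] t(2) unfolding nu_def by linarith
    have eq: "mode_coeff k (convection (\<phi> n) (\<psi> n)) - mode_coeff k (convection (\<phi>' m) (\<psi>' m))
       = mode_coeff k (convection (\<lambda>x. \<phi> n x - \<phi>' m x) (\<psi> n)) + mode_coeff k (convection (\<phi>' m) (\<lambda>x. \<psi> n x - \<psi>' m x))"
      using lu(3)[of n] lu'(3)[of m] lv(3)[of n] lv'(3)[of m]
      by (simp add: mode_coeff_convection_diff_left mode_coeff_convection_diff_right sol_poly_trig)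
    have "cmod (mode_coeff k (convection (\<phi> n) (\<psi> n)) - mode_coeff k (convection (\<phi>' m) (\<psi>' m))) \<le> C * (sob_norm L 1 (\<lambda>x. \<phi> n x - \<phi>' m x) * sob_norm L 1 (\<psi> n))
        + C * (sob_norm L 1 (\<phi>' m) * sob_norm L 1 (\<lambda>x. \<psi> n x - \<psi>' m x))"
      unfolding C_def eq
      by (intro order_trans[OF norm_triangle_ineq] add_mono mode_coeff_convection_le sol_poly_diff lu lu' lv lv' k)
    also have "\<dots> \<le> C * (2 * t * (nv + 1)) + C * ((nu + 1) * (2 * t))"
      using C t nn by (intro add_mono mult_left_mono mult_mono d1 d2 b1 b2) (auto simp: sob_norm_nonneg)
    also have "\<dots> = 2 * C * (nu + nv + 2) * t" by (simp add: algebra_simps)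
    also have "\<dots> < e" by (rule t)
    finally show "cmod (mode_coeff k (convection (\<phi> n) (\<psi> n)) - mode_coeff k (convection (\<phi>' m) (\<psi>' m))) < e" .
  qed
qed

text \<open>A value of \<open>B\<close> on \<open>V\<close> is a functional rather than a field, so
  its coefficient is read off from the two pairings, combined as in
  \<open>mode_coeff_inner\<close>.\<close>

definition B_coeff :: "real^2 \<Rightarrow> field \<Rightarrow> field \<Rightarrow> complex" where
  "B_coeff k u v = (of_real (B_pairing L u v (cos_mode k)) - \<i> * of_real (B_pairing L u v (sin_mode k))) / of_real (L\<^sup>2)"

text \<open>Closeness of a pair of sequences to itself gives a limit, closeness to any other pair
  makes this limit common to all. Its real and imaginary parts are then the described values of the
  pairings.\<close>

lemma B_coeff_limit:
  assumes u: "u \<in> V L" and v: "v \<in> V L" and k: "k \<in> freqs L"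
    and l: "V_limit L \<phi> u" "V_limit L \<psi> v"
  shows "(\<lambda>n. mode_coeff k (convection (\<phi> n) (\<psi> n))) \<longlonglongrightarrow> B_coeff k u v"
proof -
  have "Cauchy (\<lambda>n. mode_coeff k (convection (\<phi> n) (\<psi> n)))"
    by (rule metric_CauchyI) (use V_limit_convection_close[OF u v k _ l l] in \<open>simp add: dist_norm\<close>)
  then obtain b where b: "(\<lambda>n. mode_coeff k (convection (\<phi> n) (\<psi> n))) \<longlonglongrightarrow> b"
    using Cauchy_convergent convergent_def by blast
  have b': "(\<lambda>n. mode_coeff k (convection (\<phi>' n) (\<psi>' n))) \<longlonglongrightarrow> b" if l': "V_limit L \<phi>' u" "V_limit L \<psi>' v" for \<phi>' \<psi>'
  proof -
    have "(\<lambda>n. mode_coeff k (convection (\<phi> n) (\<psi> n)) - mode_coeff k (convection (\<phi>' n) (\<psi>' n))) \<longlonglongrightarrow> 0"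
    proof (rule LIMSEQ_I)
      fix r :: real assume "r > 0"
      from V_limit_convection_close[OF u v k this l l']
      show "\<exists>no. \<forall>n\<ge>no. norm (mode_coeff k (convection (\<phi> n) (\<psi> n)) - mode_coeff k (convection (\<phi>' n) (\<psi>' n)) - 0) < r"
        by auto
    qed
    from tendsto_diff[OF b this] show ?thesis by simp
  qed
  have cL: "convection (\<phi>' n) (\<psi>' n) \<in> L2 L" if "V_limit L \<phi>' u" "V_limit L \<psi>' v" for \<phi>' \<psi>' n
    using V_limit_sob_finite(3)[OF u that(1)] V_limit_sob_finite(3)[OF v that(2)] by (intro convection_L2 sol_poly_trig)
  have "(\<lambda>n. L2_inner L (leray L (convection (\<phi>' n) (\<psi>' n))) (cos_mode k)) \<longlonglongrightarrow> L\<^sup>2 * Re b"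
    "(\<lambda>n. L2_inner L (leray L (convection (\<phi>' n) (\<psi>' n))) (sin_mode k)) \<longlonglongrightarrow> - (L\<^sup>2 * Im b)"
    if l': "V_limit L \<phi>' u" "V_limit L \<psi>' v" for \<phi>' \<psi>'
  proof -
    note c = cL[OF l'] and h = H_L2[OF leray_H[OF cL[OF l']]]
    show "(\<lambda>n. L2_inner L (leray L (convection (\<phi>' n) (\<psi>' n))) (cos_mode k)) \<longlonglongrightarrow> L\<^sup>2 * Re b"
      unfolding inner_cos_mode[OF h] leray_mode_coeff[OF c k] by (intro tendsto_intros b' l')
    show "(\<lambda>n. L2_inner L (leray L (convection (\<phi>' n) (\<psi>' n))) (sin_mode k)) \<longlonglongrightarrow> - (L\<^sup>2 * Im b)"
      unfolding inner_sin_mode[OF h] leray_mode_coeff[OF c k] by (intro tendsto_intros b' l')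
  qed
  note lim = this
  have "B_pairing L u v (cos_mode k) = L\<^sup>2 * Re b"
    unfolding B_pairing_def using lim(1) l LIMSEQ_unique by (intro the_equality) blast+
  moreover have "B_pairing L u v (sin_mode k) = - (L\<^sup>2 * Im b)"
    unfolding B_pairing_def using lim(2) l LIMSEQ_unique by (intro the_equality) blast+
  ultimately have "B_coeff k u v = b" using L_pos
    by (simp add: B_coeff_def complex_eq_iff Re_divide_of_real Im_divide_of_real del: of_real_power)
  then show ?thesis using b by simp
qed

lemma V_limit_norm:
  assumes u: "u \<in> V L" and v: "v \<in> V L" and l: "V_limit L \<phi> u" "V_limit L \<psi> v" and s: "s = 0 \<or> s = 1"
  shows "(\<lambda>n. sob_norm L s (\<lambda>x. \<phi> n x - \<psi> n x)) \<longlonglongrightarrow> sob_norm L s (\<lambda>x. u x - v x)"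
    and "(\<lambda>n. sob_norm L s (\<phi> n)) \<longlonglongrightarrow> sob_norm L s u"
proof -
  have Hs: "sob_finite s w" if "sob_finite 1 w" for w using that s sob_finite_0(1) by auto
  have lim0: "(\<lambda>n. sob_norm L s (\<lambda>x. p n x - w x)) \<longlonglongrightarrow> 0" if w: "w \<in> V L" and lw: "V_limit L p w" for p w
  proof (cases "s = 1")
    case True then show ?thesis using V_limit_sob_finite(5)[OF w lw] by simp
  next
    case False
    then have s0: "s = 0" using s by simp
    have "(\<lambda>n. L / (2 * pi) * sob_norm L 1 (\<lambda>x. p n x - w x)) \<longlonglongrightarrow> L / (2 * pi) * 0"
      by (intro tendsto_intros V_limit_sob_finite(5)[OF w lw])
    then have z: "(\<lambda>n. L / (2 * pi) * sob_norm L 1 (\<lambda>x. p n x - w x)) \<longlonglongrightarrow> 0" by simp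
    show ?thesis unfolding s0
      by (rule tendsto_sandwich[OF always_eventually always_eventually tendsto_const z])
         (use sob_finite_0(2)[OF V_limit_sob_finite(4)[OF w lw]] sob_norm_nonneg in blast)+
  qed
  note lu = V_limit_sob_finite[OF u l(1)] and lv = V_limit_sob_finite[OF v l(2)]
  note uL = V_L2[OF u] V_sob_finite[OF u] and vL = V_L2[OF v] V_sob_finite[OF v]
  show "(\<lambda>n. sob_norm L s (\<phi> n)) \<longlonglongrightarrow> sob_norm L s u"
  proof (rule LIM_zero_cancel, rule Lim_null_comparison[OF always_eventually lim0[OF u l(1)]], rule allI)
    fix n show "norm (sob_norm L s (\<phi> n) - sob_norm L s u) \<le> sob_norm L s (\<lambda>x. \<phi> n x - u x)"
      using sob_norm_reverse[OF Hs[OF lu(1)] Hs[OF uL(2)] lu(2) uL(1)] by simp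
  qed
  have z: "(\<lambda>n. sob_norm L s (\<lambda>x. \<phi> n x - u x) + sob_norm L s (\<lambda>x. \<psi> n x - v x)) \<longlonglongrightarrow> 0"
    using tendsto_add[OF lim0[OF u l(1)] lim0[OF v l(2)]] by simp
  show "(\<lambda>n. sob_norm L s (\<lambda>x. \<phi> n x - \<psi> n x)) \<longlonglongrightarrow> sob_norm L s (\<lambda>x. u x - v x)"
  proof (rule LIM_zero_cancel, rule Lim_null_comparison[OF always_eventually z], rule allI)
    fix n
    let ?a = "\<lambda>x. \<phi> n x - \<psi> n x" and ?b = "\<lambda>x. u x - v x"
    let ?c = "\<lambda>x. \<phi> n x - u x" and ?d = "\<lambda>x. \<psi> n x - v x"
    have i: "sob_finite s ?a" "sob_finite s ?b" "sob_finite s ?c" "sob_finite s ?d"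
      by (intro Hs sob_norm_diff(1) lu lv uL vL)+
    have m: "?a \<in> L2 L" "?b \<in> L2 L" "?c \<in> L2 L" "?d \<in> L2 L" by (intro L2_diff lu lv uL vL)+
    have "norm (sob_norm L s ?a - sob_norm L s ?b) \<le> sob_norm L s (\<lambda>x. ?a x - ?b x)"
      using sob_norm_reverse[OF i(1,2) m(1,2)] by simp
    also have "(\<lambda>x. ?a x - ?b x) = (\<lambda>x. ?c x - ?d x)" by (auto simp: algebra_simps)
    also have "sob_norm L s \<dots> \<le> sob_norm L s ?c + sob_norm L s ?d" by (rule sob_norm_diff(2)[OF i(3,4) m(3,4)])
    finally show "norm (sob_norm L s ?a - sob_norm L s ?b) \<le> sob_norm L s ?c + sob_norm L s ?d" .
  qed
qed

text \<open>For approximants the difference splits bilinearly into B(\<phi>, \<phi> - \<psi>) +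
  B(\<phi> - \<psi>, \<psi>). The difference occupies each slot once, so the H-norm bound needs both
  asymmetric cases of \<open>poly_estimates\<close>. Finiteness of \<open>F\<close> lets the bounds
  pass to the limit.\<close>

lemma B_coeff_estimates:
  assumes u: "u \<in> V L" and v: "v \<in> V L" and F: "finite F" "F \<subseteq> freqs L"
  defines "R \<equiv> sob_norm L 1 u + sob_norm L 1 v"
  shows "L2_set (\<lambda>k. norm k powr (- 1/4) * cmod (B_coeff k u u - B_coeff k v v)) F \<le> nonlin_const * R * sob_norm L 1 (\<lambda>x. u x - v x)"
    and "L2_set (\<lambda>k. lat_weight k * cmod (B_coeff k u u - B_coeff k v v)) F \<le> nonlin_const * R * sob_norm L 0 (\<lambda>x. u x - v x)"
proof -
  obtain \<phi> \<psi> where l: "V_limit L \<phi> u" "V_limit L \<psi> v" using V_limit_exists u v by blast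
  note lu = V_limit_sob_finite[OF u l(1)] and lv = V_limit_sob_finite[OF v l(2)]
  define T where "T n k = mode_coeff k (convection (\<phi> n) (\<phi> n)) - mode_coeff k (convection (\<psi> n) (\<psi> n))" for n k
  have Tlim: "(\<lambda>n. T n k) \<longlonglongrightarrow> B_coeff k u u - B_coeff k v v" if "k \<in> F" for k
    unfolding T_def using that F u v by (intro tendsto_diff B_coeff_limit l) auto
  have Teq: "T n k = mode_coeff k (convection (\<phi> n) (\<lambda>x. \<phi> n x - \<psi> n x)) + mode_coeff k (convection (\<lambda>x. \<phi> n x - \<psi> n x) (\<psi> n))" for n k
    unfolding T_def using lu(3)[of n] lv(3)[of n]
    by (simp add: mode_coeff_convection_diff_left mode_coeff_convection_diff_right sol_poly_trig)
  have tri: "L2_set (\<lambda>k. \<omega> k * cmod (T n k)) F \<le>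
      L2_set (\<lambda>k. \<omega> k * cmod (mode_coeff k (convection (\<phi> n) (\<lambda>x. \<phi> n x - \<psi> n x)))) F
    + L2_set (\<lambda>k. \<omega> k * cmod (mode_coeff k (convection (\<lambda>x. \<phi> n x - \<psi> n x) (\<psi> n)))) F" if "\<And>k. \<omega> k \<ge> 0" for \<omega> n
  proof -
    have "L2_set (\<lambda>k. \<omega> k * cmod (T n k)) F \<le> L2_set (\<lambda>k. \<omega> k * cmod (mode_coeff k (convection (\<phi> n) (\<lambda>x. \<phi> n x - \<psi> n x)))
        + \<omega> k * cmod (mode_coeff k (convection (\<lambda>x. \<phi> n x - \<psi> n x) (\<psi> n)))) F"
      unfolding Teq distrib_left[symmetric] using that
      by (intro L2_set_mono mult_left_mono norm_triangle_ineq) auto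
    from order_trans[OF this L2_set_triangle_ineq] show ?thesis .
  qed
  have lim: "(\<lambda>n. L2_set (\<lambda>k. \<omega> k * cmod (T n k)) F) \<longlonglongrightarrow> L2_set (\<lambda>k. \<omega> k * cmod (B_coeff k u u - B_coeff k v v)) F" for \<omega>
    unfolding L2_set_def by (intro tendsto_intros Tlim)
  have Rlim: "(\<lambda>n. nonlin_const * (sob_norm L 1 (\<phi> n) + sob_norm L 1 (\<psi> n)) * sob_norm L s (\<lambda>x. \<phi> n x - \<psi> n x))
      \<longlonglongrightarrow> nonlin_const * R * sob_norm L s (\<lambda>x. u x - v x)" if "s = 0 \<or> s = 1" for s
    unfolding R_def by (intro tendsto_intros V_limit_norm(1)[OF u v l that] V_limit_norm(2)[OF u u l(1) l(1)]
        V_limit_norm(2)[OF v v l(2) l(2)]) auto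
  show "L2_set (\<lambda>k. norm k powr (- 1/4) * cmod (B_coeff k u u - B_coeff k v v)) F \<le> nonlin_const * R * sob_norm L 1 (\<lambda>x. u x - v x)"
  proof (rule LIMSEQ_le[OF lim Rlim])
    have "L2_set (\<lambda>k. norm k powr (- 1/4) * cmod (T n k)) F
       \<le> nonlin_const * (sob_norm L 1 (\<phi> n) + sob_norm L 1 (\<psi> n)) * sob_norm L 1 (\<lambda>x. \<phi> n x - \<psi> n x)" for n
    proof -
      have "L2_set (\<lambda>k. norm k powr (- 1/4) * cmod (T n k)) F
          \<le> nonlin_const * sob_norm L 1 (\<phi> n) * sob_norm L 1 (\<lambda>x. \<phi> n x - \<psi> n x)
            + nonlin_const * sob_norm L 1 (\<lambda>x. \<phi> n x - \<psi> n x) * sob_norm L 1 (\<psi> n)"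
        by (rule order_trans[OF tri add_mono[OF
            poly_estimates(1)[OF lu(3) sol_poly_diff[OF lu(3) lv(3)] F]
            poly_estimates(1)[OF sol_poly_diff[OF lu(3) lv(3)] lv(3) F]]]) (rule powr_ge_zero)
      then show ?thesis by (simp only: distrib_left distrib_right mult_ac)
    qed
    then show "\<exists>N. \<forall>n\<ge>N. L2_set (\<lambda>k. norm k powr (- 1/4) * cmod (T n k)) F
       \<le> nonlin_const * (sob_norm L 1 (\<phi> n) + sob_norm L 1 (\<psi> n)) * sob_norm L 1 (\<lambda>x. \<phi> n x - \<psi> n x)"
      by blast
  qed simp
  show "L2_set (\<lambda>k. lat_weight k * cmod (B_coeff k u u - B_coeff k v v)) F \<le> nonlin_const * R * sob_norm L 0 (\<lambda>x. u x - v x)"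
  proof (rule LIMSEQ_le[OF lim Rlim])
    have "L2_set (\<lambda>k. lat_weight k * cmod (T n k)) F
       \<le> nonlin_const * (sob_norm L 1 (\<phi> n) + sob_norm L 1 (\<psi> n)) * sob_norm L 0 (\<lambda>x. \<phi> n x - \<psi> n x)" for n
    proof -
      have "L2_set (\<lambda>k. lat_weight k * cmod (T n k)) F
          \<le> nonlin_const * sob_norm L 1 (\<phi> n) * sob_norm L 0 (\<lambda>x. \<phi> n x - \<psi> n x)
            + nonlin_const * sob_norm L 0 (\<lambda>x. \<phi> n x - \<psi> n x) * sob_norm L 1 (\<psi> n)"
        by (rule order_trans[OF tri add_mono[OF
            poly_estimates(2)[OF lu(3) sol_poly_diff[OF lu(3) lv(3)] F]
            poly_estimates(3)[OF sol_poly_diff[OF lu(3) lv(3)] lv(3) F]]]) (rule lat_weight_nonneg)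
      then show ?thesis by (simp only: distrib_left distrib_right mult_ac)
    qed
    then show "\<exists>N. \<forall>n\<ge>N. L2_set (\<lambda>k. lat_weight k * cmod (T n k)) F
       \<le> nonlin_const * (sob_norm L 1 (\<phi> n) + sob_norm L 1 (\<psi> n)) * sob_norm L 0 (\<lambda>x. \<phi> n x - \<psi> n x)"
      by blast
  qed simp
qed

end

section \<open>Duhamel's formula\<close>

text \<open>The antiderivative is continuous up to the singularity at \<open>t\<close>, so the
  interior form of the fundamental theorem of calculus applies.\<close>

lemma kernel_integral:
  fixes s t :: real
  assumes "s \<le> t"
  shows "((\<lambda>r. (t - r) powr (- 7/8)) has_integral 8 * (t - s) powr (1/8)) {s..t}"
proof -
  have "((\<lambda>r. (t - r) powr (- 7/8)) has_integral (- 8 * (t - t) powr (1/8) - - 8 * (t - s) powr (1/8))) {s..t}"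
  proof (rule fundamental_theorem_of_calculus_interior[OF assms])
    show "continuous_on {s..t} (\<lambda>r. - 8 * (t - r) powr (1/8))"
      by (intro continuous_on_mult continuous_on_powr' continuous_intros) auto
    fix r assume "r \<in> {s<..<t}"
    then have "((\<lambda>r. - 8 * (t - r) powr (1/8)) has_real_derivative (t - r) powr (- 7/8)) (at r)"
      by (auto intro!: derivative_eq_intros)
    then show "((\<lambda>r. - 8 * (t - r) powr (1/8)) has_vector_derivative (t - r) powr (- 7/8)) (at r)"
      by (simp only: has_real_derivative_iff_has_vector_derivative)
  qed
  then show ?thesis by simp
qed

text \<open>Raise \<open>x / a \<le> exp (x / a)\<close> to the power \<open>a\<close>.\<close>

lemma powr_exp_le:
  fixes x a :: real
  assumes "x \<ge> 0" "a > 0"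
  shows "x powr a * exp (- x) \<le> a powr a"
proof -
  have "x / a \<le> exp (x / a)" using exp_ge_add_one_self[of "x / a"] by linarith
  then have "(x / a) powr a \<le> exp (x / a) powr a" using assms by (intro powr_mono2) auto
  also have "\<dots> = exp x" using assms(2) by (simp add: powr_def)
  finally have "x powr a \<le> a powr a * exp x" using assms by (simp add: powr_divide field_simps)
  then have "x powr a * exp (- x) \<le> (a powr a * exp x) * exp (- x)" by (intro mult_right_mono) auto
  also have "\<dots> = a powr a" by (simp add: exp_minus)
  finally show ?thesis .
qed

text \<open>Parabolic smoothing: \<open>2 * a\<close> derivatives cost the power \<open>- a\<close>
  of the elapsed time, uniformly in the frequency.\<close>

lemma heat_kernel_bound:
  fixes k \<nu> \<tau> a :: real
  assumes "k > 0" "\<nu> > 0" "\<tau> > 0" "a > 0"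
  shows "k powr (2 * a) * exp (- (\<nu> * k\<^sup>2 * \<tau>)) \<le> (a / \<nu>) powr a * \<tau> powr (- a)"
proof -
  have x: "(\<nu> * k\<^sup>2 * \<tau>) powr a = \<nu> powr a * k powr (2 * a) * \<tau> powr a"
    using assms by (simp add: powr_mult powr_powr flip: powr_numeral)
  have p: "\<nu> powr a > 0" "\<tau> powr a > 0" using assms by auto
  have "\<nu> powr a * k powr (2 * a) * \<tau> powr a * exp (- (\<nu> * k\<^sup>2 * \<tau>)) \<le> a powr a"
    using powr_exp_le[of "\<nu> * k\<^sup>2 * \<tau>" a] assms unfolding x by simp
  then have "k powr (2 * a) * exp (- (\<nu> * k\<^sup>2 * \<tau>)) \<le> a powr a / (\<nu> powr a * \<tau> powr a)"
    using p by (simp add: field_simps)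
  also have "\<dots> = (a / \<nu>) powr a * \<tau> powr (- a)"
    using assms by (simp add: powr_divide powr_minus field_simps)
  finally show ?thesis .
qed

text \<open>Continuity of the integrand makes \<open>c\<close> differentiable, and the integrand on
  the left is the derivative of minus \<open>exp (- (\<mu> * (t - r)))\<close> times
  \<open>c r\<close>.\<close>

lemma duhamel:
  fixes c n :: "real \<Rightarrow> complex" and \<mu> :: real
  assumes st: "s \<le> t" and cc: "continuous_on {s..t} c" and nc: "continuous_on {s..t} n"
    and eq: "\<And>r. r \<in> {s..t} \<Longrightarrow> c r = c s - integral {s..r} (\<lambda>q. of_real \<mu> * c q + n q)"
  shows "((\<lambda>r. of_real (exp (- (\<mu> * (t - r)))) * n r) has_integral (of_real (exp (- (\<mu> * (t - s)))) * c s - c t)) {s..t}"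
proof -
  have hc: "continuous_on {s..t} (\<lambda>q. of_real \<mu> * c q + n q)" by (intro continuous_intros cc nc)
  have d: "(c has_vector_derivative - (of_real \<mu> * c r + n r)) (at r within {s..t})" if r: "r \<in> {s..t}" for r
  proof -
    have "((\<lambda>r. c s - integral {s..r} (\<lambda>q. of_real \<mu> * c q + n q)) has_vector_derivative (0 - (of_real \<mu> * c r + n r))) (at r within {s..t})"
      by (intro has_vector_derivative_diff has_vector_derivative_const integral_has_vector_derivative hc r)
    then have "(c has_vector_derivative (0 - (of_real \<mu> * c r + n r))) (at r within {s..t})"
      by (rule has_vector_derivative_transform[OF r, rotated]) (rule eq)
    then show ?thesis by simp
  qed
  have "((\<lambda>r. of_real (exp (- (\<mu> * (t - r)))) * n r) has_integral
      (- (of_real (exp (- (\<mu> * (t - t)))) * c t) - - (of_real (exp (- (\<mu> * (t - s)))) * c s))) {s..t}"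
  proof (rule fundamental_theorem_of_calculus[OF st])
    fix r assume r: "r \<in> {s..t}"
    have e: "((\<lambda>r. complex_of_real (exp (- (\<mu> * (t - r))))) has_vector_derivative of_real (\<mu> * exp (- (\<mu> * (t - r))))) (at r within {s..t})"
    proof -
      have "((\<lambda>r. exp (- (\<mu> * (t - r)))) has_real_derivative \<mu> * exp (- (\<mu> * (t - r)))) (at r within {s..t})"
        by (auto intro!: derivative_eq_intros)
      then show ?thesis
        using bounded_linear.has_vector_derivative[OF bounded_linear_of_real]
        by (simp only: has_real_derivative_iff_has_vector_derivative)
    qed
    have "((\<lambda>r. - (of_real (exp (- (\<mu> * (t - r)))) * c r)) has_vector_derivative
       - (of_real (exp (- (\<mu> * (t - r)))) * (- (of_real \<mu> * c r + n r)) + of_real (\<mu> * exp (- (\<mu> * (t - r)))) * c r)) (at r within {s..t})"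
      by (intro has_vector_derivative_minus has_vector_derivative_mult e d r)
    then show "((\<lambda>r. - (of_real (exp (- (\<mu> * (t - r)))) * c r)) has_vector_derivative
       of_real (exp (- (\<mu> * (t - r)))) * n r) (at r within {s..t})"
      by (simp add: algebra_simps)
  qed
  then show ?thesis by simp
qed

lemma has_integral_norm_le:
  fixes f :: "real \<Rightarrow> complex"
  assumes "(f has_integral i) S" "(g has_integral j) S" "\<And>x. x \<in> S \<Longrightarrow> norm (f x) \<le> g x"
  shows "norm i \<le> j"
  using integral_norm_bound_integral[of f S g] assms
  by (simp add: has_integral_integrable integral_unique)

lemma has_integral_nonneg_half_open:
  fixes g :: "real \<Rightarrow> real"
  assumes "(g has_integral G) {s..t}" "\<And>r. s \<le> r \<Longrightarrow> r < t \<Longrightarrow> 0 \<le> g r"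
  shows "0 \<le> G"
proof (rule has_integral_nonneg)
  show "((\<lambda>r. if r = t then 0 else g r) has_integral G) {s..t}"
    by (rule has_integral_spike_finite[OF _ _ assms(1), of "{t}"]) auto
qed (use assms(2) in auto)

text \<open>A form of Minkowski's integral inequality, by duality: pairing the formula with the
  weighted conjugates \<open>p k\<close> of the coefficients at time \<open>t\<close> gives the
  square of the norm \<open>X\<close> on one side and \<open>X\<close> times the claimed bound on
  the other. The integrand is controlled only for \<open>r < t\<close>, since the kernels are
  singular at \<open>t\<close>.\<close>

lemma duhamel_L2_set:
  fixes c n :: "'k \<Rightarrow> real \<Rightarrow> complex" and \<mu> a :: "'k \<Rightarrow> real"
  assumes F: "finite F" and st: "s \<le> t" and m: "\<And>k. k \<in> F \<Longrightarrow> m \<le> \<mu> k"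
    and a: "\<And>k. a k \<ge> 0"
    and D: "\<And>k. k \<in> F \<Longrightarrow> ((\<lambda>r. of_real (exp (- (\<mu> k * (t - r)))) * n k r) has_integral
              (of_real (exp (- (\<mu> k * (t - s)))) * c k s - c k t)) {s..t}"
    and g: "(g has_integral G) {s..t}"
    and le: "\<And>r. s \<le> r \<Longrightarrow> r < t \<Longrightarrow> L2_set (\<lambda>k. a k * (exp (- (\<mu> k * (t - r))) * cmod (n k r))) F \<le> g r"
  shows "L2_set (\<lambda>k. a k * cmod (c k t)) F \<le> exp (- (m * (t - s))) * L2_set (\<lambda>k. a k * cmod (c k s)) F + G"
proof -
  define X where "X = L2_set (\<lambda>k. a k * cmod (c k t)) F"
  have X0: "X \<ge> 0" by (simp add: X_def)
  define p where "p k = complex_of_real ((a k)\<^sup>2) * cnj (c k t)" for k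
  have CS: "cmod (\<Sum>k\<in>F. p k * v k) \<le> X * L2_set (\<lambda>k. a k * cmod (v k)) F" for v
  proof -
    have "cmod (\<Sum>k\<in>F. p k * v k) \<le> (\<Sum>k\<in>F. \<bar>a k * cmod (c k t)\<bar> * \<bar>a k * cmod (v k)\<bar>)"
      by (rule order_trans[OF norm_sum]) (simp add: p_def norm_mult a power2_eq_square mult_ac)
    also have "\<dots> \<le> X * L2_set (\<lambda>k. a k * cmod (v k)) F" unfolding X_def by (rule L2_set_mult_ineq)
    finally show ?thesis .
  qed
  define I where "I r = (\<Sum>k\<in>F. p k * (of_real (exp (- (\<mu> k * (t - r)))) * n k r))" for r
  define J where "J = (\<Sum>k\<in>F. p k * (of_real (exp (- (\<mu> k * (t - s)))) * c k s - c k t))"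
  have IJ: "(I has_integral J) {s..t}"
    unfolding I_def[abs_def] J_def by (intro has_integral_sum F has_integral_mult_right D)
  have "norm J \<le> X * G"
  proof -
    \<comment> \<open>Redefinition at the single point \<open>t\<close> gives a majorant on the
      closed interval without changing the integral.\<close>
    define g' where "g' r = (if r = t then cmod (I t) else X * g r)" for r
    have "((\<lambda>r. X * g r) has_integral X * G) {s..t}" using has_integral_mult_right[OF g, of X] by simp
    then have g': "(g' has_integral X * G) {s..t}"
      by (rule has_integral_spike_finite[of "{t}", rotated 2]) (auto simp: g'_def)
    show ?thesis
    proof (rule has_integral_norm_le[OF IJ g'])
      fix r assume r: "r \<in> {s..t}"
      show "norm (I r) \<le> g' r"
      proof (cases "r = t")
        case False
        then have rt: "s \<le> r" "r < t" using r by auto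
        have "norm (I r) \<le> X * L2_set (\<lambda>k. a k * cmod (of_real (exp (- (\<mu> k * (t - r)))) * n k r)) F"
          unfolding I_def by (rule CS)
        also have "\<dots> = X * L2_set (\<lambda>k. a k * (exp (- (\<mu> k * (t - r))) * cmod (n k r))) F"
          by (simp add: norm_mult)
        also have "\<dots> \<le> X * g r" by (intro mult_left_mono le rt X0)
        finally show ?thesis using False by (simp add: g'_def)
      qed (simp add: g'_def)
    qed
  qed
  note J = this
  have "complex_of_real (X\<^sup>2) = (\<Sum>k\<in>F. p k * c k t)"
    unfolding X_def L2_set_def p_def
    by (simp add: sum_nonneg power_mult_distrib mult.assoc complex_norm_square mult.commute[of "cnj _"] del: of_real_power)
  also have "\<dots> = (\<Sum>k\<in>F. p k * (of_real (exp (- (\<mu> k * (t - s)))) * c k s)) - J"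
    unfolding J_def by (simp add: sum_subtractf[symmetric] algebra_simps)
  finally have "cmod (complex_of_real (X\<^sup>2)) \<le> cmod (\<Sum>k\<in>F. p k * (of_real (exp (- (\<mu> k * (t - s)))) * c k s)) + cmod J"
    using norm_triangle_ineq4 by metis
  also have "cmod (\<Sum>k\<in>F. p k * (of_real (exp (- (\<mu> k * (t - s)))) * c k s))
     \<le> X * L2_set (\<lambda>k. a k * cmod (of_real (exp (- (\<mu> k * (t - s)))) * c k s)) F" by (rule CS)
  also have "\<dots> \<le> X * (exp (- (m * (t - s))) * L2_set (\<lambda>k. a k * cmod (c k s)) F)"
  proof (intro mult_left_mono X0)
    have "L2_set (\<lambda>k. a k * cmod (of_real (exp (- (\<mu> k * (t - s)))) * c k s)) F
       \<le> L2_set (\<lambda>k. exp (- (m * (t - s))) * (a k * cmod (c k s))) F"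
    proof (intro L2_set_mono)
      fix k assume k: "k \<in> F"
      have "exp (- (\<mu> k * (t - s))) \<le> exp (- (m * (t - s)))"
        using m[OF k] st by (auto intro!: mult_right_mono)
      then have "exp (- (\<mu> k * (t - s))) * (a k * cmod (c k s)) \<le> exp (- (m * (t - s))) * (a k * cmod (c k s))"
        using a by (intro mult_right_mono) auto
      then show "a k * cmod (of_real (exp (- (\<mu> k * (t - s)))) * c k s) \<le> exp (- (m * (t - s))) * (a k * cmod (c k s))"
        by (simp add: norm_mult mult_ac)
    qed (simp add: a)
    also have "\<dots> = exp (- (m * (t - s))) * L2_set (\<lambda>k. a k * cmod (c k s)) F"
      by (rule L2_set_right_distrib[symmetric]) simp
    finally show "L2_set (\<lambda>k. a k * cmod (of_real (exp (- (\<mu> k * (t - s)))) * c k s)) F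
       \<le> exp (- (m * (t - s))) * L2_set (\<lambda>k. a k * cmod (c k s)) F" .
  qed
  finally have fin: "cmod (complex_of_real (X\<^sup>2)) \<le> X * (exp (- (m * (t - s))) * L2_set (\<lambda>k. a k * cmod (c k s)) F) + cmod J"
    by simp
  moreover have "cmod (complex_of_real (X\<^sup>2)) = X * X" unfolding norm_of_real by (simp add: power2_eq_square)
  ultimately have "X * X \<le> X * (exp (- (m * (t - s))) * L2_set (\<lambda>k. a k * cmod (c k s)) F + G)"
    using J unfolding distrib_left by linarith
  moreover have "G \<ge> 0"
  proof (rule has_integral_nonneg_half_open[OF g])
    fix r assume "s \<le> r" "r < t"
    from le[OF this] show "0 \<le> g r" using L2_set_nonneg order_trans by blast
  qed
  moreover have "0 \<le> exp (- (m * (t - s))) * L2_set (\<lambda>k. a k * cmod (c k s)) F" by simp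
  ultimately show ?thesis using X0 unfolding X_def[symmetric]
    by (cases "X = 0") (auto simp: mult_le_cancel_left)
qed

text \<open>At the first time where \<open>y\<close> reaches \<open>B\<close>, continuity gives
  equality. The weak bound then holds up to that time, and \<open>step\<close> makes it strict
  there, a contradiction.\<close>

lemma bootstrap:
  fixes y :: "real \<Rightarrow> real"
  assumes c: "continuous_on {s..e} y" and s: "y s < B"
    and step: "\<And>t. t \<in> {s..e} \<Longrightarrow> (\<And>r. r \<in> {s..t} \<Longrightarrow> y r \<le> B) \<Longrightarrow> y t < B"
    and t: "t \<in> {s..e}"
  shows "y t < B"
proof (rule ccontr)
  assume n: "\<not> y t < B"
  define T where "T = {r \<in> {s..e}. B \<le> y r}"
  have "closed T" unfolding T_def
    by (intro continuous_on_closed_Collect_le continuous_on_const c) simp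
  moreover have "T \<subseteq> {s..e}" by (auto simp: T_def)
  ultimately have "compact T" using compact_Int_closed[OF compact_Icc, of T s e] by (simp add: Int_absorb1)
  moreover have "T \<noteq> {}" using n t by (auto simp: T_def)
  ultimately have "\<exists>t1\<in>T. \<forall>r\<in>T. t1 \<le> r" by (rule compact_attains_inf)
  then obtain t1 where t1: "t1 \<in> T" "\<And>r. r \<in> T \<Longrightarrow> t1 \<le> r" by blast
  have t1': "t1 \<in> {s..e}" "B \<le> y t1" using t1(1) by (auto simp: T_def)
  have "y t1 \<le> B"
  proof -
    have "\<exists>r\<ge>s. r \<le> t1 \<and> y r = B"
      using t1' s by (intro IVT' continuous_on_subset[OF c]) auto
    then obtain r where r: "s \<le> r" "r \<le> t1" "y r = B" by blast
    then have "r \<in> T" using t1' by (auto simp: T_def)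
    then show ?thesis using t1(2)[of r] r by auto
  qed
  then have "y r \<le> B" if "r \<in> {s..t1}" for r
  proof (cases "r = t1")
    case False
    then have "r \<notin> T" using t1(2)[of r] that by auto
    then show ?thesis using that t1'(1) by (auto simp: T_def)
  qed (use \<open>y t1 \<le> B\<close> in simp)
  then have "y t1 < B" by (rule step[OF t1'(1)])
  then show False using t1' by simp
qed

section \<open>The equation for the difference of two solutions\<close>

lemma AE_lebesgue_on_subset:
  assumes "AE x in lebesgue_on S. P x" "T \<subseteq> S" "S \<in> sets lebesgue" "T \<in> sets lebesgue"
  shows "AE x in lebesgue_on T. P x"
  using assms by (auto simp: AE_restrict_space_iff elim!: eventually_mono)

context torus begin

lemma nse_V: "nse_solution L \<nu> f s u \<Longrightarrow> t \<ge> s \<Longrightarrow> u t \<in> V L"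
  by (simp add: nse_solution_def)

lemma nse_tendsto:
  "nse_solution L \<nu> f s u \<Longrightarrow> t \<ge> s \<Longrightarrow> ((\<lambda>r. sob_norm L 1 (\<lambda>x. u r x - u t x)) \<longlongrightarrow> 0) (at t within {s..})"
  by (simp add: nse_solution_def)

lemma continuous_on_null_comparison:
  fixes h :: "real \<Rightarrow> 'b::real_normed_vector"
  assumes "\<And>t. t \<ge> s \<Longrightarrow> (g t \<longlongrightarrow> 0) (at t within {s..})"
    and "\<And>t r. t \<ge> s \<Longrightarrow> r \<ge> s \<Longrightarrow> norm (h r - h t) \<le> g t r"
  shows "continuous_on {s..} h"
  unfolding continuous_on_def
proof
  fix t assume t: "t \<in> {s..}"
  have "eventually (\<lambda>r. norm (h r - h t) \<le> g t r) (at t within {s..})"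
    using assms(2)[of t] t by (auto simp: eventually_at_filter)
  from Lim_null_comparison[OF this assms(1)] t have "((\<lambda>r. h r - h t) \<longlongrightarrow> 0) (at t within {s..})" by simp
  then show "(h \<longlongrightarrow> h t) (at t within {s..})" by (rule LIM_zero_cancel)
qed

lemma nse_sob_norm_tendsto:
  assumes u: "nse_solution L \<nu> f s u" and t: "t \<ge> s"
  shows "((\<lambda>r. sob_norm L 1 (u r)) \<longlongrightarrow> sob_norm L 1 (u t)) (at t within {s..})"
proof -
  have "continuous_on {s..} (\<lambda>r. sob_norm L 1 (u r))"
  proof (rule continuous_on_null_comparison[OF nse_tendsto[OF u]])
    fix t r assume "t \<ge> s" "r \<ge> s"
    then have "u t \<in> V L" "u r \<in> V L" using nse_V[OF u] by auto
    then show "norm (sob_norm L 1 (u r) - sob_norm L 1 (u t)) \<le> sob_norm L 1 (\<lambda>x. u r x - u t x)"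
      using sob_norm_reverse V_sob_finite V_L2 by simp
  qed
  then show ?thesis using t by (simp add: continuous_on_def)
qed

lemma nse_mode_coeff_continuous:
  assumes u: "nse_solution L \<nu> f s u" and k: "k \<in> freqs L"
  shows "continuous_on {s..} (\<lambda>r. mode_coeff k (u r))"
proof (rule continuous_on_null_comparison)
  show "((\<lambda>r. sob_norm L 1 (\<lambda>x. u r x - u t x) / L / norm k) \<longlongrightarrow> 0) (at t within {s..})" if "t \<ge> s" for t
    using tendsto_divide_zero[OF tendsto_divide_zero[OF nse_tendsto[OF u that]]] .
  fix t r assume "t \<ge> s" "r \<ge> s"
  then have v: "u t \<in> V L" "u r \<in> V L" using nse_V[OF u] by auto
  have d: "(\<lambda>x. u r x - u t x) \<in> V L" by (rule V_diff[OF v(2,1)])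
  have "cmod (mode_coeff k (u r) - mode_coeff k (u t)) \<le> norm (fourier_coeff L (\<lambda>x. u r x - u t x) k)"
    unfolding mode_coeff_diff[OF V_L2[OF v(2)] V_L2[OF v(1)], symmetric] by (rule mode_coeff_le[OF freqs_nz[OF k]])
  also have "\<dots> \<le> sob_norm L 1 (\<lambda>x. u r x - u t x) / L / norm k"
  proof -
    have "norm k * norm (fourier_coeff L (\<lambda>x. u r x - u t x) k) \<le> sob_norm L 1 (\<lambda>x. u r x - u t x) / L"
      using norm_fc_le_sob[OF V_sob_finite[OF d] k] by simp
    then show ?thesis using freqs_norm_pos[OF k] by (simp only: pos_le_divide_eq mult.commute)
  qed
  finally show "norm (mode_coeff k (u r) - mode_coeff k (u t)) \<le> sob_norm L 1 (\<lambda>x. u r x - u t x) / L / norm k" .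
qed

text \<open>The difference estimate of \<open>B\<close>, applied to two times of one solution and to
  a single frequency.\<close>

lemma nse_B_coeff_continuous:
  assumes u: "nse_solution L \<nu> f s u" and k: "k \<in> freqs L"
  shows "continuous_on {s..} (\<lambda>r. B_coeff k (u r) (u r))"
proof (rule continuous_on_null_comparison)
  show "((\<lambda>r. norm k powr (1/4) * (nonlin_const * (sob_norm L 1 (u r) + sob_norm L 1 (u t)) * sob_norm L 1 (\<lambda>x. u r x - u t x))) \<longlongrightarrow> 0) (at t within {s..})"
    if "t \<ge> s" for t
  proof -
    have "((\<lambda>r. norm k powr (1/4) * (nonlin_const * (sob_norm L 1 (u r) + sob_norm L 1 (u t)) * sob_norm L 1 (\<lambda>x. u r x - u t x)))
      \<longlongrightarrow> norm k powr (1/4) * (nonlin_const * (sob_norm L 1 (u t) + sob_norm L 1 (u t)) * 0)) (at t within {s..})"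
      by (intro tendsto_intros nse_tendsto[OF u that] nse_sob_norm_tendsto[OF u that])
    then show ?thesis by simp
  qed
  fix t r assume "t \<ge> s" "r \<ge> s"
  then have v: "u t \<in> V L" "u r \<in> V L" using nse_V[OF u] by auto
  have "norm k powr (- 1/4) * cmod (B_coeff k (u r) (u r) - B_coeff k (u t) (u t)) \<le> nonlin_const * (sob_norm L 1 (u r) + sob_norm L 1 (u t)) * sob_norm L 1 (\<lambda>x. u r x - u t x)"
    using B_coeff_estimates(1)[OF v(2,1), of "{k}"] k by (simp add: L2_set_def real_sqrt_mult real_sqrt_abs)
  then have "norm k powr (1/4) * (norm k powr (- 1/4) * cmod (B_coeff k (u r) (u r) - B_coeff k (u t) (u t)))
     \<le> norm k powr (1/4) * (nonlin_const * (sob_norm L 1 (u r) + sob_norm L 1 (u t)) * sob_norm L 1 (\<lambda>x. u r x - u t x))"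
    by (intro mult_left_mono) auto
  moreover have "norm k powr (1/4) * norm k powr (- 1/4) = 1"
    using freqs_norm_pos[OF k] by (simp flip: powr_add)
  ultimately show "norm (B_coeff k (u r) (u r) - B_coeff k (u t) (u t)) \<le> norm k powr (1/4) * (nonlin_const * (sob_norm L 1 (u r) + sob_norm L 1 (u t)) * sob_norm L 1 (\<lambda>x. u r x - u t x))"
    by (simp only: mult.assoc[symmetric] mult_1)
qed

lemma forcing_integrable:
  assumes f: "Linf_H L t0 f" and w: "w \<in> H L" and s: "t0 \<le> s"
  shows "integrable (lebesgue_on {s..t}) (\<lambda>r. L2_inner L (f r) w)"
proof -
  have m: "(\<lambda>r. L2_inner L (f r) w) \<in> borel_measurable (lebesgue_on {t0..})"
    using f w by (auto simp: Linf_H_def)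
  obtain B where B: "AE r in lebesgue_on {t0..}. f r \<in> H L \<and> L2_norm L (f r) \<le> B"
    using f by (auto simp: Linf_H_def)
  have st: "{s..t} \<subseteq> {t0..}" using s by auto
  have B': "AE r in lebesgue_on {s..t}. f r \<in> H L \<and> L2_norm L (f r) \<le> B"
    by (rule AE_lebesgue_on_subset[OF B st]) auto
  show ?thesis
  proof (rule Bochner_Integration.integrable_bound)
    show "integrable (lebesgue_on {s..t}) (\<lambda>r. B * L2_norm L w)"
      by (intro continuous_imp_integrable_real continuous_on_const)
    show "(\<lambda>r. L2_inner L (f r) w) \<in> borel_measurable (lebesgue_on {s..t})"
      using measurable_restrict_mono[OF m st] .
    show "AE r in lebesgue_on {s..t}. norm (L2_inner L (f r) w) \<le> norm (B * L2_norm L w)"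
      using B'
    proof eventually_elim
      fix r assume r: "f r \<in> H L \<and> L2_norm L (f r) \<le> B"
      have "\<bar>L2_inner L (f r) w\<bar> \<le> L2_norm L (f r) * L2_norm L w"
        using r w by (intro L2_Cauchy_Schwarz H_L2) auto
      also have "\<dots> \<le> B * L2_norm L w" using r by (intro mult_right_mono L2_norm_nonneg) auto
      finally show "norm (L2_inner L (f r) w) \<le> norm (B * L2_norm L w)" by simp
    qed
  qed
qed

text \<open>The equation is given from the initial time \<open>s0\<close> only, whereas a cycle
  begins later; its instances at \<open>s\<close> and \<open>t\<close> are subtracted. Splitting the
  Lebesgue integrals needs integrability, supplied by \<open>h\<close> for the solution terms and by
  \<open>forcing_integrable\<close> for the forcing.\<close>

lemma nse_increment:
  assumes u: "nse_solution L \<nu> f s0 u" and f: "Linf_H L s0 f" and st: "s0 \<le> s" "s \<le> t"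
    and w: "w \<in> V L" and h: "continuous_on {s0..} (\<lambda>r. \<nu> * A_pairing L (u r) w + B_pairing L (u r) (u r) w)"
  shows "((\<lambda>r. \<nu> * A_pairing L (u r) w + B_pairing L (u r) (u r) w) has_integral
     (L2_inner L (u s) w - L2_inner L (u t) w + (\<integral>r. L2_inner L (f r) w \<partial>lebesgue_on {s..t}))) {s..t}"
proof -
  let ?h = "\<lambda>r. \<nu> * A_pairing L (u r) w + B_pairing L (u r) (u r) w"
  have eq: "L2_inner L (u r) w + (\<integral>q. ?h q \<partial>lebesgue_on {s0..r}) = L2_inner L (u s0) w + (\<integral>q. L2_inner L (f q) w \<partial>lebesgue_on {s0..r})"
    if "r \<ge> s0" for r using u w that unfolding nse_solution_def by blast
  have hi: "integrable (lebesgue_on {p..q}) ?h" if "s0 \<le> p" for p q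
    by (intro continuous_imp_integrable_real continuous_on_subset[OF h]) (use that in auto)
  have 1: "(\<integral>q. ?h q \<partial>lebesgue_on {s0..t}) = (\<integral>q. ?h q \<partial>lebesgue_on {s0..s}) + (\<integral>q. ?h q \<partial>lebesgue_on {s..t})"
    using st by (intro Equivalence_Measurable_On_Borel.integral_combine hi) auto
  have 2: "(\<integral>q. L2_inner L (f q) w \<partial>lebesgue_on {s0..t}) = (\<integral>q. L2_inner L (f q) w \<partial>lebesgue_on {s0..s}) + (\<integral>q. L2_inner L (f q) w \<partial>lebesgue_on {s..t})"
    using st by (intro Equivalence_Measurable_On_Borel.integral_combine forcing_integrable[OF f V_H[OF w]]) auto
  have "(?h has_integral (\<integral>q. ?h q \<partial>lebesgue_on {s..t})) {s..t}"
    by (rule has_integral_integral_lebesgue_on[OF hi[OF st(1)]]) auto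
  moreover have "(\<integral>q. ?h q \<partial>lebesgue_on {s..t}) = L2_inner L (u s) w - L2_inner L (u t) w + (\<integral>r. L2_inner L (f r) w \<partial>lebesgue_on {s..t})"
    using eq[of s] eq[of t] 1 2 st by simp
  ultimately show ?thesis by simp
qed

lemma Linf_H_mono: assumes "Linf_H L t0 f" "t0 \<le> s" shows "Linf_H L s f"
proof -
  have st: "{s..} \<subseteq> {t0..}" using assms(2) by auto
  obtain B where B: "AE r in lebesgue_on {t0..}. f r \<in> H L \<and> L2_norm L (f r) \<le> B"
    using assms by (auto simp: Linf_H_def)
  have "AE r in lebesgue_on {s..}. f r \<in> H L \<and> L2_norm L (f r) \<le> B"
    by (rule AE_lebesgue_on_subset[OF B st]) auto
  moreover have "(\<lambda>r. L2_inner L (f r) w) \<in> borel_measurable (lebesgue_on {s..})" if "w \<in> H L" for w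
    using assms(1) that measurable_restrict_mono[OF _ st] by (auto simp: Linf_H_def)
  ultimately show ?thesis unfolding Linf_H_def by blast
qed

text \<open>The cosine and sine equations combined as in \<open>mode_coeff_inner\<close>. The
  forcing is kept as a bare integral, in the same form for every solution, so that it cancels
  between two of them.\<close>

lemma nse_mode_increment:
  assumes u: "nse_solution L \<nu> f s0 u" and f: "Linf_H L s0 f" and st: "s0 \<le> s" "s \<le> t" and k: "k \<in> freqs L"
  shows "((\<lambda>r. of_real (\<nu> * (norm k)\<^sup>2) * mode_coeff k (u r) + B_coeff k (u r) (u r)) has_integral
     (mode_coeff k (u s) - mode_coeff k (u t) + (of_real (\<integral>r. L2_inner L (f r) (cos_mode k) \<partial>lebesgue_on {s..t})
        - \<i> * of_real (\<integral>r. L2_inner L (f r) (sin_mode k) \<partial>lebesgue_on {s..t})) / of_real (L\<^sup>2))) {s..t}"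
proof -
  have V: "cos_mode k \<in> V L" "sin_mode k \<in> V L" using modes_sol_poly[OF k] sol_poly_V by auto
  have ctf: "continuous_on {s0..} (\<lambda>r. mode_coeff k (u r))" and cBT: "continuous_on {s0..} (\<lambda>r. B_coeff k (u r) (u r))"
    using nse_mode_coeff_continuous[OF u k] nse_B_coeff_continuous[OF u k] .
  have BTc: "B_pairing L a b (cos_mode k) = L\<^sup>2 * Re (B_coeff k a b)" "B_pairing L a b (sin_mode k) = - (L\<^sup>2 * Im (B_coeff k a b))" for a b
    using L_pos by (simp_all add: B_coeff_def Re_divide_of_real Im_divide_of_real del: of_real_power)
  have Ac: "A_pairing L (u r) (cos_mode k) = (norm k)\<^sup>2 * (L\<^sup>2 * Re (mode_coeff k (u r)))"
     "A_pairing L (u r) (sin_mode k) = - ((norm k)\<^sup>2 * (L\<^sup>2 * Im (mode_coeff k (u r))))" if "r \<ge> s0" for r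
    using A_pairing_modes[OF nse_V[OF u that] k] inner_cos_mode[OF V_L2[OF nse_V[OF u that]]] inner_sin_mode[OF V_L2[OF nse_V[OF u that]]]
    by simp_all
  have "continuous_on {s0..} (\<lambda>r. \<nu> * ((norm k)\<^sup>2 * (L\<^sup>2 * Re (mode_coeff k (u r)))) + L\<^sup>2 * Re (B_coeff k (u r) (u r)))"
    by (intro continuous_intros ctf cBT)
  then have c1: "continuous_on {s0..} (\<lambda>r. \<nu> * A_pairing L (u r) (cos_mode k) + B_pairing L (u r) (u r) (cos_mode k))"
    by (rule continuous_on_eq) (simp add: Ac BTc)
  have "continuous_on {s0..} (\<lambda>r. \<nu> * - ((norm k)\<^sup>2 * (L\<^sup>2 * Im (mode_coeff k (u r)))) + - (L\<^sup>2 * Im (B_coeff k (u r) (u r))))"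
    by (intro continuous_intros ctf cBT)
  then have c2: "continuous_on {s0..} (\<lambda>r. \<nu> * A_pairing L (u r) (sin_mode k) + B_pairing L (u r) (u r) (sin_mode k))"
    by (rule continuous_on_eq) (simp add: Ac BTc)
  note i1 = has_integral_of_real[OF nse_increment[OF u f st V(1) c1], where 'b=complex]
  note i2 = has_integral_of_real[OF nse_increment[OF u f st V(2) c2], where 'b=complex]
  note i = has_integral_mult_right[OF has_integral_diff[OF i1 has_integral_mult_right[OF i2, of \<i>]], of "1 / of_real (L\<^sup>2)"]
  have Lne: "complex_of_real (L\<^sup>2) \<noteq> 0" using L_pos by simp
  have "s \<ge> s0" "t \<ge> s0" using st by auto
  note in1 = mode_coeff_inner[OF V_L2[OF nse_V[OF u this(1)]], of k] mode_coeff_inner[OF V_L2[OF nse_V[OF u this(2)]], of k]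
  show ?thesis
  proof (rule has_integral_eq_rhs[OF has_integral_eq[OF _ i]])
    fix r assume "r \<in> {s..t}"
    then have r: "r \<ge> s0" using st by auto
    show "1 / of_real (L\<^sup>2) * (complex_of_real (\<nu> * A_pairing L (u r) (cos_mode k) + B_pairing L (u r) (u r) (cos_mode k))
      - \<i> * complex_of_real (\<nu> * A_pairing L (u r) (sin_mode k) + B_pairing L (u r) (u r) (sin_mode k)))
      = of_real (\<nu> * (norm k)\<^sup>2) * mode_coeff k (u r) + B_coeff k (u r) (u r)"
    proof -
      have "complex_of_real (\<nu> * A_pairing L (u r) (cos_mode k) + B_pairing L (u r) (u r) (cos_mode k))
        - \<i> * complex_of_real (\<nu> * A_pairing L (u r) (sin_mode k) + B_pairing L (u r) (u r) (sin_mode k))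
        = of_real (L\<^sup>2) * (of_real (\<nu> * (norm k)\<^sup>2) * mode_coeff k (u r) + B_coeff k (u r) (u r))"
        by (simp add: Ac[OF r] BTc complex_eq_iff algebra_simps del: of_real_power)
      then show ?thesis using Lne by (simp del: of_real_power)
    qed
  next
    show "mode_coeff k (u s) - mode_coeff k (u t) + (of_real (\<integral>r. L2_inner L (f r) (cos_mode k) \<partial>lebesgue_on {s..t})
        - \<i> * of_real (\<integral>r. L2_inner L (f r) (sin_mode k) \<partial>lebesgue_on {s..t})) / of_real (L\<^sup>2)
      = 1 / of_real (L\<^sup>2) * (complex_of_real (L2_inner L (u s) (cos_mode k) - L2_inner L (u t) (cos_mode k) + (\<integral>r. L2_inner L (f r) (cos_mode k) \<partial>lebesgue_on {s..t}))
       - \<i> * complex_of_real (L2_inner L (u s) (sin_mode k) - L2_inner L (u t) (sin_mode k) + (\<integral>r. L2_inner L (f r) (sin_mode k) \<partial>lebesgue_on {s..t})))"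
      unfolding in1 using Lne by (simp add: field_simps del: of_real_power)
  qed
qed

end

text \<open>One cycle of the algorithm: \<open>s\<close> is the restart time and \<open>S\<close>
  the trajectory issuing from it. Nothing is assumed on the restarted state; it enters later through
  the norms of the difference at time \<open>s\<close>.\<close>

locale two_solutions = torus +
  fixes \<nu> t0 s :: real and f U S :: "real \<Rightarrow> field"
  assumes \<nu>_pos: "\<nu> > 0" and f: "Linf_H L t0 f" and t0s: "t0 \<le> s"
    and U: "nse_solution L \<nu> f t0 U" and S: "nse_solution L \<nu> f s S"
begin

definition w :: "real \<Rightarrow> field" where "w t = (\<lambda>x. U t x - S t x)"
definition y :: "real \<Rightarrow> real" where "y t = sob_norm L 1 (w t)"
definition z :: "real \<Rightarrow> real" where "z t = sob_norm L 0 (w t)"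
definition nonlin_diff :: "real^2 \<Rightarrow> real \<Rightarrow> complex" where "nonlin_diff k t = B_coeff k (U t) (U t) - B_coeff k (S t) (S t)"

lemma UV: "t \<ge> s \<Longrightarrow> U t \<in> V L" and SV: "t \<ge> s \<Longrightarrow> S t \<in> V L"
  using nse_V[OF U] nse_V[OF S] t0s by auto

lemma wV: "t \<ge> s \<Longrightarrow> w t \<in> V L" unfolding w_def by (intro V_diff UV SV)

lemma y_nonneg: "y t \<ge> 0" and z_nonneg: "z t \<ge> 0" by (simp_all add: y_def z_def sob_norm_nonneg)

lemma y_continuous: "continuous_on {s..} y"
proof (rule continuous_on_null_comparison)
  show "((\<lambda>r. sob_norm L 1 (\<lambda>x. U r x - U t x) + sob_norm L 1 (\<lambda>x. S r x - S t x)) \<longlongrightarrow> 0) (at t within {s..})"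
    if t: "t \<ge> s" for t
  proof -
    have "((\<lambda>r. sob_norm L 1 (\<lambda>x. U r x - U t x)) \<longlongrightarrow> 0) (at t within {s..})"
      by (rule tendsto_within_subset[OF nse_tendsto[OF U]]) (use t t0s in auto)
    from tendsto_add[OF this nse_tendsto[OF S t]] show ?thesis by simp
  qed
  fix t r assume tr: "t \<ge> s" "r \<ge> s"
  note v = UV[OF tr(1)] UV[OF tr(2)] SV[OF tr(1)] SV[OF tr(2)] wV[OF tr(1)] wV[OF tr(2)]
  have d: "(\<lambda>x. U r x - U t x) \<in> V L" "(\<lambda>x. S r x - S t x) \<in> V L" by (intro V_diff v)+
  have "norm (y r - y t) \<le> sob_norm L 1 (\<lambda>x. w r x - w t x)"
    unfolding y_def using sob_norm_reverse[OF V_sob_finite[OF v(6)] V_sob_finite[OF v(5)] V_L2[OF v(6)] V_L2[OF v(5)]] by simp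
  also have "(\<lambda>x. w r x - w t x) = (\<lambda>x. (U r x - U t x) - (S r x - S t x))" by (auto simp: w_def algebra_simps)
  also have "sob_norm L 1 \<dots> \<le> sob_norm L 1 (\<lambda>x. U r x - U t x) + sob_norm L 1 (\<lambda>x. S r x - S t x)"
    by (intro sob_norm_diff V_sob_finite V_L2 d)
  finally show "norm (y r - y t) \<le> sob_norm L 1 (\<lambda>x. U r x - U t x) + sob_norm L 1 (\<lambda>x. S r x - S t x)" .
qed

lemma tfw: "t \<ge> s \<Longrightarrow> mode_coeff k (w t) = mode_coeff k (U t) - mode_coeff k (S t)"
  unfolding w_def by (intro mode_coeff_diff V_L2 UV SV)

text \<open>A mode of one solution is driven by a forcing that is only measurable in time. In the
  difference the forcing integrals over the same interval cancel, and \<open>nonlin_diff\<close> is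
  continuous, as \<open>duhamel\<close> requires.\<close>

lemma mode_duhamel:
  assumes k: "k \<in> freqs L" and t: "s \<le> t"
  shows "((\<lambda>r. of_real (exp (- (\<nu> * (norm k)\<^sup>2 * (t - r)))) * nonlin_diff k r) has_integral
     (of_real (exp (- (\<nu> * (norm k)\<^sup>2 * (t - s)))) * mode_coeff k (w s) - mode_coeff k (w t))) {s..t}"
proof (rule duhamel[OF t])
  have cU: "continuous_on {s..t} (\<lambda>r. mode_coeff k (U r))" "continuous_on {s..t} (\<lambda>r. B_coeff k (U r) (U r))"
    by (rule continuous_on_subset[OF nse_mode_coeff_continuous[OF U k]] continuous_on_subset[OF nse_B_coeff_continuous[OF U k]], use t0s in auto)+
  have cS: "continuous_on {s..t} (\<lambda>r. mode_coeff k (S r))" "continuous_on {s..t} (\<lambda>r. B_coeff k (S r) (S r))"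
    by (rule continuous_on_subset[OF nse_mode_coeff_continuous[OF S k]] continuous_on_subset[OF nse_B_coeff_continuous[OF S k]], auto)+
  have "continuous_on {s..t} (\<lambda>r. mode_coeff k (U r) - mode_coeff k (S r))" by (intro continuous_intros cU cS)
  then show "continuous_on {s..t} (\<lambda>r. mode_coeff k (w r))" by (rule continuous_on_eq) (simp add: tfw)
  show "continuous_on {s..t} (nonlin_diff k)" unfolding nonlin_diff_def[abs_def] by (intro continuous_intros cU cS)
  fix r assume r: "r \<in> {s..t}"
  then have sr: "s \<le> r" by simp
  have "((\<lambda>q. (of_real (\<nu> * (norm k)\<^sup>2) * mode_coeff k (U q) + B_coeff k (U q) (U q)) - (of_real (\<nu> * (norm k)\<^sup>2) * mode_coeff k (S q) + B_coeff k (S q) (S q)))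
      has_integral ((mode_coeff k (U s) - mode_coeff k (U r)) - (mode_coeff k (S s) - mode_coeff k (S r)))) {s..r}"
    using has_integral_diff[OF nse_mode_increment[OF U f t0s sr k]
        nse_mode_increment[OF S Linf_H_mono[OF f t0s] order_refl sr k]] by (simp del: of_real_power)
  then have "((\<lambda>q. of_real (\<nu> * (norm k)\<^sup>2) * mode_coeff k (w q) + nonlin_diff k q) has_integral (mode_coeff k (w s) - mode_coeff k (w r))) {s..r}"
    by (rule has_integral_eq_rhs[OF has_integral_eq[rotated]]) (auto simp: tfw sr nonlin_diff_def algebra_simps)
  then show "mode_coeff k (w r) = mode_coeff k (w s) - integral {s..r} (\<lambda>q. of_real (\<nu> * (norm k)\<^sup>2) * mode_coeff k (w q) + nonlin_diff k q)"
    by (simp add: integral_unique)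
qed

end

section \<open>Estimates on one time step\<close>

definition heat_const :: "real \<Rightarrow> real \<Rightarrow> real" where "heat_const a \<nu> = (a / \<nu>) powr a"

context two_solutions begin

text \<open>The heat factor pays for the \<open>2 * a\<close> powers of the frequency by which
  \<open>\<omega>\<close> exceeds \<open>\<omega>'\<close>.\<close>

lemma heat_L2_set:
  assumes F: "F \<subseteq> freqs L" and \<tau>: "\<tau> > 0" and a: "a > 0"
    and om: "\<And>k. k \<in> freqs L \<Longrightarrow> \<omega> k = norm k powr (2 * a) * \<omega>' k" "\<And>k. \<omega>' k \<ge> 0"
  shows "L2_set (\<lambda>k. L * \<omega> k * (exp (- (\<nu> * (norm k)\<^sup>2 * \<tau>)) * cmod (v k))) F
     \<le> L * heat_const a \<nu> * \<tau> powr (- a) * L2_set (\<lambda>k. \<omega>' k * cmod (v k)) F"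
proof -
  have "L2_set (\<lambda>k. L * \<omega> k * (exp (- (\<nu> * (norm k)\<^sup>2 * \<tau>)) * cmod (v k))) F
     \<le> L2_set (\<lambda>k. L * heat_const a \<nu> * \<tau> powr (- a) * (\<omega>' k * cmod (v k))) F"
  proof (rule L2_set_mono)
    fix k assume "k \<in> F"
    then have k: "k \<in> freqs L" using F by auto
    have "norm k powr (2 * a) * exp (- (\<nu> * (norm k)\<^sup>2 * \<tau>)) \<le> heat_const a \<nu> * \<tau> powr (- a)"
      unfolding heat_const_def by (rule heat_kernel_bound[OF freqs_norm_pos[OF k] \<nu>_pos \<tau> a])
    then have "norm k powr (2 * a) * exp (- (\<nu> * (norm k)\<^sup>2 * \<tau>)) * (L * (\<omega>' k * cmod (v k)))
       \<le> heat_const a \<nu> * \<tau> powr (- a) * (L * (\<omega>' k * cmod (v k)))"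
      using L_pos om(2) by (intro mult_right_mono) auto
    then show "L * \<omega> k * (exp (- (\<nu> * (norm k)\<^sup>2 * \<tau>)) * cmod (v k)) \<le> L * heat_const a \<nu> * \<tau> powr (- a) * (\<omega>' k * cmod (v k))"
      by (simp add: om(1)[OF k] mult_ac)
    show "0 \<le> L * \<omega> k * (exp (- (\<nu> * (norm k)\<^sup>2 * \<tau>)) * cmod (v k))"
      using L_pos om(2) by (simp add: om(1)[OF k])
  qed
  also have "\<dots> = L * heat_const a \<nu> * \<tau> powr (- a) * L2_set (\<lambda>k. \<omega>' k * cmod (v k)) F"
    using L_pos by (intro L2_set_right_distrib[symmetric]) (simp add: heat_const_def)
  finally show ?thesis .
qed

definition decay_rate where "decay_rate = \<nu> * (2 * pi / L)\<^sup>2"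

lemma decay_rate_le: "k \<in> freqs L \<Longrightarrow> decay_rate \<le> \<nu> * (norm k)\<^sup>2"
  unfolding decay_rate_def using freqs_norm_ge \<nu>_pos L_pos by (intro mult_left_mono power_mono) auto

lemma sob_term_w:
  assumes "t \<ge> s" "F \<subseteq> freqs L"
  shows "L2_set (sob_term 1 (w t)) F = L2_set (\<lambda>k. L * norm k * cmod (mode_coeff k (w t))) F"
    and "L2_set (sob_term 0 (w t)) F = L2_set (\<lambda>k. L * 1 * cmod (mode_coeff k (w t))) F"
  using V_norm_fc[OF wV[OF assms(1)]] assms(2) freqs_nz
  by (auto simp: L2_set_def sob_term_def subset_iff mult.assoc intro!: sum.cong arg_cong[of _ _ sqrt])

lemma nonlin_diff_estimates:
  assumes r: "r \<ge> s" and F: "finite F" "F \<subseteq> freqs L" and R: "sob_norm L 1 (U r) + sob_norm L 1 (S r) \<le> R"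
  shows "L2_set (\<lambda>k. norm k powr (- 1/4) * cmod (nonlin_diff k r)) F \<le> nonlin_const * R * y r"
    and "L2_set (\<lambda>k. lat_weight k * cmod (nonlin_diff k r)) F \<le> nonlin_const * R * z r"
proof -
  have "nonlin_const * (sob_norm L 1 (U r) + sob_norm L 1 (S r)) * y r \<le> nonlin_const * R * y r"
    using nonlin_const_pos R by (intro mult_right_mono mult_left_mono y_nonneg) auto
  then show "L2_set (\<lambda>k. norm k powr (- 1/4) * cmod (nonlin_diff k r)) F \<le> nonlin_const * R * y r"
    using B_coeff_estimates(1)[OF UV[OF r] SV[OF r] F] unfolding nonlin_diff_def y_def w_def by linarith
  have "nonlin_const * (sob_norm L 1 (U r) + sob_norm L 1 (S r)) * z r \<le> nonlin_const * R * z r"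
    using nonlin_const_pos R by (intro mult_right_mono mult_left_mono z_nonneg) auto
  then show "L2_set (\<lambda>k. lat_weight k * cmod (nonlin_diff k r)) F \<le> nonlin_const * R * z r"
    using B_coeff_estimates(2)[OF UV[OF r] SV[OF r] F] unfolding nonlin_diff_def z_def w_def by linarith
qed

text \<open>The weight of the target norm is written as a smoothing power times a weight of the
  nonlinear estimates: V-norm from the power -1/4, V-norm from -5/4, H-norm from -5/4. The halved
  smoothing powers 5/8, 9/8 and 5/8 are the orders of the time kernels.\<close>

lemma powr_mult_lat_weight: "k \<in> freqs L \<Longrightarrow> norm k = norm k powr (2 * (5/8)) * norm k powr (- 1/4)"
  "k \<in> freqs L \<Longrightarrow> norm k = norm k powr (2 * (9/8)) * lat_weight k"
  "k \<in> freqs L \<Longrightarrow> 1 = norm k powr (2 * (5/8)) * lat_weight k"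
  using freqs_norm_pos[of k] by (simp_all add: lat_weight_def flip: powr_add)

text \<open>The kernel of order \<open>7/8\<close> is the geometric mean of the kernel \<open>5/8\<close>, which comes with the
  \<open>V\<close>-norm of the difference, and of the non-integrable kernel \<open>9/8\<close>, which comes with its
  \<open>H\<close>-norm.\<close>

lemma y_bound:
  assumes t: "s \<le> t" and R0: "R \<ge> 0"
    and R: "\<And>r. r \<in> {s..t} \<Longrightarrow> sob_norm L 1 (U r) + sob_norm L 1 (S r) \<le> R"
    and Y: "\<And>r. r \<in> {s..t} \<Longrightarrow> y r \<le> Y" and Z: "\<And>r. r \<in> {s..t} \<Longrightarrow> z r \<le> Z"
  shows "y t \<le> exp (- (decay_rate * (t - s))) * y s
     + L * nonlin_const * sqrt (heat_const (5/8) \<nu> * heat_const (9/8) \<nu>) * R * sqrt (Y * Z) * (8 * (t - s) powr (1/8))"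
    (is "_ \<le> ?E + ?K * (8 * _)")
proof -
  have YZ: "Y \<ge> 0" "Z \<ge> 0" using Y[of s] Z[of s] y_nonneg[of s] z_nonneg[of s] t by auto
  have kp: "heat_const a \<nu> \<ge> 0" for a by (simp add: heat_const_def)
  have K0: "?K \<ge> 0" using L_pos nonlin_const_pos R0 kp YZ by (intro mult_nonneg_nonneg) auto
  have g: "((\<lambda>r. ?K * (t - r) powr (- 7/8)) has_integral ?K * (8 * (t - s) powr (1/8))) {s..t}"
    by (rule has_integral_mult_right[OF kernel_integral[OF t]])
  have "L2_set (sob_term 1 (w t)) F \<le> ?E + ?K * (8 * (t - s) powr (1/8))" if F: "finite F" "F \<subseteq> freqs L" for F
  proof -
    have "L2_set (\<lambda>k. L * norm k * cmod (mode_coeff k (w t))) F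
       \<le> exp (- (decay_rate * (t - s))) * L2_set (\<lambda>k. L * norm k * cmod (mode_coeff k (w s))) F + ?K * (8 * (t - s) powr (1/8))"
    proof (rule duhamel_L2_set[OF F(1) t _ _ _ g])
      show "decay_rate \<le> \<nu> * (norm k)\<^sup>2" if "k \<in> F" for k using decay_rate_le that F(2) by blast
      show "0 \<le> L * norm k" for k :: "real^2" using L_pos by simp
      show "((\<lambda>r. of_real (exp (- (\<nu> * (norm k)\<^sup>2 * (t - r)))) * nonlin_diff k r) has_integral
         (of_real (exp (- (\<nu> * (norm k)\<^sup>2 * (t - s)))) * mode_coeff k (w s) - mode_coeff k (w t))) {s..t}" if "k \<in> F" for k
        using mode_duhamel[OF _ t] that F(2) by blast
      fix r assume r: "s \<le> r" "r < t"
      define X where "X = L2_set (\<lambda>k. L * norm k * (exp (- (\<nu> * (norm k)\<^sup>2 * (t - r))) * cmod (nonlin_diff k r))) F"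
      have \<tau>: "t - r > 0" and rt: "r \<in> {s..t}" using r by auto
      have "X \<le> L * heat_const (5/8) \<nu> * (t - r) powr (- (5/8)) * L2_set (\<lambda>k. norm k powr (- 1/4) * cmod (nonlin_diff k r)) F"
        unfolding X_def by (rule heat_L2_set[OF F(2) \<tau> _ powr_mult_lat_weight(1)]) auto
      also have "\<dots> \<le> L * heat_const (5/8) \<nu> * (t - r) powr (- (5/8)) * (nonlin_const * R * Y)"
      proof (rule mult_left_mono)
        have "nonlin_const * R * y r \<le> nonlin_const * R * Y" using nonlin_const_pos R0 by (intro mult_left_mono Y rt) auto
        then show "L2_set (\<lambda>k. norm k powr (- 1/4) * cmod (nonlin_diff k r)) F \<le> nonlin_const * R * Y"
          using nonlin_diff_estimates(1)[OF r(1) F R[OF rt]] by linarith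
      qed (use L_pos kp in auto)
      finally have A: "X \<le> L * heat_const (5/8) \<nu> * (t - r) powr (- (5/8)) * (nonlin_const * R * Y)" .
      have "X \<le> L * heat_const (9/8) \<nu> * (t - r) powr (- (9/8)) * L2_set (\<lambda>k. lat_weight k * cmod (nonlin_diff k r)) F"
        unfolding X_def by (rule heat_L2_set[OF F(2) \<tau> _ powr_mult_lat_weight(2) lat_weight_nonneg]) auto
      also have "\<dots> \<le> L * heat_const (9/8) \<nu> * (t - r) powr (- (9/8)) * (nonlin_const * R * Z)"
      proof (rule mult_left_mono)
        have "nonlin_const * R * z r \<le> nonlin_const * R * Z" using nonlin_const_pos R0 by (intro mult_left_mono Z rt) auto
        then show "L2_set (\<lambda>k. lat_weight k * cmod (nonlin_diff k r)) F \<le> nonlin_const * R * Z"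
          using nonlin_diff_estimates(2)[OF r(1) F R[OF rt]] by linarith
      qed (use L_pos kp in auto)
      finally have B: "X \<le> L * heat_const (9/8) \<nu> * (t - r) powr (- (9/8)) * (nonlin_const * R * Z)" .
      have X0: "X \<ge> 0" by (simp add: X_def)
      have p: "((t - r) powr (- 7/8))\<^sup>2 = (t - r) powr (- (5/8)) * (t - r) powr (- (9/8))"
        by (simp add: powr_sq flip: powr_add)
      have "X\<^sup>2 \<le> (L * heat_const (5/8) \<nu> * (t - r) powr (- (5/8)) * (nonlin_const * R * Y)) * (L * heat_const (9/8) \<nu> * (t - r) powr (- (9/8)) * (nonlin_const * R * Z))"
        unfolding power2_eq_square using X0 order_trans[OF X0 A] by (intro mult_mono A B)
      also have "\<dots> = (?K * (t - r) powr (- 7/8))\<^sup>2"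
        unfolding power_mult_distrib p using YZ kp by (simp add: power2_eq_square)
      finally have "X \<le> ?K * (t - r) powr (- 7/8)"
        by (rule power2_le_imp_le) (use K0 in auto)
      then show "L2_set (\<lambda>k. L * norm k * (exp (- (\<nu> * (norm k)\<^sup>2 * (t - r))) * cmod (nonlin_diff k r))) F \<le> ?K * (t - r) powr (- 7/8)"
        unfolding X_def .
    qed
    also have "L2_set (\<lambda>k. L * norm k * cmod (mode_coeff k (w s))) F \<le> y s"
      unfolding sob_term_w(1)[OF order_refl F(2), symmetric] y_def by (intro L2_set_sob_term_le V_sob_finite wV order_refl F)
    finally show ?thesis unfolding sob_term_w(1)[OF t F(2)] by (simp add: mult_left_mono)
  qed
  then show ?thesis unfolding y_def[of t]
    using K0 y_nonneg by (intro sob_norm_leI(2)) (auto intro!: add_nonneg_nonneg mult_nonneg_nonneg)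
qed

text \<open>The exponential weight makes the constant in front of \<open>Z\<close> small for large \<open>\<kappa>\<close>, because
  \<open>exp (- x) \<le> x powr (- 1/4)\<close> trades a little integrability of the kernel for a power of \<open>\<kappa>\<close>.\<close>

lemma z_bound:
  assumes t: "s \<le> t" and R0: "R \<ge> 0" and \<kappa>: "\<kappa> > 0" and Z0: "Z \<ge> 0"
    and R: "\<And>r. r \<in> {s..t} \<Longrightarrow> sob_norm L 1 (U r) + sob_norm L 1 (S r) \<le> R"
    and Z: "\<And>r. r \<in> {s..t} \<Longrightarrow> z r \<le> Z * exp (\<kappa> * (r - s))"
  shows "z t \<le> z s + L * nonlin_const * heat_const (5/8) \<nu> * R * Z * exp (\<kappa> * (t - s)) * \<kappa> powr (- (1/4)) * (8 * (t - s) powr (1/8))"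
    (is "_ \<le> _ + ?K * (8 * _)")
proof -
  have kp: "heat_const a \<nu> \<ge> 0" for a by (simp add: heat_const_def)
  have K0: "?K \<ge> 0" using L_pos nonlin_const_pos R0 kp Z0 by (intro mult_nonneg_nonneg) auto
  have g: "((\<lambda>r. ?K * (t - r) powr (- 7/8)) has_integral ?K * (8 * (t - s) powr (1/8))) {s..t}"
    by (rule has_integral_mult_right[OF kernel_integral[OF t]])
  have "L2_set (sob_term 0 (w t)) F \<le> z s + ?K * (8 * (t - s) powr (1/8))" if F: "finite F" "F \<subseteq> freqs L" for F
  proof -
    \<comment> \<open>The decay rate is replaced by 0: growth of the H-norm only has to be
      controlled, its contraction being the task of the filter.\<close>
    have "L2_set (\<lambda>k. L * 1 * cmod (mode_coeff k (w t))) F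
       \<le> exp (- (0 * (t - s))) * L2_set (\<lambda>k. L * 1 * cmod (mode_coeff k (w s))) F + ?K * (8 * (t - s) powr (1/8))"
    proof (rule duhamel_L2_set[OF F(1) t _ _ _ g])
      show "0 \<le> \<nu> * (norm k)\<^sup>2" if "k \<in> F" for k using \<nu>_pos by simp
      show "0 \<le> L * 1" for k :: "real^2" using L_pos by simp
      show "((\<lambda>r. of_real (exp (- (\<nu> * (norm k)\<^sup>2 * (t - r)))) * nonlin_diff k r) has_integral
         (of_real (exp (- (\<nu> * (norm k)\<^sup>2 * (t - s)))) * mode_coeff k (w s) - mode_coeff k (w t))) {s..t}" if "k \<in> F" for k
        using mode_duhamel[OF _ t] that F(2) by blast
      fix r assume r: "s \<le> r" "r < t"
      have \<tau>: "t - r > 0" and rt: "r \<in> {s..t}" using r by auto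
      have "L2_set (\<lambda>k. L * 1 * (exp (- (\<nu> * (norm k)\<^sup>2 * (t - r))) * cmod (nonlin_diff k r))) F
         \<le> L * heat_const (5/8) \<nu> * (t - r) powr (- (5/8)) * L2_set (\<lambda>k. lat_weight k * cmod (nonlin_diff k r)) F"
        by (rule heat_L2_set[OF F(2) \<tau> _ powr_mult_lat_weight(3) lat_weight_nonneg]) auto
      also have "\<dots> \<le> L * heat_const (5/8) \<nu> * (t - r) powr (- (5/8)) * (nonlin_const * R * (Z * exp (\<kappa> * (r - s))))"
      proof (rule mult_left_mono)
        have "nonlin_const * R * z r \<le> nonlin_const * R * (Z * exp (\<kappa> * (r - s)))" using nonlin_const_pos R0 by (intro mult_left_mono Z rt) auto
        then show "L2_set (\<lambda>k. lat_weight k * cmod (nonlin_diff k r)) F \<le> nonlin_const * R * (Z * exp (\<kappa> * (r - s)))"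
          using nonlin_diff_estimates(2)[OF r(1) F R[OF rt]] by linarith
      qed (use L_pos kp in auto)
      also have "\<dots> = (L * nonlin_const * heat_const (5/8) \<nu> * R * Z * exp (\<kappa> * (t - s))) * ((t - r) powr (- (5/8)) * exp (- (\<kappa> * (t - r))))"
      proof -
        have "exp (\<kappa> * (r - s)) = exp (\<kappa> * (t - s)) * exp (- (\<kappa> * (t - r)))"
          by (simp add: exp_add[symmetric] algebra_simps)
        then show ?thesis by (simp add: mult_ac)
      qed
      also have "\<dots> \<le> (L * nonlin_const * heat_const (5/8) \<nu> * R * Z * exp (\<kappa> * (t - s))) * (\<kappa> powr (- (1/4)) * (t - r) powr (- 7/8))"
      proof (rule mult_left_mono)
        have "(\<kappa> * (t - r)) powr (1/4) * exp (- (\<kappa> * (t - r))) \<le> (1/4) powr (1/4)"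
          using \<kappa> \<tau> by (intro powr_exp_le) auto
        also have "\<dots> \<le> 1" by (rule powr_le1) auto
        finally have "\<kappa> powr (1/4) * (t - r) powr (1/4) * exp (- (\<kappa> * (t - r))) \<le> 1" by (simp add: powr_mult)
        then have "(\<kappa> powr (- (1/4)) * (t - r) powr (- 7/8)) * (\<kappa> powr (1/4) * (t - r) powr (1/4) * exp (- (\<kappa> * (t - r))))
           \<le> (\<kappa> powr (- (1/4)) * (t - r) powr (- 7/8)) * 1"
          by (intro mult_left_mono) auto
        moreover have "\<kappa> powr (- (1/4)) * \<kappa> powr (1/4) = 1" "(t - r) powr (- 7/8) * (t - r) powr (1/4) = (t - r) powr (- (5/8))"
          using \<kappa> \<tau> by (simp_all flip: powr_add)
        moreover have "(\<kappa> powr (- (1/4)) * (t - r) powr (- 7/8)) * (\<kappa> powr (1/4) * (t - r) powr (1/4) * exp (- (\<kappa> * (t - r))))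
          = (\<kappa> powr (- (1/4)) * \<kappa> powr (1/4)) * ((t - r) powr (- 7/8) * (t - r) powr (1/4)) * exp (- (\<kappa> * (t - r)))"
          by (simp only: mult_ac)
        ultimately show "(t - r) powr (- (5/8)) * exp (- (\<kappa> * (t - r))) \<le> \<kappa> powr (- (1/4)) * (t - r) powr (- 7/8)"
          by (simp only: mult_1 mult_1_right)
      qed (use L_pos nonlin_const_pos R0 kp Z0 in \<open>auto intro!: mult_nonneg_nonneg\<close>)
      finally show "L2_set (\<lambda>k. L * 1 * (exp (- (\<nu> * (norm k)\<^sup>2 * (t - r))) * cmod (nonlin_diff k r))) F \<le> ?K * (t - r) powr (- 7/8)"
        by (simp only: mult.assoc)
    qed
    also have "L2_set (\<lambda>k. L * 1 * cmod (mode_coeff k (w s))) F \<le> z s"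
      unfolding sob_term_w(2)[OF order_refl F(2), symmetric] z_def by (intro L2_set_sob_term_le sob_finite_0 V_sob_finite wV order_refl F)
    finally show ?thesis unfolding sob_term_w(2)[OF t F(2)] by simp
  qed
  then show ?thesis unfolding z_def[of t]
    using K0 z_nonneg by (intro sob_norm_leI(2)) (auto intro!: add_nonneg_nonneg mult_nonneg_nonneg)
qed

lemma z_le_y: "t \<ge> s \<Longrightarrow> z t \<le> L / (2 * pi) * y t"
  unfolding z_def y_def by (intro sob_finite_0 V_sob_finite wV)

text \<open>Gronwall's inequality for a singular kernel, by a weighted supremum \<open>Zs\<close>.
  By \<open>z_bound\<close> and \<open>small\<close>, \<open>Zs\<close> is at most its initial value
  plus half of itself, and the half is absorbed. Absorption needs \<open>Zs\<close> to be finite,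
  which follows from \<open>Y\<close> by the Poincare inequality; the size of \<open>Y\<close> does
  not enter the conclusion.\<close>

lemma z_growth:
  assumes t: "t \<in> {s..s + \<delta>}" and R0: "R \<ge> 0" and \<kappa>: "\<kappa> > 0"
    and small: "L * nonlin_const * heat_const (5/8) \<nu> * R * \<kappa> powr (- (1/4)) * (8 * \<delta> powr (1/8)) \<le> 1/2"
    and R: "\<And>r. r \<in> {s..t} \<Longrightarrow> sob_norm L 1 (U r) + sob_norm L 1 (S r) \<le> R"
    and Y: "\<And>r. r \<in> {s..t} \<Longrightarrow> y r \<le> Y" and r: "r \<in> {s..t}"
  shows "z r \<le> 2 * z s * exp (\<kappa> * \<delta>)"
proof -
  define h where "h r = exp (- (\<kappa> * (r - s))) * z r" for r
  define Zs where "Zs = (SUP r\<in>{s..t}. h r)"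
  have st: "s \<le> t" "t \<le> s + \<delta>" using t by auto
  have hb: "h r \<le> L / (2 * pi) * Y" if "r \<in> {s..t}" for r
  proof -
    have "h r \<le> 1 * z r" unfolding h_def using that \<kappa> z_nonneg[of r] by (intro mult_right_mono) auto
    also have "\<dots> \<le> L / (2 * pi) * y r" using z_le_y[of r] that by simp
    also have "\<dots> \<le> L / (2 * pi) * Y" using L_pos by (intro mult_left_mono Y that) auto
    finally show ?thesis .
  qed
  have bdd: "bdd_above (h ` {s..t})" using hb by (intro bdd_aboveI[of _ "L / (2 * pi) * Y"]) auto
  have le: "h r \<le> Zs" if "r \<in> {s..t}" for r unfolding Zs_def by (rule cSUP_upper[OF that bdd])
  have Zs0: "Zs \<ge> 0"
  proof -
    have "0 \<le> h s" by (simp add: h_def z_nonneg)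
    then show ?thesis using le[of s] st by simp
  qed
  have zle: "z r \<le> Zs * exp (\<kappa> * (r - s))" if "r \<in> {s..t}" for r
  proof -
    have "z r = h r * exp (\<kappa> * (r - s))"
      unfolding h_def by (simp add: mult.assoc mult.commute[of "z r"] flip: exp_add)
    then show ?thesis using le[OF that] by simp
  qed
  have "h r \<le> z s + Zs / 2" if r: "r \<in> {s..t}" for r
  proof -
    have rs: "s \<le> r" "r - s \<le> \<delta>" using r st by auto
    define A where "A = L * nonlin_const * heat_const (5/8) \<nu> * R"
    have A0: "A \<ge> 0" unfolding A_def using L_pos nonlin_const_pos R0 by (intro mult_nonneg_nonneg) (auto simp: heat_const_def)
    have "z r \<le> z s + A * Zs * exp (\<kappa> * (r - s)) * \<kappa> powr (- (1/4)) * (8 * (r - s) powr (1/8))"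
      unfolding A_def using r by (intro z_bound rs R0 \<kappa> Zs0 R zle) auto
    then have "h r \<le> exp (- (\<kappa> * (r - s))) * (z s + A * Zs * exp (\<kappa> * (r - s)) * \<kappa> powr (- (1/4)) * (8 * (r - s) powr (1/8)))"
      unfolding h_def by (intro mult_left_mono) auto
    also have "\<dots> = exp (- (\<kappa> * (r - s))) * z s + Zs * (A * \<kappa> powr (- (1/4)) * (8 * (r - s) powr (1/8)))"
    proof -
      have "exp (- (\<kappa> * (r - s))) * exp (\<kappa> * (r - s)) = 1" by (simp flip: exp_add)
      moreover have "e1 * (p + A * Zs * e2 * c * d) = e1 * p + (e1 * e2) * (Zs * (A * c * d))" for e1 e2 p c d :: real
        by (simp add: algebra_simps)
      ultimately show ?thesis by simp
    qed
    also have "\<dots> \<le> 1 * z s + Zs * (A * \<kappa> powr (- (1/4)) * (8 * \<delta> powr (1/8)))"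
      using rs \<kappa> z_nonneg Zs0 A0
      by (intro add_mono mult_right_mono mult_left_mono powr_mono2) auto
    also have "\<dots> \<le> z s + Zs * (1/2)"
      unfolding A_def using small Zs0 by (intro add_mono mult_left_mono) simp_all
    finally show ?thesis by simp
  qed
  then have "Zs \<le> z s + Zs / 2" unfolding Zs_def using st by (intro cSUP_least) auto
  then have Z2: "Zs \<le> 2 * z s" by simp
  have "z r \<le> Zs * exp (\<kappa> * (r - s))" by (rule zle[OF r])
  also have "\<dots> \<le> (2 * z s) * exp (\<kappa> * \<delta>)"
    using Z2 Zs0 r st \<kappa> by (intro mult_mono) auto
  finally show ?thesis .
qed

text \<open>As long as \<open>y\<close> stays below \<open>4 * b\<close>, the trajectory is bounded
  by \<rho> + \<open>4 * b0\<close>, so that \<open>R\<close> is admissible and \<open>key\<close>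
  applies. It then yields at most \<open>2 * b + b / 2\<close>, strictly below the threshold, and
  \<open>bootstrap\<close> closes the loop.\<close>

lemma step_estimate:
  assumes \<rho>: "\<And>t. t \<ge> s \<Longrightarrow> sob_norm L 1 (U t) \<le> \<rho>" and b: "0 < b" "b \<le> b0"
    and y_start: "y s \<le> 2 * b" and z_start: "z s \<le> \<epsilon> * b" and \<epsilon>: "\<epsilon> \<ge> 0"
    and R: "R = 2 * \<rho> + 4 * b0" and \<kappa>: "\<kappa> > 0"
    and small: "L * nonlin_const * heat_const (5/8) \<nu> * R * \<kappa> powr (- (1/4)) * (8 * \<delta> powr (1/8)) \<le> 1/2"
    and Q: "Q = L * nonlin_const * sqrt (heat_const (5/8) \<nu> * heat_const (9/8) \<nu>) * R * (8 * \<delta> powr (1/8)) * sqrt (8 * exp (\<kappa> * \<delta>))"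
    and Qe: "Q * sqrt \<epsilon> \<le> 1/2" and t: "t \<in> {s..s + \<delta>}"
  shows "y t \<le> 4 * b" "y t \<le> exp (- (decay_rate * (t - s))) * y s + Q * sqrt \<epsilon> * b"
proof -
  have \<rho>0: "\<rho> \<ge> 0" using \<rho>[of s] sob_norm_nonneg[of 1 "U s"] by linarith
  have R0: "R \<ge> 0" using \<rho>0 b R by simp
  have key: "y t \<le> exp (- (decay_rate * (t - s))) * y s + Q * sqrt \<epsilon> * b"
    if t: "t \<in> {s..s + \<delta>}" and Y: "\<And>r. r \<in> {s..t} \<Longrightarrow> y r \<le> 4 * b" for t
  proof -
    have Rb: "sob_norm L 1 (U r) + sob_norm L 1 (S r) \<le> R" if r: "r \<in> {s..t}" for r
    proof -
      have rs: "r \<ge> s" using r by simp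
      have "\<bar>sob_norm L 1 (U r) - sob_norm L 1 (S r)\<bar> \<le> y r"
        unfolding y_def w_def by (intro sob_norm_reverse V_sob_finite V_L2 UV SV rs)
      then show ?thesis using \<rho>[OF rs] Y[OF r] R b by linarith
    qed
    have Z: "z r \<le> 2 * (\<epsilon> * b) * exp (\<kappa> * \<delta>)" if r: "r \<in> {s..t}" for r
    proof -
      have "z r \<le> 2 * z s * exp (\<kappa> * \<delta>)" by (rule z_growth[OF t R0 \<kappa> small Rb Y r])
      also have "\<dots> \<le> 2 * (\<epsilon> * b) * exp (\<kappa> * \<delta>)" using z_start by (intro mult_right_mono) auto
      finally show ?thesis .
    qed
    define A where "A = L * nonlin_const * sqrt (heat_const (5/8) \<nu> * heat_const (9/8) \<nu>) * R"
    have A0: "A \<ge> 0" unfolding A_def using L_pos nonlin_const_pos R0 by (intro mult_nonneg_nonneg) (auto simp: heat_const_def)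
    have "y t \<le> exp (- (decay_rate * (t - s))) * y s + A * sqrt (4 * b * (2 * (\<epsilon> * b) * exp (\<kappa> * \<delta>))) * (8 * (t - s) powr (1/8))"
      unfolding A_def using t by (intro y_bound R0 Rb Y Z) auto
    \<comment> \<open>Both bounds under the root are proportional to \<open>b\<close>, so the
      nonlinear contribution is linear in \<open>b\<close> although the nonlinearity is quadratic,
      and it carries the small factor \<open>sqrt \<epsilon>\<close>.\<close>
    also have "sqrt (4 * b * (2 * (\<epsilon> * b) * exp (\<kappa> * \<delta>))) = sqrt (8 * exp (\<kappa> * \<delta>)) * sqrt \<epsilon> * b"
    proof -
      have "4 * b * (2 * (\<epsilon> * b) * exp (\<kappa> * \<delta>)) = (8 * exp (\<kappa> * \<delta>)) * \<epsilon> * b\<^sup>2"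
        by (simp add: power2_eq_square)
      then show ?thesis using b by (simp only: real_sqrt_mult real_sqrt_abs abs_of_pos)
    qed
    also have "A * (sqrt (8 * exp (\<kappa> * \<delta>)) * sqrt \<epsilon> * b) * (8 * (t - s) powr (1/8))
       \<le> A * (sqrt (8 * exp (\<kappa> * \<delta>)) * sqrt \<epsilon> * b) * (8 * \<delta> powr (1/8))"
      using t A0 \<epsilon> b by (intro mult_left_mono powr_mono2) auto
    also have "\<dots> = Q * sqrt \<epsilon> * b" unfolding Q A_def by (simp add: mult_ac)
    finally show ?thesis by simp
  qed
  have lt: "y t < 4 * b" if t: "t \<in> {s..s + \<delta>}" for t
  proof (rule bootstrap[of s "s + \<delta>" y])
    show "continuous_on {s..s + \<delta>} y" by (rule continuous_on_subset[OF y_continuous]) auto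
    show "y s < 4 * b" using y_start b by simp
    fix t assume t: "t \<in> {s..s + \<delta>}" and Y: "\<And>r. r \<in> {s..t} \<Longrightarrow> y r \<le> 4 * b"
    have "y t \<le> exp (- (decay_rate * (t - s))) * y s + Q * sqrt \<epsilon> * b" by (rule key[OF t Y])
    also have "\<dots> \<le> 1 * y s + 1/2 * b"
    proof (intro add_mono mult_right_mono Qe y_nonneg)
      show "exp (- (decay_rate * (t - s))) \<le> 1" using t \<nu>_pos by (simp add: decay_rate_def)
    qed (use b in simp)
    also have "\<dots> < 4 * b" using y_start b by simp
    finally show "y t < 4 * b" .
  qed (rule t)
  show "y t \<le> 4 * b" using lt[OF t] by simp
  show "y t \<le> exp (- (decay_rate * (t - s))) * y s + Q * sqrt \<epsilon> * b"
    by (rule key[OF t]) (use lt t in \<open>auto simp: less_imp_le\<close>)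
qed

end

section \<open>Convergence\<close>

lemma sqrt_bound_of_sq: "(x :: real)\<^sup>2 \<le> c\<^sup>2 * b\<^sup>2 \<Longrightarrow> c \<ge> 0 \<Longrightarrow> b \<ge> 0 \<Longrightarrow> x \<le> c * b"
  by (rule power2_le_imp_le) (simp_all add: power_mult_distrib)

context torus begin

text \<open>Completeness of Lebesgue measure. The approximation is prescribed only up to null sets,
  so its measurability has to be inherited.\<close>

lemma aeq_measurable:
  assumes "aeq L u v" "v \<in> borel_measurable M" shows "u \<in> borel_measurable M"
proof -
  have SO: "Omega L \<in> sets lebesgue" by (auto simp: Omega_cbox)
  have "AE x in lebesgue. x \<in> Omega L \<longrightarrow> u x = v x"
    using assms(1) SO by (simp add: aeq_def AE_restrict_space_iff)
  then obtain N where N: "N \<in> null_sets lebesgue" "{x \<in> space lebesgue. \<not> (x \<in> Omega L \<longrightarrow> u x = v x)} \<subseteq> N"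
    unfolding eventually_ae_filter by blast
  have neg: "negligible N" using N(1) by (simp add: negligible_iff_null_sets)
  have "v measurable_on Omega L" using assms(2) measurable_on_iff_borel_measurable[OF SO] by blast
  then have "u measurable_on Omega L"
    by (rule measurable_on_spike[OF _ neg]) (use N(2) in auto)
  then show ?thesis using measurable_on_iff_borel_measurable[OF SO] by blast
qed

lemma aeq_fc: "aeq L u v \<Longrightarrow> v \<in> L2 L \<Longrightarrow> fourier_coeff L u = fourier_coeff L v"
  using fc_aeq aeq_measurable L2_measurable by blast

lemma aeq_trans: "aeq L u v \<Longrightarrow> aeq L v w \<Longrightarrow> aeq L u w"
  unfolding aeq_def by (auto elim: eventually_elim2)

lemma J_op_L2: "J_op L lam I u \<in> L2 L"
  unfolding J_op_def by (rule spectral_proj_L2)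

lemma J_op_fc:
  "k \<in> freqs L \<Longrightarrow> fourier_coeff L (J_op L lam I u) k = (if (norm k)\<^sup>2 \<le> lam then fourier_coeff L (leray L (I u)) k else 0)"
  unfolding J_op_def by (rule spectral_proj_fc)

lemma filter_bounds:
  assumes est: "(sob_norm L 1 w')\<^sup>2 \<le> (sob_norm L 1 w)\<^sup>2 + lam * (c1 * h\<^sup>2 * (sob_norm L 1 w)\<^sup>2)"
     "(sob_norm L 0 w')\<^sup>2 \<le> (sob_norm L 1 w)\<^sup>2 / lam + c1 * h\<^sup>2 * (sob_norm L 1 w)\<^sup>2"
    and w: "sob_norm L 1 w \<le> b" and lam: "lam > 0"
    and eta: "\<eta> \<ge> 0" "lam * (c1 * h\<^sup>2) \<le> \<eta>" and eps: "\<epsilon> \<ge> 0" "1 / lam + c1 * h\<^sup>2 \<le> \<epsilon>\<^sup>2" and c: "c1 \<ge> 0"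
  shows "sob_norm L 1 w' \<le> (1 + \<eta>) * b" "sob_norm L 0 w' \<le> \<epsilon> * b"
proof -
  have wb: "(sob_norm L 1 w)\<^sup>2 \<le> b\<^sup>2" using w by (intro power_mono sob_norm_nonneg)
  have b0: "b \<ge> 0" using w sob_norm_nonneg[of 1 w] by linarith
  have "(sob_norm L 1 w')\<^sup>2 \<le> (1 + lam * (c1 * h\<^sup>2)) * (sob_norm L 1 w)\<^sup>2"
    using est(1) by (simp add: algebra_simps)
  also have "\<dots> \<le> (1 + \<eta>)\<^sup>2 * b\<^sup>2"
  proof (intro mult_mono wb)
    have "1 + lam * (c1 * h\<^sup>2) \<le> 1 + \<eta>" using eta by simp
    also have "\<dots> \<le> (1 + \<eta>)\<^sup>2" using eta(1) by (simp add: power2_sum)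
    finally show "1 + lam * (c1 * h\<^sup>2) \<le> (1 + \<eta>)\<^sup>2" .
  qed auto
  finally show "sob_norm L 1 w' \<le> (1 + \<eta>) * b" by (rule sqrt_bound_of_sq) (use eta b0 in simp_all)
  have "(sob_norm L 0 w')\<^sup>2 \<le> (1 / lam + c1 * h\<^sup>2) * (sob_norm L 1 w)\<^sup>2"
    using est(2) by (simp add: algebra_simps)
  also have "\<dots> \<le> \<epsilon>\<^sup>2 * b\<^sup>2" using eps by (intro mult_mono wb) auto
  finally show "sob_norm L 0 w' \<le> \<epsilon> * b" by (rule sqrt_bound_of_sq) (use eps b0 in simp_all)
qed

text \<open>The error left by the initialisation is the filtered reference field itself, so the
  first state obeys the same bounds as an update with \<open>w\<close> as the error before
  it.\<close>

lemma initial_filter: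
  assumes I: "type_I_interpolant L c1 h I" and w: "w \<in> V L" and lam: "lam > 0"
    and S: "S \<in> L2 L" "aeq L S (J_op L lam I w)"
  shows "(sob_norm L 1 (\<lambda>x. w x - S x))\<^sup>2 \<le> (sob_norm L 1 w)\<^sup>2 + lam * (c1 * h\<^sup>2 * (sob_norm L 1 w)\<^sup>2)"
     "(sob_norm L 0 (\<lambda>x. w x - S x))\<^sup>2 \<le> (sob_norm L 1 w)\<^sup>2 / lam + c1 * h\<^sup>2 * (sob_norm L 1 w)\<^sup>2"
proof -
  have IL: "I w \<in> L2 L" and Ib: "(L2_norm L (\<lambda>x. w x - I w x))\<^sup>2 \<le> c1 * h\<^sup>2 * (sob_norm L 1 w)\<^sup>2"
    using I w by (auto simp: type_I_interpolant_def)
  have fS: "fourier_coeff L S = fourier_coeff L (J_op L lam I w)" by (rule aeq_fc[OF S(2) J_op_L2])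
  note e = filter_estimate[OF w leray_H[OF IL] IL leray_orthogonal[OF IL] Ib lam, of "\<lambda>x. w x - S x"]
  have c: "norm (fourier_coeff L (\<lambda>x. w x - S x) k) = norm (fourier_coeff L w k - (if (norm k)\<^sup>2 \<le> lam then fourier_coeff L (leray L (I w)) k else 0))"
    if "k \<in> freqs L" for k
    unfolding fc_diff[OF V_L2[OF w] S(1)] fS J_op_fc[OF that] ..
  show "(sob_norm L 1 (\<lambda>x. w x - S x))\<^sup>2 \<le> (sob_norm L 1 w)\<^sup>2 + lam * (c1 * h\<^sup>2 * (sob_norm L 1 w)\<^sup>2)"
     "(sob_norm L 0 (\<lambda>x. w x - S x))\<^sup>2 \<le> (sob_norm L 1 w)\<^sup>2 / lam + c1 * h\<^sup>2 * (sob_norm L 1 w)\<^sup>2"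
    using e(2,3) c by blast+
qed

text \<open>The new error is the old one with its filtered observation removed. Both
  \<open>I\<close> and \<open>leray\<close> respect differences only up to null sets, the latter
  being a chosen representative. Therefore \<open>g\<close> and \<open>d\<close> are differences of
  observations and of projections, and the orthogonality needed by \<open>filter_estimate\<close> is
  verified for them directly.\<close>

lemma update_filter:
  assumes I: "type_I_interpolant L c1 h I" and u: "u \<in> V L" and v: "v \<in> V L" and lam: "lam > 0"
    and S: "S \<in> L2 L" "aeq L S (\<lambda>x. E_op L lam I v x + J_op L lam I u x)"
  defines "w \<equiv> (\<lambda>x. u x - v x)"
  shows "(sob_norm L 1 (\<lambda>x. u x - S x))\<^sup>2 \<le> (sob_norm L 1 w)\<^sup>2 + lam * (c1 * h\<^sup>2 * (sob_norm L 1 w)\<^sup>2)"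
     "(sob_norm L 0 (\<lambda>x. u x - S x))\<^sup>2 \<le> (sob_norm L 1 w)\<^sup>2 / lam + c1 * h\<^sup>2 * (sob_norm L 1 w)\<^sup>2"
proof -
  have w: "w \<in> V L" unfolding w_def by (rule V_diff[OF u v])
  have IL: "I u \<in> L2 L" "I v \<in> L2 L" "I w \<in> L2 L" using I u v w by (auto simp: type_I_interpolant_def)
  have "aeq L (I (\<lambda>x. 1 *\<^sub>R u x + (-1) *\<^sub>R v x)) (\<lambda>x. 1 *\<^sub>R I u x + (-1) *\<^sub>R I v x)"
    using I u v unfolding type_I_interpolant_def by blast
  then have lin: "aeq L (I w) (\<lambda>x. I u x - I v x)" by (simp add: w_def)
  define g where "g = (\<lambda>x. I u x - I v x)"
  define d where "d = (\<lambda>x. leray L (I u) x - leray L (I v) x)"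
  have gL: "g \<in> L2 L" unfolding g_def by (intro L2_diff IL)
  have dH: "d \<in> H L" unfolding d_def by (intro H_diff leray_H IL)
  have orth: "L2_inner L (\<lambda>x. g x - d x) p = 0" if p: "p \<in> H L" for p
  proof -
    have "(\<lambda>x. g x - d x) = (\<lambda>x. (I u x - leray L (I u) x) - (I v x - leray L (I v) x))"
      by (auto simp: g_def d_def)
    then show ?thesis
      using leray_orthogonal[OF IL(1) p] leray_orthogonal[OF IL(2) p]
      by (simp add: L2_inner_diff_left[OF L2_diff[OF IL(1) H_L2[OF leray_H[OF IL(1)]]] L2_diff[OF IL(2) H_L2[OF leray_H[OF IL(2)]]] H_L2[OF p]])
  qed
  have Ib: "(L2_norm L (\<lambda>x. w x - g x))\<^sup>2 \<le> c1 * h\<^sup>2 * (sob_norm L 1 w)\<^sup>2"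
  proof -
    have "aeq L (\<lambda>x. w x - I w x) (\<lambda>x. w x - g x)"
      using lin unfolding aeq_def g_def by eventually_elim simp
    then have "L2_norm L (\<lambda>x. w x - I w x) = L2_norm L (\<lambda>x. w x - g x)"
      by (rule aeq_L2_norm) (intro L2_measurable L2_diff V_L2 w IL gL)+
    moreover have "(L2_norm L (\<lambda>x. w x - I w x))\<^sup>2 \<le> c1 * h\<^sup>2 * (sob_norm L 1 w)\<^sup>2"
      using I w by (auto simp: type_I_interpolant_def)
    ultimately show ?thesis by simp
  qed
  have EL: "E_op L lam I v \<in> L2 L" unfolding E_op_def by (intro L2_diff V_L2 v J_op_L2)
  have fS: "fourier_coeff L S k = fourier_coeff L v k - fourier_coeff L (J_op L lam I v) k + fourier_coeff L (J_op L lam I u) k" for k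
    unfolding aeq_fc[OF S(2) L2_add[OF EL J_op_L2]] fc_add[OF EL J_op_L2]
    by (simp add: E_op_def fc_diff V_L2 v J_op_L2)
  have c: "norm (fourier_coeff L (\<lambda>x. u x - S x) k) = norm (fourier_coeff L w k - (if (norm k)\<^sup>2 \<le> lam then fourier_coeff L d k else 0))"
    if k: "k \<in> freqs L" for k
    unfolding fc_diff[OF V_L2[OF u] S(1)] fS J_op_fc[OF k] w_def d_def
      fc_diff[OF V_L2[OF u] V_L2[OF v]] fc_diff[OF H_L2[OF leray_H[OF IL(1)]] H_L2[OF leray_H[OF IL(2)]]]
    by (rule arg_cong[of _ _ norm]) (simp add: algebra_simps)
  note e = filter_estimate[OF w dH gL orth Ib lam, of "\<lambda>x. u x - S x"]
  show "(sob_norm L 1 (\<lambda>x. u x - S x))\<^sup>2 \<le> (sob_norm L 1 w)\<^sup>2 + lam * (c1 * h\<^sup>2 * (sob_norm L 1 w)\<^sup>2)"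
     "(sob_norm L 0 (\<lambda>x. u x - S x))\<^sup>2 \<le> (sob_norm L 1 w)\<^sup>2 / lam + c1 * h\<^sup>2 * (sob_norm L 1 w)\<^sup>2"
    using e(2,3) c by blast+
qed

end

section \<open>From geometric decay over the cycles to exponential decay in time\<close>

lemma exp_decay_tendsto:
  fixes K \<alpha> t0 :: real
  assumes "\<alpha> > 0"
  shows "((\<lambda>t. K * exp (- \<alpha> * (t - t0))) \<longlongrightarrow> 0) at_top"
proof -
  have "filterlim (\<lambda>t. - t0 + t) at_top at_top"
    by (rule filterlim_tendsto_add_at_top[OF tendsto_const filterlim_ident])
  then have "filterlim (\<lambda>t. - \<alpha> * (- t0 + t)) at_bot at_top"
    using assms by (intro filterlim_tendsto_neg_mult_at_bot[OF tendsto_const]) auto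
  then have "((\<lambda>t. exp (- \<alpha> * (- t0 + t))) \<longlongrightarrow> 0) at_top"
    by (rule filterlim_compose[OF exp_at_bot])
  then have "((\<lambda>t. K * exp (- \<alpha> * (- t0 + t))) \<longlongrightarrow> 0) at_top" by (rule tendsto_mult_right_zero)
  then show ?thesis by (simp only: add_uminus_conv_diff add.commute[of "- t0"])
qed

text \<open>Within cycle \<open>n\<close> the elapsed time may come close to \<open>n + 1\<close>
  periods, which costs one power of \<gamma>; hence the factor \<open>1 / \<gamma>\<close>.\<close>

lemma geometric_exp_bound:
  fixes \<gamma> \<delta> t t0 :: real
  assumes "0 < \<gamma>" "\<gamma> < 1" "\<delta> > 0" "t < t0 + real (Suc n) * \<delta>"
  shows "\<gamma> ^ n \<le> (1 / \<gamma>) * exp (- (- ln \<gamma> / \<delta>) * (t - t0))"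
proof -
  have "(t - t0) / \<delta> - 1 \<le> real n" using assms(3,4) by (simp add: field_simps)
  then have "real n * ln \<gamma> \<le> ((t - t0) / \<delta> - 1) * ln \<gamma>"
    using assms(1,2) by (intro mult_right_mono_neg) auto
  then have "exp (real n * ln \<gamma>) \<le> exp (((t - t0) / \<delta> - 1) * ln \<gamma>)" by simp
  also have "((t - t0) / \<delta> - 1) * ln \<gamma> = - (- ln \<gamma> / \<delta>) * (t - t0) + - ln \<gamma>"
    by (simp add: field_simps)
  also have "exp \<dots> = exp (- (- ln \<gamma> / \<delta>) * (t - t0)) * exp (- ln \<gamma>)" by (rule exp_add)
  also have "exp (- ln \<gamma>) = 1 / \<gamma>" using assms(1) by (simp add: exp_minus inverse_eq_divide)
  also have "exp (real n * ln \<gamma>) = \<gamma> ^ n" using assms(1) by (simp add: exp_of_nat_mult)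
  finally show ?thesis by (simp add: mult.commute)
qed

theorem theorem3p2:
  fixes L \<nu> t0 \<rho>H \<rho>V c1 :: real
    and f U :: "real \<Rightarrow> field"
  assumes "L > 0" and "\<nu> > 0"
    and "Linf_H L t0 f"
    and "nse_solution L \<nu> f t0 U"
    and "\<And>t. t \<ge> t0 \<Longrightarrow> sob_norm L 0 (U t) \<le> \<rho>H"
    and "\<And>t. t \<ge> t0 \<Longrightarrow> sob_norm L 1 (U t) \<le> \<rho>V"
    and "\<And>t d. t \<ge> t0 \<Longrightarrow> d > 0 \<Longrightarrow>
           (\<integral>\<^sup>+s. sob_sq L 2 (U s) \<partial>lebesgue_on {t..t+d})
             \<le> ennreal ((1 / \<nu> + d * (2 * pi / L)\<^sup>2 / 2) * \<rho>V\<^sup>2)"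
    and "c1 > 0"
  shows "\<forall>\<delta>>0. \<exists>lam>0. \<exists>h>0. \<forall>I u.
           type_I_interpolant L c1 h I \<and> approximating_solution L \<nu> f t0 \<delta> lam I U u \<longrightarrow>
             ((\<lambda>t. sob_norm L 1 (\<lambda>x. U t x - u t x)) \<longlongrightarrow> 0) at_top \<and>
             (\<exists>K>0. \<exists>\<alpha>>0. \<forall>t\<ge>t0.
                sob_norm L 1 (\<lambda>x. U t x - u t x) \<le> K * exp (- \<alpha> * (t - t0)))"
proof (intro allI impI)
  fix \<delta> :: real assume \<delta>: "\<delta> > 0"
  interpret torus L by standard (rule assms)
  note U = assms(4) and \<rho> = assms(6)
  have \<rho>0: "\<rho>V \<ge> 0" using \<rho>[of t0] sob_norm_nonneg[of 1 "U t0"] by simp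
  \<comment> \<open>Bounds the reference field at \<open>t0\<close>, which plays the part of the
    error before the first filtering; the \<open>+ 1\<close> keeps it positive when
    \<open>\<rho>V\<close> is zero.\<close>
  define b0 where "b0 = \<rho>V + 1"
  have b0: "b0 > 0" using \<rho>0 by (simp add: b0_def)
  define m where "m = \<nu> * (2 * pi / L)\<^sup>2"
  have m: "m > 0" using assms(1,2) by (simp add: m_def)
  define q where "q = exp (- (m * \<delta>))"
  have q: "0 < q" "q < 1" using m \<delta> by (simp_all add: q_def)
  \<comment> \<open>A cycle maps a bound \<open>b\<close> to
    \<open>q * (1 + \<eta>) * b + \<eta> * b\<close>, one \<eta> from the filter and one from the
    integral. This is at most \<open>q + 2 * \<eta>\<close> times \<open>b\<close>, which for this
    \<eta> is exactly \<open>\<gamma> * b\<close>.\<close>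
  define \<eta> where "\<eta> = (1 - q) / 4"
  have \<eta>: "0 < \<eta>" "\<eta> \<le> 1/4" using q by (simp_all add: \<eta>_def)
  define \<gamma> where "\<gamma> = (1 + q) / 2"
  have \<gamma>: "0 < \<gamma>" "\<gamma> < 1" using q by (simp_all add: \<gamma>_def)
  \<comment> \<open>\<open>\<rho>V\<close> for the reference field plus
    \<open>\<rho>V + 4 * b0\<close> for the approximation; no filter parameter enters.\<close>
  define R where "R = 2 * \<rho>V + 4 * b0"
  define A where "A = L * nonlin_const * heat_const (5/8) \<nu> * R * (8 * \<delta> powr (1/8))"
  have A0: "A \<ge> 0" unfolding A_def R_def using assms(1) nonlin_const_pos \<rho>0 b0
    by (intro mult_nonneg_nonneg) (auto simp: heat_const_def)
  \<comment> \<open>The fourth power is undone by the exponent -1/4, leaving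
    \<open>A / (2 * A + 1)\<close>, which is at most 1/2.\<close>
  define \<kappa> where "\<kappa> = (2 * A + 1) powr 4"
  have \<kappa>: "\<kappa> > 0" using A0 by (simp add: \<kappa>_def)
  have \<kappa>A: "A * \<kappa> powr (- (1/4)) \<le> 1/2"
  proof -
    have "\<kappa> powr (- (1/4)) = 1 / (2 * A + 1)"
      unfolding \<kappa>_def powr_powr using A0 by (simp add: powr_neg_one)
    moreover have "A * (1 / (2 * A + 1)) \<le> 1/2" using A0 by (simp add: field_simps)
    ultimately show ?thesis by simp
  qed
  have small: "L * nonlin_const * heat_const (5/8) \<nu> * R * \<kappa> powr (- (1/4)) * (8 * \<delta> powr (1/8)) \<le> 1/2"
    using \<kappa>A by (simp add: A_def mult_ac)
  define Q where "Q = L * nonlin_const * sqrt (heat_const (5/8) \<nu> * heat_const (9/8) \<nu>) * R * (8 * \<delta> powr (1/8)) * sqrt (8 * exp (\<kappa> * \<delta>))"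
  have Q0: "Q \<ge> 0" unfolding Q_def R_def using assms(1) nonlin_const_pos \<rho>0 b0
    by (intro mult_nonneg_nonneg) (auto simp: heat_const_def)
  \<comment> \<open>Squared because the cycle estimate contains only \<open>sqrt \<epsilon>\<close>;
    \<open>Q + 1\<close> allows \<open>Q\<close> to vanish.\<close>
  define \<epsilon> where "\<epsilon> = (\<eta> / (Q + 1))\<^sup>2"
  have \<epsilon>: "\<epsilon> > 0" using \<eta> Q0 by (simp add: \<epsilon>_def)
  have Qe: "Q * sqrt \<epsilon> \<le> \<eta>"
  proof -
    have "sqrt \<epsilon> = \<eta> / (Q + 1)" using \<eta> Q0 by (simp add: \<epsilon>_def)
    moreover have "Q * (\<eta> / (Q + 1)) \<le> \<eta>" using \<eta>(1) Q0 by (simp add: pos_divide_le_eq distrib_left mult.commute)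
    ultimately show ?thesis by (simp only:)
  qed
  \<comment> \<open>Half of the allowance \<open>\<epsilon>\<^sup>2\<close> for the squared H-norm
    goes to the unresolved high frequencies, the other half to the interpolation error.\<close>
  define lam where "lam = 2 / \<epsilon>\<^sup>2"
  have lam: "lam > 0" using \<epsilon> by (simp add: lam_def)
  \<comment> \<open>The first entry of the minimum controls the H-norm, the second the V-norm, where
    the interpolation error is amplified by \<open>lam\<close>; so \<open>h\<close> must be chosen
    after \<open>lam\<close>.\<close>
  define h where "h = sqrt (min (\<epsilon>\<^sup>2 / 2) (\<eta> / lam) / c1)"
  have mn: "min (\<epsilon>\<^sup>2 / 2) (\<eta> / lam) > 0" using \<epsilon> \<eta> lam by simp
  have h: "h > 0" using mn assms(8) by (simp add: h_def)
  have h2: "c1 * h\<^sup>2 = min (\<epsilon>\<^sup>2 / 2) (\<eta> / lam)" using mn assms(8) by (simp add: h_def less_imp_le)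
  have he: "lam * (c1 * h\<^sup>2) \<le> \<eta>"
  proof -
    have "lam * (c1 * h\<^sup>2) \<le> lam * (\<eta> / lam)" unfolding h2 using lam by (intro mult_left_mono) auto
    then show ?thesis using lam by simp
  qed
  have hl: "1 / lam + c1 * h\<^sup>2 \<le> \<epsilon>\<^sup>2" unfolding h2 lam_def using \<epsilon> by simp
  have c1: "c1 \<ge> 0" using assms(8) by simp
  show "\<exists>lam>0. \<exists>h>0. \<forall>I u.
           type_I_interpolant L c1 h I \<and> approximating_solution L \<nu> f t0 \<delta> lam I U u \<longrightarrow>
             ((\<lambda>t. sob_norm L 1 (\<lambda>x. U t x - u t x)) \<longlongrightarrow> 0) at_top \<and>
             (\<exists>K>0. \<exists>\<alpha>>0. \<forall>t\<ge>t0.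
                sob_norm L 1 (\<lambda>x. U t x - u t x) \<le> K * exp (- \<alpha> * (t - t0)))"
  proof (rule exI[of _ lam], rule conjI[OF lam], rule exI[of _ h], rule conjI[OF h], intro allI impI)
    fix I u assume a: "type_I_interpolant L c1 h I \<and> approximating_solution L \<nu> f t0 \<delta> lam I U u"
    then have I: "type_I_interpolant L c1 h I" by simp
    define tn where "tn n = t0 + real n * \<delta>" for n :: nat
    obtain un S where
      init: "aeq L (un 0) (J_op L lam I (U t0))" and
      sp: "\<And>n. semi_process L \<nu> f (tn n) (un n) (S n)" and
      upd: "\<And>n. aeq L (un (Suc n)) (\<lambda>x. E_op L lam I (S n (tn (Suc n))) x + J_op L lam I (U (tn (Suc n))) x)" and
      ueq: "\<And>n t. t \<in> {tn n..<tn (Suc n)} \<Longrightarrow> aeq L (u t) (S n t)"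
      using a unfolding approximating_solution_def Let_def tn_def by blast
    have S: "nse_solution L \<nu> f (tn n) (S n)" and Sun: "aeq L (S n (tn n)) (un n)" for n
      using sp[of n] by (auto simp: semi_process_def)
    have tn: "t0 \<le> tn n" "tn (Suc n) = tn n + \<delta>" for n using \<delta> by (auto simp: tn_def algebra_simps)
    have UV: "U t \<in> V L" if "t \<ge> t0" for t using nse_V[OF U that] .
    have SV: "S n t \<in> V L" if "t \<ge> tn n" for n t using nse_V[OF S that] .
    have two: "two_solutions L \<nu> t0 (tn n) f U (S n)" for n
      by unfold_locales (use assms U S tn in auto)
    \<comment> \<open>Bounds the error at time \<open>tn n\<close> just before the
      filtering.\<close>
    define b where "b n = b0 * \<gamma> ^ n" for n
    have b: "0 < b n" "b n \<le> b0" for n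
      using b0 \<gamma> by (auto simp: b_def mult_le_cancel_left1 power_le_one)
    have step: "sob_norm L 1 (\<lambda>x. U t x - S n t x) \<le> 4 * b n \<and>
        sob_norm L 1 (\<lambda>x. U t x - S n t x) \<le> exp (- (m * (t - tn n))) * sob_norm L 1 (\<lambda>x. U (tn n) x - S n (tn n) x) + \<eta> * b n"
      if s1: "sob_norm L 1 (\<lambda>x. U (tn n) x - S n (tn n) x) \<le> (1 + \<eta>) * b n"
        and s0: "sob_norm L 0 (\<lambda>x. U (tn n) x - S n (tn n) x) \<le> \<epsilon> * b n"
        and t: "t \<in> {tn n..tn n + \<delta>}" for n t
    proof -
      interpret two_solutions L \<nu> t0 "tn n" f U "S n" by (rule two)
      have yz: "y t = sob_norm L 1 (\<lambda>x. U t x - S n t x)" "z t = sob_norm L 0 (\<lambda>x. U t x - S n t x)" for t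
        by (simp_all add: y_def z_def w_def)
      have "(1 + \<eta>) * b n \<le> 2 * b n" using b \<eta> by (intro mult_right_mono) (auto simp: less_imp_le)
      then have y2: "y (tn n) \<le> 2 * b n" using s1 unfolding yz by linarith
      have z2: "z (tn n) \<le> \<epsilon> * b n" using s0 unfolding yz .
      have Qe2: "Q * sqrt \<epsilon> \<le> 1/2" using Qe \<eta> by linarith
      have \<rho>': "sob_norm L 1 (U t) \<le> \<rho>V" if "t \<ge> tn n" for t using \<rho> that tn(1)[of n] by simp
      note st = step_estimate[OF \<rho>' b(1,2) y2 z2 less_imp_le[OF \<epsilon>] R_def \<kappa> small Q_def Qe2 t]
      have "Q * sqrt \<epsilon> * b n \<le> \<eta> * b n" using Qe b(1)[of n] by (intro mult_right_mono) auto
      then show ?thesis using st unfolding yz decay_rate_def m_def by linarith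
    qed
    \<comment> \<open>State just after the filtering: the V-norm may have grown by
      \<open>1 + \<eta>\<close>, while the H-norm is now small. Both are inputs of the next cycle.
      The induction step uses the old trajectory at the closed right end of its cycle.\<close>
    have inv: "sob_norm L 1 (\<lambda>x. U (tn n) x - S n (tn n) x) \<le> (1 + \<eta>) * b n \<and>
        sob_norm L 0 (\<lambda>x. U (tn n) x - S n (tn n) x) \<le> \<epsilon> * b n" for n
    proof (induction n)
      case 0
      have t00: "tn 0 = t0" by (simp add: tn_def)
      have SL: "S 0 t0 \<in> L2 L" using SV[of 0 t0] t00 V_L2 by simp
      have ae: "aeq L (S 0 t0) (J_op L lam I (U t0))" using aeq_trans[OF Sun[of 0] init] t00 by simp
      have Ub: "sob_norm L 1 (U t0) \<le> b 0" using \<rho>[of t0] by (simp add: b_def b0_def)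
      from filter_bounds[OF initial_filter[OF I UV[OF order_refl] lam SL ae] Ub lam less_imp_le[OF \<eta>(1)] he less_imp_le[OF \<epsilon>] hl c1]
      show ?case unfolding t00 by blast
    next
      case (Suc n)
      let ?t = "tn (Suc n)"
      have tt: "?t \<in> {tn n..tn n + \<delta>}" using \<delta> tn(2)[of n] by simp
      have "sob_norm L 1 (\<lambda>x. U ?t x - S n ?t x) \<le> exp (- (m * (?t - tn n))) * sob_norm L 1 (\<lambda>x. U (tn n) x - S n (tn n) x) + \<eta> * b n"
        using step[OF conjunct1[OF Suc] conjunct2[OF Suc] tt] by blast
      also have "exp (- (m * (?t - tn n))) = q" by (simp add: q_def tn)
      also have "q * sob_norm L 1 (\<lambda>x. U (tn n) x - S n (tn n) x) \<le> q * ((1 + \<eta>) * b n)"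
        using Suc q by (intro mult_left_mono) auto
      also have "q * ((1 + \<eta>) * b n) + \<eta> * b n = (q + (q * \<eta> + \<eta>)) * b n" by (simp add: algebra_simps)
      also have "\<dots> \<le> (q + (1 * \<eta> + \<eta>)) * b n"
        using q \<eta> b(1)[of n] by (intro mult_right_mono add_mono) auto
      also have "\<dots> = b (Suc n)" by (simp add: b_def \<gamma>_def \<eta>_def field_simps)
      finally have wb: "sob_norm L 1 (\<lambda>x. U ?t x - S n ?t x) \<le> b (Suc n)" by simp
      have SL: "S (Suc n) ?t \<in> L2 L" by (intro V_L2 SV order_refl)
      have ae: "aeq L (S (Suc n) ?t) (\<lambda>x. E_op L lam I (S n ?t) x + J_op L lam I (U ?t) x)"
        by (rule aeq_trans[OF Sun upd])
      have UVt: "U ?t \<in> V L" "S n ?t \<in> V L"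
        by (rule UV[OF tn(1)], rule SV) (use \<delta> tn(2)[of n] in simp)
      from filter_bounds[OF update_filter[OF I UVt lam SL ae] wb lam less_imp_le[OF \<eta>(1)] he less_imp_le[OF \<epsilon>] hl c1]
      show ?case by blast
    qed
    define \<alpha> where "\<alpha> = - ln \<gamma> / \<delta>"
    have \<alpha>: "\<alpha> > 0" unfolding \<alpha>_def using \<gamma> \<delta> by (intro divide_pos_pos) simp_all
    define K where "K = 4 * b0 * (1 / \<gamma>)"
    have K: "K > 0" using b0 \<gamma> by (simp add: K_def)
    have bound: "sob_norm L 1 (\<lambda>x. U t x - u t x) \<le> K * exp (- \<alpha> * (t - t0))" if t: "t \<ge> t0" for t
    proof -
      \<comment> \<open>The cycle containing \<open>t\<close>.\<close>
      define n where "n = nat \<lfloor>(t - t0) / \<delta>\<rfloor>"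
      have f: "real n \<le> (t - t0) / \<delta>" "(t - t0) / \<delta> < real n + 1"
        using t \<delta> by (auto simp: n_def of_nat_nat)
      have tt: "tn n \<le> t" "t < tn (Suc n)" using f \<delta> by (auto simp: tn_def field_simps)
      have Sv: "S n t \<in> V L" by (rule SV[OF tt(1)])
      have "aeq L (u t) (S n t)" using ueq tt by simp
      then have ae: "aeq L (\<lambda>x. U t x - u t x) (\<lambda>x. U t x - S n t x)"
        unfolding aeq_def by eventually_elim simp
      have dL: "(\<lambda>x. U t x - S n t x) \<in> L2 L" by (intro L2_diff V_L2 UV Sv t)
      have "sob_norm L 1 (\<lambda>x. U t x - u t x) = sob_norm L 1 (\<lambda>x. U t x - S n t x)"
        by (rule sob_norm_aeq(1)[OF ae aeq_measurable[OF ae L2_measurable[OF dL]] L2_measurable[OF dL]])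
      also have "\<dots> \<le> 4 * b n" using step[of n t] inv[of n] tt tn(2)[of n] by auto
      also have "\<dots> = 4 * b0 * \<gamma> ^ n" by (simp add: b_def)
      also have "\<dots> \<le> 4 * b0 * ((1 / \<gamma>) * exp (- \<alpha> * (t - t0)))"
        using geometric_exp_bound[OF \<gamma> \<delta>, of t t0 n] tt(2) b0 unfolding \<alpha>_def tn_def
        by (intro mult_left_mono) auto
      finally show ?thesis by (simp add: K_def)
    qed
    have ev: "\<forall>\<^sub>F t in at_top. sob_norm L 1 (\<lambda>x. U t x - u t x) \<le> K * exp (- \<alpha> * (t - t0))"
      using eventually_ge_at_top[of t0] by eventually_elim (rule bound)
    have "((\<lambda>t. sob_norm L 1 (\<lambda>x. U t x - u t x)) \<longlongrightarrow> 0) at_top"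
      by (rule tendsto_sandwich[OF always_eventually ev tendsto_const exp_decay_tendsto[OF \<alpha>]])
         (simp add: sob_norm_nonneg)
    then show "((\<lambda>t. sob_norm L 1 (\<lambda>x. U t x - u t x)) \<longlongrightarrow> 0) at_top \<and>
             (\<exists>K>0. \<exists>\<alpha>>0. \<forall>t\<ge>t0.
                sob_norm L 1 (\<lambda>x. U t x - u t x) \<le> K * exp (- \<alpha> * (t - t0)))"
      using bound K \<alpha> by blast
  qed
qed

end
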